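(* Let $\mathfrak{g}$ be a finite-dimensional semisimple Lie algebra over an algebraically closed field $\Bbbk$ of characteristic $0$, with Cartan subalgebra $\mathfrak{h}$, root system $R$ and base $\Pi$. For all subsets $S,T\subset\Pi$, $$\chi(\mathfrak{g}_{S,T})\leqslant \operatorname{rk}(\mathfrak{g})+\operatorname{card}\mathcal{K}(S)+\operatorname{card}\mathcal{K}(T)-2\dim E_{S,T}.$$
   Context: Index: for a finite-dimensional Lie algebra $\mathfrak{a}$ and $f\in\mathfrak{a}^*$, let $\mathfrak{a}^{(f)}=\{X\in\mathfrak{a}: f([X,Y])=0\ \forall Y\in\mathfrak{a}\}$; the index is $\chi(\mathfrak{a})=\min_{f\in\mathfrak{a}^*}\dim\mathfrak{a}^{(f)}$. Notation: $\mathfrak{g}^\alpha$ is the root space of $\alpha\in R$; $R_+$, $R_-$ are the positive/negative roots w.r.t. $\Pi$; for $S\subset\Pi$, $R^S=R\cap\mathbb{Z}S$, $R_+^S=R\cap\mathbb{N}S$, $R_-^S=R^S\setminus R_+^S$. For $\alpha\in R$, $H_\alpha$ is the unique element of $[\mathfrak{g}^\alpha,\mathfrak{g}^{-\alpha}]$ with $\alpha(H_\alpha)=2$, and $\langle\lambda,\alpha^\vee\rangle=\lambda(H_\alpha)$. If $S\subset\Pi$ is connected (in the Dynkin diagram), $R^S$ is irreducible with base $S$ and $\varepsilon_S$ denotes its highest root. The set $\mathcal{K}(S)$ of subsets of $S$ is defined by induction on $\operatorname{card}S$: $\mathcal{K}(\emptyset)=\emptyset$; if $S_1,\dots,S_r$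 are the connected components of $S$, $\mathcal{K}(S)=\mathcal{K}(S_1)\cup\dots\cup\mathcal{K}(S_r)$; if $S$ is connected, $\mathcal{K}(S)=\{S\}\cup\mathcal{K}(\{\alpha\in S:\langle\alpha,\varepsilon_S^\vee\rangle=0\})$. Every $K\in\mathcal{K}(S)$ is connected. $E_{S,T}$ is the subspace of $\mathfrak{h}^*$ spanned by the $\varepsilon_K$, $K\in\mathcal{K}(S)\cup\mathcal{K}(T)$. Finally $\mathfrak{g}_{S,T}=\mathfrak{h}\oplus\sum_{\alpha\in R_+^S}\mathfrak{g}^\alpha\oplus\sum_{\alpha\in R_-^T}\mathfrak{g}^\alpha$, and $\operatorname{rk}(\mathfrak{g})=\dim\mathfrak{h}$. *)

theory Defs
  imports "HOL-Computational_Algebra.Polynomial" "HOL-Library.Function_Algebras"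
begin

definition lie_algebra :: "('k::field \<Rightarrow> 'g::ab_group_add \<Rightarrow> 'g) \<Rightarrow> ('g \<Rightarrow> 'g \<Rightarrow> 'g) \<Rightarrow> bool" where
  "lie_algebra sc br \<longleftrightarrow> vector_space sc \<and>
    (\<forall>x y z. br (x + y) z = br x z + br y z) \<and>
    (\<forall>x y z. br x (y + z) = br x y + br x z) \<and>
    (\<forall>c x y. br (sc c x) y = sc c (br x y)) \<and>
    (\<forall>c x y. br x (sc c y) = sc c (br x y)) \<and>
    (\<forall>x. br x x = 0) \<and>
    (\<forall>x y z. br x (br y z) + br y (br z x) + br z (br x y) = 0)"

definition finite_dim :: "('k::field \<Rightarrow> 'g::ab_group_add \<Rightarrow> 'g) \<Rightarrow> bool" where
  "finite_dim sc \<longleftrightarrow> (\<exists>B. finite B \<and> module.span sc B = UNIV)"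

definition bracket_span :: "('k::field \<Rightarrow> 'g::ab_group_add \<Rightarrow> 'g) \<Rightarrow> ('g \<Rightarrow> 'g \<Rightarrow> 'g) \<Rightarrow> 'g set \<Rightarrow> 'g set \<Rightarrow> 'g set" where
  "bracket_span sc br A B = module.span sc {br x y | x y. x \<in> A \<and> y \<in> B}"

definition lie_subalgebra :: "('k::field \<Rightarrow> 'g::ab_group_add \<Rightarrow> 'g) \<Rightarrow> ('g \<Rightarrow> 'g \<Rightarrow> 'g) \<Rightarrow> 'g set \<Rightarrow> bool" where
  "lie_subalgebra sc br A \<longleftrightarrow> module.subspace sc A \<and> (\<forall>x\<in>A. \<forall>y\<in>A. br x y \<in> A)"

definition lie_ideal :: "('k::field \<Rightarrow> 'g::ab_group_add \<Rightarrow> 'g) \<Rightarrow> ('g \<Rightarrow> 'g \<Rightarrow> 'g) \<Rightarrow> 'g set \<Rightarrow> bool" where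
  "lie_ideal sc br I \<longleftrightarrow> module.subspace sc I \<and> (\<forall>x\<in>I. \<forall>y. br y x \<in> I)"

fun derived_series :: "('k::field \<Rightarrow> 'g::ab_group_add \<Rightarrow> 'g) \<Rightarrow> ('g \<Rightarrow> 'g \<Rightarrow> 'g) \<Rightarrow> 'g set \<Rightarrow> nat \<Rightarrow> 'g set" where
  "derived_series sc br I 0 = I"
| "derived_series sc br I (Suc n) =
     bracket_span sc br (derived_series sc br I n) (derived_series sc br I n)"

definition solvable :: "('k::field \<Rightarrow> 'g::ab_group_add \<Rightarrow> 'g) \<Rightarrow> ('g \<Rightarrow> 'g \<Rightarrow> 'g) \<Rightarrow> 'g set \<Rightarrow> bool" where
  "solvable sc br I \<longleftrightarrow> (\<exists>n. derived_series sc br I n = {0})"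

definition semisimple :: "('k::field \<Rightarrow> 'g::ab_group_add \<Rightarrow> 'g) \<Rightarrow> ('g \<Rightarrow> 'g \<Rightarrow> 'g) \<Rightarrow> bool" where
  "semisimple sc br \<longleftrightarrow> lie_algebra sc br \<and>
     (\<forall>I. lie_ideal sc br I \<and> solvable sc br I \<longrightarrow> I = {0})"

fun lower_central :: "('k::field \<Rightarrow> 'g::ab_group_add \<Rightarrow> 'g) \<Rightarrow> ('g \<Rightarrow> 'g \<Rightarrow> 'g) \<Rightarrow> 'g set \<Rightarrow> nat \<Rightarrow> 'g set" where
  "lower_central sc br A 0 = A"
| "lower_central sc br A (Suc n) = bracket_span sc br A (lower_central sc br A n)"

definition cartan :: "('k::field \<Rightarrow> 'g::ab_group_add \<Rightarrow> 'g) \<Rightarrow> ('g \<Rightarrow> 'g \<Rightarrow> 'g) \<Rightarrow> 'g set \<Rightarrow> bool" where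
  "cartan sc br h \<longleftrightarrow> lie_subalgebra sc br h \<and> (\<exists>n. lower_central sc br h n = {0}) \<and>
     {x. \<forall>y\<in>h. br x y \<in> h} = h"

definition dual_on :: "('k::field \<Rightarrow> 'g::ab_group_add \<Rightarrow> 'g) \<Rightarrow> 'g set \<Rightarrow> ('g \<Rightarrow> 'k) \<Rightarrow> bool" where
  "dual_on sc V f \<longleftrightarrow> (\<forall>x\<in>V. \<forall>y\<in>V. f (x + y) = f x + f y) \<and> (\<forall>c. \<forall>x\<in>V. f (sc c x) = c * f x)"

definition hdual :: "('k::field \<Rightarrow> 'g::ab_group_add \<Rightarrow> 'g) \<Rightarrow> 'g set \<Rightarrow> ('g \<Rightarrow> 'k) set" where
  "hdual sc h = {f. dual_on sc h f \<and> (\<forall>x. x \<notin> h \<longrightarrow> f x = 0)}"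

definition fscale :: "'k::field \<Rightarrow> ('g \<Rightarrow> 'k) \<Rightarrow> ('g \<Rightarrow> 'k)" where
  "fscale c f = (\<lambda>x. c * f x)"

definition root_space :: "('k::field \<Rightarrow> 'g::ab_group_add \<Rightarrow> 'g) \<Rightarrow> ('g \<Rightarrow> 'g \<Rightarrow> 'g) \<Rightarrow> 'g set \<Rightarrow> ('g \<Rightarrow> 'k) \<Rightarrow> 'g set" where
  "root_space sc br h \<alpha> = {x. \<forall>H\<in>h. br H x = sc (\<alpha> H) x}"

definition roots :: "('k::field \<Rightarrow> 'g::ab_group_add \<Rightarrow> 'g) \<Rightarrow> ('g \<Rightarrow> 'g \<Rightarrow> 'g) \<Rightarrow> 'g set \<Rightarrow> ('g \<Rightarrow> 'k) set" where
  "roots sc br h = {\<alpha> \<in> hdual sc h. \<alpha> \<noteq> 0 \<and> root_space sc br h \<alpha> \<noteq> {0}}"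

definition int_comb :: "('g \<Rightarrow> 'k::field) set \<Rightarrow> ('g \<Rightarrow> 'k) set" where
  "int_comb S = {(\<lambda>x. \<Sum>\<alpha>\<in>S. of_int (c \<alpha>) * \<alpha> x) | c. True}"

definition nat_comb :: "('g \<Rightarrow> 'k::field) set \<Rightarrow> ('g \<Rightarrow> 'k) set" where
  "nat_comb S = {(\<lambda>x. \<Sum>\<alpha>\<in>S. of_nat (c \<alpha>) * \<alpha> x) | c. True}"

definition is_base :: "('k::field \<Rightarrow> 'g::ab_group_add \<Rightarrow> 'g) \<Rightarrow> ('g \<Rightarrow> 'g \<Rightarrow> 'g) \<Rightarrow> 'g set \<Rightarrow> ('g \<Rightarrow> 'k) set \<Rightarrow> bool" where
  "is_base sc br h B \<longleftrightarrow> finite B \<and> B \<subseteq> roots sc br h \<and> \<not> module.dependent fscale B \<and>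
     (\<forall>\<beta>\<in>roots sc br h. \<exists>c :: ('g \<Rightarrow> 'k) \<Rightarrow> int.
        ((\<forall>\<alpha>\<in>B. 0 \<le> c \<alpha>) \<or> (\<forall>\<alpha>\<in>B. c \<alpha> \<le> 0)) \<and>
        \<beta> = (\<lambda>x. \<Sum>\<alpha>\<in>B. of_int (c \<alpha>) * \<alpha> x))"

definition rootsS :: "('k::field \<Rightarrow> 'g::ab_group_add \<Rightarrow> 'g) \<Rightarrow> ('g \<Rightarrow> 'g \<Rightarrow> 'g) \<Rightarrow> 'g set \<Rightarrow> ('g \<Rightarrow> 'k) set \<Rightarrow> ('g \<Rightarrow> 'k) set" where
  "rootsS sc br h S = roots sc br h \<inter> int_comb S"

definition rootsS_pos :: "('k::field \<Rightarrow> 'g::ab_group_add \<Rightarrow> 'g) \<Rightarrow> ('g \<Rightarrow> 'g \<Rightarrow> 'g) \<Rightarrow> 'g set \<Rightarrow> ('g \<Rightarrow> 'k) set \<Rightarrow> ('g \<Rightarrow> 'k) set" where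
  "rootsS_pos sc br h S = roots sc br h \<inter> nat_comb S"

definition rootsS_neg :: "('k::field \<Rightarrow> 'g::ab_group_add \<Rightarrow> 'g) \<Rightarrow> ('g \<Rightarrow> 'g \<Rightarrow> 'g) \<Rightarrow> 'g set \<Rightarrow> ('g \<Rightarrow> 'k) set \<Rightarrow> ('g \<Rightarrow> 'k) set" where
  "rootsS_neg sc br h S = rootsS sc br h S - rootsS_pos sc br h S"

definition coroot :: "('k::field \<Rightarrow> 'g::ab_group_add \<Rightarrow> 'g) \<Rightarrow> ('g \<Rightarrow> 'g \<Rightarrow> 'g) \<Rightarrow> 'g set \<Rightarrow> ('g \<Rightarrow> 'k) \<Rightarrow> 'g" where
  "coroot sc br h \<alpha> = (THE H. H \<in> bracket_span sc br (root_space sc br h \<alpha>) (root_space sc br h (- \<alpha>))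
                              \<and> \<alpha> H = 2)"

definition pairing :: "('k::field \<Rightarrow> 'g::ab_group_add \<Rightarrow> 'g) \<Rightarrow> ('g \<Rightarrow> 'g \<Rightarrow> 'g) \<Rightarrow> 'g set \<Rightarrow> ('g \<Rightarrow> 'k) \<Rightarrow> ('g \<Rightarrow> 'k) \<Rightarrow> 'k" where
  "pairing sc br h l \<alpha> = l (coroot sc br h \<alpha>)"

definition highest_root :: "('k::field \<Rightarrow> 'g::ab_group_add \<Rightarrow> 'g) \<Rightarrow> ('g \<Rightarrow> 'g \<Rightarrow> 'g) \<Rightarrow> 'g set \<Rightarrow> ('g \<Rightarrow> 'k) set \<Rightarrow> ('g \<Rightarrow> 'k)" where
  "highest_root sc br h S = (THE \<epsilon>. \<epsilon> \<in> rootsS_pos sc br h S \<and>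
      (\<forall>\<beta>\<in>rootsS sc br h S. \<epsilon> - \<beta> \<in> nat_comb S))"

definition dynkin_adj :: "('k::field \<Rightarrow> 'g::ab_group_add \<Rightarrow> 'g) \<Rightarrow> ('g \<Rightarrow> 'g \<Rightarrow> 'g) \<Rightarrow> 'g set \<Rightarrow> ('g \<Rightarrow> 'k) \<Rightarrow> ('g \<Rightarrow> 'k) \<Rightarrow> bool" where
  "dynkin_adj sc br h \<alpha> \<beta> \<longleftrightarrow> \<alpha> \<noteq> \<beta> \<and> pairing sc br h \<alpha> \<beta> \<noteq> 0"

definition dynkin_connected :: "('k::field \<Rightarrow> 'g::ab_group_add \<Rightarrow> 'g) \<Rightarrow> ('g \<Rightarrow> 'g \<Rightarrow> 'g) \<Rightarrow> 'g set \<Rightarrow> ('g \<Rightarrow> 'k) set \<Rightarrow> bool" where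
  "dynkin_connected sc br h S \<longleftrightarrow> S \<noteq> {} \<and>
     (\<forall>\<alpha>\<in>S. \<forall>\<beta>\<in>S. (\<lambda>a b. a \<in> S \<and> b \<in> S \<and> dynkin_adj sc br h a b)\<^sup>*\<^sup>* \<alpha> \<beta>)"

definition dynkin_component :: "('k::field \<Rightarrow> 'g::ab_group_add \<Rightarrow> 'g) \<Rightarrow> ('g \<Rightarrow> 'g \<Rightarrow> 'g) \<Rightarrow> 'g set \<Rightarrow> ('g \<Rightarrow> 'k) set \<Rightarrow> ('g \<Rightarrow> 'k) set \<Rightarrow> bool" where
  "dynkin_component sc br h C S \<longleftrightarrow> C \<subseteq> S \<and> dynkin_connected sc br h C \<and>
     (\<forall>C'. C \<subseteq> C' \<and> C' \<subseteq> S \<and> dynkin_connected sc br h C' \<longrightarrow> C' = C)"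

definition orth_part :: "('k::field \<Rightarrow> 'g::ab_group_add \<Rightarrow> 'g) \<Rightarrow> ('g \<Rightarrow> 'g \<Rightarrow> 'g) \<Rightarrow> 'g set \<Rightarrow> ('g \<Rightarrow> 'k) set \<Rightarrow> ('g \<Rightarrow> 'k) set" where
  "orth_part sc br h S = {\<alpha> \<in> S. pairing sc br h \<alpha> (highest_root sc br h S) = 0}"

text \<open>inK S K means K is in the set K(S) (least solution of the recursive definition).\<close>
inductive inK :: "('k::field \<Rightarrow> 'g::ab_group_add \<Rightarrow> 'g) \<Rightarrow> ('g \<Rightarrow> 'g \<Rightarrow> 'g) \<Rightarrow> 'g set \<Rightarrow> ('g \<Rightarrow> 'k) set \<Rightarrow> ('g \<Rightarrow> 'k) set \<Rightarrow> bool"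
  for sc br h where
  self: "dynkin_connected sc br h S \<Longrightarrow> inK sc br h S S"
| orth: "dynkin_connected sc br h S \<Longrightarrow> inK sc br h (orth_part sc br h S) K \<Longrightarrow> inK sc br h S K"
| comp: "\<not> dynkin_connected sc br h S \<Longrightarrow> dynkin_component sc br h C S \<Longrightarrow> inK sc br h C K \<Longrightarrow> inK sc br h S K"

definition Kset :: "('k::field \<Rightarrow> 'g::ab_group_add \<Rightarrow> 'g) \<Rightarrow> ('g \<Rightarrow> 'g \<Rightarrow> 'g) \<Rightarrow> 'g set \<Rightarrow> ('g \<Rightarrow> 'k) set \<Rightarrow> ('g \<Rightarrow> 'k) set set" where
  "Kset sc br h S = {K. inK sc br h S K}"

definition E_ST :: "('k::field \<Rightarrow> 'g::ab_group_add \<Rightarrow> 'g) \<Rightarrow> ('g \<Rightarrow> 'g \<Rightarrow> 'g) \<Rightarrow> 'g set \<Rightarrow> ('g \<Rightarrow> 'k) set \<Rightarrow> ('g \<Rightarrow> 'k) set \<Rightarrow> ('g \<Rightarrow> 'k) set" where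
  "E_ST sc br h S T = module.span fscale (highest_root sc br h ` (Kset sc br h S \<union> Kset sc br h T))"

definition g_ST :: "('k::field \<Rightarrow> 'g::ab_group_add \<Rightarrow> 'g) \<Rightarrow> ('g \<Rightarrow> 'g \<Rightarrow> 'g) \<Rightarrow> 'g set \<Rightarrow> ('g \<Rightarrow> 'k) set \<Rightarrow> ('g \<Rightarrow> 'k) set \<Rightarrow> 'g set" where
  "g_ST sc br h S T = module.span sc (h \<union> \<Union> (root_space sc br h ` rootsS_pos sc br h S)
                                       \<union> \<Union> (root_space sc br h ` rootsS_neg sc br h T))"

definition lie_index :: "('k::field \<Rightarrow> 'g::ab_group_add \<Rightarrow> 'g) \<Rightarrow> ('g \<Rightarrow> 'g \<Rightarrow> 'g) \<Rightarrow> 'g set \<Rightarrow> nat" where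
  "lie_index sc br a = (LEAST n. \<exists>f. dual_on sc a f \<and>
      vector_space.dim sc {X \<in> a. \<forall>Y\<in>a. f (br X Y) = 0} = n)"

end

theory Submission
  imports Defs
begin

text \<open>
The index of a Lie algebra is at most the corank of the form \<open>f([X,Y])\<close> for any single linear form
\<open>f\<close>. Rescale root vectors by powers of \<open>t\<close> given by the absolute height of the root. As \<open>t\<close> tends
to \<open>0\<close>, \<open>g_ST\<close> degenerates to the algebra in which the positive part coming from \<open>S\<close> commutes with
the negative part coming from \<open>T\<close>. For the form \<open>f\<close> which is the sum of the coordinates along the
highest roots \<open>\<epsilon>\<^sub>K\<close>, \<open>K \<in> \<K>(S)\<close>, and the lowest roots \<open>-\<epsilon>\<^sub>L\<close>, \<open>L \<in> \<K>(T)\<close>, the degenerate matrix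
is monomial on a suitable family of vectors: a root \<open>\<alpha>\<close> in the Heisenberg piece of \<open>K\<close> pairs only
with \<open>\<epsilon>\<^sub>K - \<alpha>\<close>, and the root vectors of a maximal independent set of the \<open>\<epsilon>\<^sub>K\<close> pair with a dual family
in the Cartan subalgebra. Nonsingularity persists for some \<open>t \<noteq> 0\<close>, and counting gives the bound.

The structure of semisimple Lie algebras is obtained from generalized weight spaces: the trace of a
commutator \<open>[x,y]\<close>, with \<open>x\<close> and \<open>y\<close> of opposite weights \<open>\<alpha>\<close> and \<open>-\<alpha>\<close>, vanishes on every \<open>\<alpha>\<close>-string,
so every weight is a rational multiple of \<open>\<alpha>\<close> on it. Hence the homogeneous elements of the radical of
the Killing form act nilpotently, and Engel's theorem in Jacobson's form for sets closed under
the bracket produces an abelian ideal unless that radical is zero.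
\<close>

section \<open>Traces of endomorphisms on subspaces\<close>

text \<open>At \<open>t = 1\<close> the form is not monomial: a root of \<open>S\<close> minus a
  root of \<open>T\<close> may again be a highest root, and such mixed entries hide the rank. The
  entry with weights \<open>w\<close>, \<open>w'\<close> and \<open>\<omega> = w + w'\<close>
  carries \<open>t\<close> to the power |w| + |w'| - |\<omega>| in absolute heights, which is
  positive exactly when \<open>w\<close> and \<open>w'\<close> have opposite signs; so precisely the
  mixed entries disappear at 0. The field has no topology, and the limit becomes the remark that a
  polynomial with nonzero value at 0 has a nonzero value at some other point of an infinite field.
  The numbers in the bound are the size of the block. With W the set of roots of
  \<open>g_ST\<close>, all signed highest roots are removed from W, and a basis of their span is put
  back twice, as root vectors and through dual elements of \<open>h\<close>: card W - card K(S) -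
  card K(T) + 2 dim E vectors in a space of dimension rk + card W. The field has no order either, so
  positivity arguments are moved to the rationals (Killing squares) or to the integers
  (\<open>cartan_int\<close>).\<close>

context finite_dimensional_vector_space
begin

abbreviation endo :: "('b \<Rightarrow> 'b) \<Rightarrow> bool" where
  "endo T \<equiv> Vector_Spaces.linear scale scale T"

lemma endo_iff: "endo T \<longleftrightarrow> (\<forall>x y. T (x + y) = T x + T y) \<and> (\<forall>c x. T (scale c x) = scale c (T x))"
  by (simp add: Vector_Spaces.linear_iff vector_space_axioms)

lemma endo_compose: "endo T \<Longrightarrow> endo S \<Longrightarrow> endo (\<lambda>x. T (S x))"
  by (simp add: endo_iff)

lemma endo_add: "endo T \<Longrightarrow> endo S \<Longrightarrow> endo (\<lambda>x. T x + S x)"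
  by (simp add: endo_iff scale_right_distrib add_ac)

lemma endo_diff: "endo T \<Longrightarrow> endo S \<Longrightarrow> endo (\<lambda>x. T x - S x)"
  by (simp add: endo_iff scale_right_diff_distrib)

lemma endo_scale: "endo T \<Longrightarrow> endo (\<lambda>x. scale c (T x))"
  by (simp add: endo_iff scale_right_distrib mult.commute)

lemma endo_ident: "endo (\<lambda>x. x)" "endo (scale c)"
  by (simp_all add: endo_iff scale_right_distrib mult.commute)

lemma representation_image:
  assumes "independent b" "finite b" "independent c" "finite c" "endo T" "v \<in> span c" "\<And>y. y \<in> c \<Longrightarrow> T y \<in> span b"
  shows "representation b (T v) x = (\<Sum>y\<in>c. representation c v y * representation b (T y) x)"
proof -
  interpret T: Vector_Spaces.linear scale scale T by fact
  have "v = (\<Sum>y\<in>c. scale (representation c v y) y)"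
    using sum_representation_eq[OF assms(3,6,4)] by auto
  then have "T v = (\<Sum>y\<in>c. scale (representation c v y) (T y))"
    by (metis (no_types, lifting) T.scale T.sum sum.cong)
  then have "representation b (T v) x = (\<Sum>y\<in>c. representation b (scale (representation c v y) (T y)) x)"
    using assms by (simp add: representation_sum span_scale)
  then show ?thesis using assms by (simp add: representation_scale)
qed

definition basis_trace :: "'b set \<Rightarrow> ('b \<Rightarrow> 'b) \<Rightarrow> 'a" where
  "basis_trace b T = (\<Sum>x\<in>b. representation b (T x) x)"

text \<open>Two bases on purpose: with \<open>S\<close> the identity this yields independence of the
  trace from the basis, with \<open>b = c\<close> it is tr(TS) = tr(ST).\<close>

lemma basis_trace_comm:
  assumes "independent b" "independent c" "endo T" "endo S"
    and "\<And>x. x \<in> span b \<Longrightarrow> S x \<in> span c" "\<And>x. x \<in> span c \<Longrightarrow> T x \<in> span b"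
  shows "basis_trace b (\<lambda>x. T (S x)) = basis_trace c (\<lambda>x. S (T x))"
proof -
  have f: "finite b" "finite c" using assms finiteI_independent by auto
  have "basis_trace b (\<lambda>x. T (S x)) =
    (\<Sum>x\<in>b. \<Sum>y\<in>c. representation c (S x) y * representation b (T y) x)"
    unfolding basis_trace_def
    by (intro sum.cong refl representation_image) (use assms f span_base in auto)
  also have "\<dots> = (\<Sum>y\<in>c. \<Sum>x\<in>b. representation b (T y) x * representation c (S x) y)"
    by (subst sum.swap) (simp add: mult.commute)
  also have "\<dots> = basis_trace c (\<lambda>x. S (T x))"
    unfolding basis_trace_def
    by (intro sum.cong refl representation_image[symmetric]) (use assms f span_base in auto)
  finally show ?thesis .
qed

text \<open>The operator stays a map on the whole space and the subspace is an argument, so one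
  operator can be traced on many weight spaces. For linear \<open>T\<close> preserving
  \<open>U\<close> the choice is irrelevant by \<open>trace_on_basis\<close>.\<close>

definition trace_on :: "'b set \<Rightarrow> ('b \<Rightarrow> 'b) \<Rightarrow> 'a" where
  "trace_on U T = basis_trace (SOME b. independent b \<and> span b = U) T"

lemma subspace_basis: 
  assumes "subspace U" obtains b where "independent b" "span b = U" "finite b" "card b = dim U"
proof -
  obtain b where "b \<subseteq> U" "independent b" "U \<subseteq> span b" "card b = dim U"
    using basis_exists by blast
  then show ?thesis
    using that finiteI_independent span_minimal[OF _ assms] by (metis subset_antisym)
qed

lemma trace_on_basis:
  assumes "independent b" "span b = U" "endo T" "\<And>x. x \<in> U \<Longrightarrow> T x \<in> U"
  shows "trace_on U T = basis_trace b T"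
proof -
  let ?c = "SOME b. independent b \<and> span b = U"
  have c: "independent ?c \<and> span ?c = U" by (rule someI) (use assms in auto)
  show ?thesis unfolding trace_on_def
    using basis_trace_comm[of ?c b T "\<lambda>x. x"] c assms endo_ident by auto
qed

lemma trace_on_comm:
  assumes "subspace U" "endo T" "endo S" "\<And>x. x \<in> U \<Longrightarrow> S x \<in> U" "\<And>x. x \<in> U \<Longrightarrow> T x \<in> U"
  shows "trace_on U (\<lambda>x. T (S x)) = trace_on U (\<lambda>x. S (T x))"
proof -
  obtain b where b: "independent b" "span b = U" using subspace_basis[OF assms(1)] .
  have "endo (\<lambda>x. T (S x))" "endo (\<lambda>x. S (T x))"
    using assms endo_compose by blast+
  then show ?thesis using basis_trace_comm[of b b T S] assms b by (simp add: trace_on_basis[OF b])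
qed

lemma trace_on_add:
  assumes "subspace U" "endo T" "endo S" "\<And>x. x \<in> U \<Longrightarrow> S x \<in> U" "\<And>x. x \<in> U \<Longrightarrow> T x \<in> U"
  shows "trace_on U (\<lambda>x. T x + S x) = trace_on U T + trace_on U S"
proof -
  obtain b where b: "independent b" "span b = U" using subspace_basis[OF assms(1)] .
  have "endo (\<lambda>x. T x + S x)" using assms endo_add by blast
  then show ?thesis using assms b
    by (auto simp: trace_on_basis[OF b] subspace_add basis_trace_def representation_add span_base 
      sum.distrib[symmetric] intro!: sum.cong)
qed

lemma trace_on_scale:
  assumes "subspace U" "endo T" "\<And>x. x \<in> U \<Longrightarrow> T x \<in> U"
  shows "trace_on U (\<lambda>x. scale c (T x)) = c * trace_on U T"
proof -
  obtain b where b: "independent b" "span b = U" using subspace_basis[OF assms(1)] .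
  have "endo (\<lambda>x. scale c (T x))" using assms endo_scale by blast
  then show ?thesis using assms b
    by (auto simp: trace_on_basis[OF b] subspace_scale basis_trace_def representation_scale span_base 
      sum_distrib_left intro!: sum.cong)
qed

lemma trace_on_id:
  assumes "subspace U" shows "trace_on U (\<lambda>x. scale c x) = c * of_nat (dim U)"
proof -
  obtain b where b: "independent b" "span b = U" "card b = dim U" using subspace_basis[OF assms(1)] .
  have "basis_trace b (\<lambda>x. scale c x) = (\<Sum>x\<in>b. c)" unfolding basis_trace_def
    by (rule sum.cong) (use b in \<open>auto simp: representation_scale span_base representation_basis\<close>)
  moreover have "endo (\<lambda>x. scale c x)" by (rule endo_ident)
  ultimately show ?thesis
    using b assms by (simp add: trace_on_basis[OF b(1,2)] subspace_scale mult.commute)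
qed

lemma trace_on_cong:
  assumes "subspace U" "\<And>x. x \<in> U \<Longrightarrow> T x = S x"
  shows "trace_on U T = trace_on U S"
proof -
  let ?c = "SOME b. independent b \<and> span b = U"
  have c: "independent ?c \<and> span ?c = U" 
    by (rule someI_ex, rule subspace_basis[OF assms(1)]) blast
  have "x \<in> U" if "x \<in> ?c" for x using c that span_base by blast
  then show ?thesis unfolding trace_on_def basis_trace_def
    by (intro sum.cong) (auto simp: assms(2))
qed

text \<open>Counting: the sum of the spans has dimension \<open>card b + card c\<close>, and a
  finite spanning set with no more elements than the dimension is independent.\<close>

lemma independent_Un_direct:
  assumes "independent b" "independent c" "span b \<inter> span c = {0}"
  shows "independent (b \<union> c)" "b \<inter> c = {}"
proof -
  show bc: "b \<inter> c = {}"
  proof (rule ccontr)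
    assume "b \<inter> c \<noteq> {}"
    then obtain x where x: "x \<in> b" "x \<in> c" by blast
    then have "x \<in> span b \<inter> span c" by (simp add: span_base)
    then have "0 \<in> b" using assms(3) x by auto
    then show False using dependent_zero assms(1) by blast
  qed
  have f: "finite b" "finite c" using assms finiteI_independent by auto
  have "dim (span b) + dim (span c) = dim {x + y |x y. x \<in> span b \<and> y \<in> span c}"
    using dim_sums_Int[of "span b" "span c"] assms(3) by (simp add: dim_span)
  also have "\<dots> = dim (b \<union> c)" by (simp add: span_Un[symmetric])
  finally have "dim (b \<union> c) = card (b \<union> c)"
    using assms f bc by (simp add: dim_eq_card_independent card_Un_disjoint)
  then show "independent (b \<union> c)"
    by (intro card_le_dim_spanning[of "b \<union> c" "span (b \<union> c)"]) (auto simp: f span_superset)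
qed

lemma trace_on_direct:
  assumes "subspace A" "subspace C" "A \<inter> C = {0}" "endo T"
    "\<And>x. x \<in> A \<Longrightarrow> T x \<in> A" "\<And>x. x \<in> C \<Longrightarrow> T x \<in> C"
  shows "trace_on (span (A \<union> C)) T = trace_on A T + trace_on C T"
proof -
  interpret T: Vector_Spaces.linear scale scale T by fact
  obtain a where a: "independent a" "span a = A" "finite a" using subspace_basis[OF assms(1)] .
  obtain c where c: "independent c" "span c = C" "finite c" using subspace_basis[OF assms(2)] .
  have i: "independent (a \<union> c)" and d: "a \<inter> c = {}"
    using independent_Un_direct[OF a(1) c(1)] a(2) c(2) assms(3) by simp_all
  have s: "span (a \<union> c) = span (A \<union> C)"
    by (simp only: span_Un a(2)[symmetric] c(2)[symmetric] span_span)
  have st: "T x \<in> span (A \<union> C)" if x: "x \<in> span (A \<union> C)" for x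
  proof -
    obtain y z where "y \<in> A" "z \<in> C" "x = y + z"
      using x[unfolded span_Un] span_eq_iff[THEN iffD2, OF assms(1)] span_eq_iff[THEN iffD2, OF assms(2)]
      by auto
    then show ?thesis using assms(5)[of y] assms(6)[of z] by (simp add: T.add span_add span_base)
  qed
  have "basis_trace (a \<union> c) T = (\<Sum>x\<in>a. representation (a \<union> c) (T x) x) + (\<Sum>x\<in>c. representation (a \<union> c) (T x) x)"
    unfolding basis_trace_def using a c d by (simp add: sum.union_disjoint)
  also have "(\<Sum>x\<in>a. representation (a \<union> c) (T x) x) = basis_trace a T"
    unfolding basis_trace_def
  proof (rule sum.cong[OF refl])
    fix x assume "x \<in> a"
    then have "T x \<in> span a" using assms(5) a(2) span_base by blast
    then show "representation (a \<union> c) (T x) x = representation a (T x) x"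
      using representation_extend[OF i] by simp
  qed
  also have "(\<Sum>x\<in>c. representation (a \<union> c) (T x) x) = basis_trace c T"
    unfolding basis_trace_def
  proof (rule sum.cong[OF refl])
    fix x assume "x \<in> c"
    then have "T x \<in> span c" using assms(6) c(2) span_base by blast
    then show "representation (a \<union> c) (T x) x = representation c (T x) x"
      using representation_extend[OF i] by simp
  qed
  finally show ?thesis
    using trace_on_basis[OF i s assms(4) st] trace_on_basis[OF a(1,2) assms(4)] trace_on_basis[OF c(1,2) assms(4)]
      assms by auto
qed

lemma endo_funpow: "endo T \<Longrightarrow> endo (T ^^ n)"
  by (induction n) (auto simp: endo_iff)

lemma funpow_stable: "(\<And>x. x \<in> U \<Longrightarrow> T x \<in> U) \<Longrightarrow> x \<in> U \<Longrightarrow> (T ^^ n) x \<in> U"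
  by (induction n) auto

lemma funpow_zero_mono:
  assumes "endo T" "(T ^^ n) x = 0" "n \<le> m" shows "(T ^^ m) x = 0"
proof -
  interpret Vector_Spaces.linear scale scale "T ^^ (m - n)" using endo_funpow[OF assms(1)] .
  have "(T ^^ m) x = (T ^^ (m - n)) ((T ^^ n) x)"
    using assms(3) by (metis comp_apply funpow_add le_add_diff_inverse2)
  then show ?thesis using assms by simp
qed

lemma nilp_uniform:
  assumes "endo T" "subspace U" "\<And>x. x \<in> U \<Longrightarrow> \<exists>n. (T ^^ n) x = 0"
  obtains n where "\<And>x. x \<in> U \<Longrightarrow> (T ^^ n) x = 0"
proof -
  obtain b where b: "independent b" "span b = U" "finite b" using subspace_basis[OF assms(2)] .
  have "\<forall>x\<in>b. \<exists>n. (T ^^ n) x = 0" using assms(3) b(2) span_base by blast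
  from bchoice[OF this] obtain m where m: "\<And>x. x \<in> b \<Longrightarrow> (T ^^ m x) x = 0"
    by blast
  define n where "n = Max (m ` b)"
  interpret Vector_Spaces.linear scale scale "T ^^ n" using endo_funpow[OF assms(1)] .
  have "(T ^^ n) x = 0" if "x \<in> b" for x
  proof -
    have "m x \<le> n" unfolding n_def using b(3) that by simp
    then show ?thesis using funpow_zero_mono[OF assms(1) m[OF that]] by blast
  qed
  then have "(T ^^ n) x = 0" if "x \<in> U" for x
    using eq_0_on_span[of b x] b that by simp
  then show ?thesis using that by blast
qed

text \<open>Were \<open>T\<close> surjective on \<open>U\<close>, so would be all its powers,
  including the uniform one that kills \<open>U\<close>.\<close>

lemma nilp_image_psubset:
  assumes "endo T" "subspace U" "\<And>x. x \<in> U \<Longrightarrow> T x \<in> U" "\<And>x. x \<in> U \<Longrightarrow> \<exists>n. (T ^^ n) x = 0" "U \<noteq> {0}"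
  shows "T ` U \<subset> U"
proof (rule ccontr)
  assume "\<not> T ` U \<subset> U"
  then have e: "T ` U = U" using assms by blast
  obtain n where n: "\<And>x. x \<in> U \<Longrightarrow> (T ^^ n) x = 0"
    using nilp_uniform[OF assms(1,2,4)] by blast
  have "(T ^^ n) ` U = U" for n
  proof (induction n)
    case (Suc n)
    have "(T ^^ Suc n) ` U = T ` ((T ^^ n) ` U)" by (simp add: image_comp)
    then show ?case using Suc e by simp
  qed simp
  then have "x = 0" if "x \<in> U" for x
    using that n by (metis imageE)
  then have "U \<subseteq> {0}" by blast
  then show False using assms(2,5) subspace_0 by blast
qed

text \<open>Triangular form one layer at a time: a basis of V = T(U) is extended to one of
  \<open>U\<close>. The added vectors are mapped into V, hence have no diagonal entry, and V is
  smaller than \<open>U\<close>.\<close>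

lemma trace_on_nilp:
  assumes "endo T" "subspace U" "\<And>x. x \<in> U \<Longrightarrow> T x \<in> U" "\<And>x. x \<in> U \<Longrightarrow> \<exists>n. (T ^^ n) x = 0"
  shows "trace_on U T = 0"
  using assms
proof (induction "dim U" arbitrary: U rule: less_induct)
  case less
  interpret T: Vector_Spaces.linear scale scale T by fact
  show ?case
  proof (cases "U = {0}")
    case True
    have "trace_on U T = basis_trace {} T"
      by (intro trace_on_basis independent_empty) (auto simp: True less.prems(1))
    then show ?thesis by (simp add: basis_trace_def)
  next
    case False
    define V where "V = T ` U"
    have V: "V \<subset> U" using nilp_image_psubset[OF less.prems False] by (simp add: V_def)
    have sV: "subspace V" unfolding V_def using T.subspace_image less.prems by simp
    have dV: "dim V < dim U" using dim_psubset[of V U] V sV less.prems(2)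
      by (simp add: span_eq_iff[THEN iffD2])
    have tV: "trace_on V T = 0"
      by (rule less.hyps[OF dV less.prems(1) sV]) (use V V_def less.prems in auto)
    obtain b where b: "independent b" "span b = V" "finite b" using subspace_basis[OF sV] .
    obtain c where c: "b \<subseteq> c" "c \<subseteq> U" "independent c" "U \<subseteq> span c"
      using maximal_independent_subset_extend[of b U] b V span_superset by (metis less_le order_trans)
    have fc: "finite c" using c finiteI_independent by auto
    have sc: "span c = U" using c less.prems(2) span_minimal by (meson subset_antisym)
    have Tb: "T x \<in> span b" if "x \<in> c" for x using that c b V_def by auto
    have "basis_trace c T = (\<Sum>x\<in>b. representation c (T x) x) + (\<Sum>x\<in>c - b. representation c (T x) x)"
      unfolding basis_trace_def using sum.subset_diff[OF c(1) fc] by (simp add: add.commute)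
    also have "(\<Sum>x\<in>c - b. representation c (T x) x) = 0"
    proof (rule sum.neutral, rule ballI)
      fix x assume x: "x \<in> c - b"
      have "representation c (T x) = representation b (T x)"
        using representation_extend[OF c(3) Tb c(1)] x by auto
      then show "representation c (T x) x = 0"
        using x representation_ne_zero[of b "T x" x] by auto
    qed
    also have "(\<Sum>x\<in>b. representation c (T x) x) = basis_trace b T" unfolding basis_trace_def
    proof (rule sum.cong[OF refl])
      fix x assume "x \<in> b"
      then have "T x \<in> span b" using c(1) Tb by blast
      then show "representation c (T x) x = representation b (T x) x"
        using representation_extend[OF c(3) _ c(1)] by simp
    qed
    also have "\<dots> = 0"
    proof -
      have "T x \<in> V" if "x \<in> V" for x using that V V_def by blast
      then show ?thesis using tV trace_on_basis[OF b(1,2) less.prems(1)] by simp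
    qed
    finally show ?thesis using trace_on_basis[OF c(3) sc less.prems(1,3)] by simp
  qed
qed

end

section \<open>Generalized eigenspaces and Engel's theorem\<close>

context finite_dimensional_vector_space
begin

definition gen_eigenspace :: "('b \<Rightarrow> 'b) \<Rightarrow> 'a \<Rightarrow> 'b set" where
  "gen_eigenspace T l = {v. \<exists>n. ((\<lambda>x. T x - scale l x) ^^ n) v = 0}"

lemma endo_shift: "endo T \<Longrightarrow> endo (\<lambda>x. T x - scale l x)"
  by (intro endo_diff endo_ident)

lemma endo_0: "endo T \<Longrightarrow> T 0 = 0"
  using endo_iff[of T] by (metis add_cancel_right_right)

lemma endo_neg: "endo T \<Longrightarrow> T (- x) = - T x"
  by (metis add_eq_0_iff endo_0 endo_iff)

lemma endo_minus: "endo T \<Longrightarrow> T (x - y) = T x - T y"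
  by (metis add_diff_cancel_right' diff_add_cancel endo_iff)

lemma endo_sum: "endo T \<Longrightarrow> T (sum f A) = (\<Sum>x\<in>A. T (f x))"
  by (induction A rule: infinite_finite_induct) (auto simp: endo_0 endo_iff)

lemma endo_image: assumes "endo T" "subspace S" shows "subspace (T ` S)"
proof -
  interpret T: Vector_Spaces.linear scale scale T by fact
  show ?thesis using T.subspace_image assms(2) by blast
qed

lemma subspace_gen_eigenspace:
  assumes "endo T" shows "subspace (gen_eigenspace T l)"
proof (rule subspaceI)
  let ?A = "\<lambda>x. T x - scale l x"
  have A: "endo ?A" using assms by (rule endo_shift)
  show "0 \<in> gen_eigenspace T l" unfolding gen_eigenspace_def by (auto intro: exI[of _ 0])
  show "x + y \<in> gen_eigenspace T l"
    if xy: "x \<in> gen_eigenspace T l" "y \<in> gen_eigenspace T l" for x y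
  proof -
    obtain n m where "(?A ^^ n) x = 0" "(?A ^^ m) y = 0" using xy by (auto simp: gen_eigenspace_def)
    then have "(?A ^^ (n + m)) x = 0" "(?A ^^ (n + m)) y = 0"
      using funpow_zero_mono[OF A, of n x "n + m"] funpow_zero_mono[OF A, of m y "n + m"] by auto
    then have "(?A ^^ (n + m)) (x + y) = 0"
      using endo_funpow[OF A, of "n + m"] by (simp add: endo_iff)
    then show ?thesis by (auto simp: gen_eigenspace_def)
  qed
  show "scale c x \<in> gen_eigenspace T l" if x: "x \<in> gen_eigenspace T l" for c x
  proof -
    obtain n where "(?A ^^ n) x = 0" using x by (auto simp: gen_eigenspace_def)
    then have "(?A ^^ n) (scale c x) = 0"
      using endo_funpow[OF A, of n] by (simp add: endo_iff)
    then show ?thesis by (auto simp: gen_eigenspace_def)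
  qed
qed

text \<open>Both (T - l) v and (T - m) v satisfy the hypotheses with a smaller exponent, since the
  two operators commute. So both vanish, and their difference is a nonzero multiple of
  \<open>v\<close>.\<close>

lemma gen_eigenspace_disjoint:
  assumes T: "endo T" and lm: "l \<noteq> m"
    and "((\<lambda>x. T x - scale l x) ^^ a) v = 0" "((\<lambda>x. T x - scale m x) ^^ b) v = 0"
  shows "v = 0"
  using assms(3,4)
proof (induction "a + b" arbitrary: a b v rule: less_induct)
  case less
  let ?L = "\<lambda>x. T x - scale l x" and ?M = "\<lambda>x. T x - scale m x"
  have L: "endo ?L" and M: "endo ?M" using T by (auto intro: endo_shift)
  have comm: "?L (?M x) = ?M (?L x)" for x
    using T by (simp add: endo_iff endo_minus[OF T] scale_right_diff_distrib mult.commute)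
  have cL: "(?M ^^ k) (?L x) = ?L ((?M ^^ k) x)" for k x
    by (induction k) (simp_all only: funpow.simps comm o_apply id_apply)
  have cM: "(?L ^^ k) (?M x) = ?M ((?L ^^ k) x)" for k x
    by (induction k) (simp_all only: funpow.simps comm o_apply id_apply)
  show ?case
  proof (cases "a = 0 \<or> b = 0")
    case True then show ?thesis using less.prems by auto
  next
    case False
    then obtain a' b' where ab: "a = Suc a'" "b = Suc b'" by (metis not0_implies_Suc)
    have "?L v = 0"
    proof (rule less.hyps[of a' b])
      have "(?L ^^ a') (?L v) = (?L ^^ Suc a') v" by (simp only: funpow_Suc_right o_apply)
      then show "(?L ^^ a') (?L v) = 0" using less.prems(1) unfolding ab by simp
      show "(?M ^^ b) (?L v) = 0" using less.prems(2) endo_0[OF L] by (simp only: cL)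
    qed (use ab in auto)
    moreover have "?M v = 0"
    proof (rule less.hyps[of a b'])
      have "(?M ^^ b') (?M v) = (?M ^^ Suc b') v" by (simp only: funpow_Suc_right o_apply)
      then show "(?M ^^ b') (?M v) = 0" using less.prems(2) unfolding ab by simp
      show "(?L ^^ a) (?M v) = 0" using less.prems(1) endo_0[OF M] by (simp only: cM)
    qed (use ab in auto)
    ultimately have "scale (l - m) v = 0" by (simp add: scale_left_diff_distrib)
    then show ?thesis using lm by simp
  qed
qed

text \<open>Choose p of least degree with p(T) v in \<open>S\<close>. A root l factors it as (X - l)
  q; then u = q(T) v lies outside \<open>S\<close> by minimality, while (T - l) u = p(T) v lies in
  \<open>S\<close>.\<close>

lemma eigenvector_mod:
  fixes S U :: "'b set"
  assumes alg: "\<forall>p :: 'a poly. 0 < degree p \<longrightarrow> (\<exists>x. poly p x = 0)"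
    and T: "endo T" and U: "subspace U" "\<And>x. x \<in> U \<Longrightarrow> T x \<in> U" and S: "subspace S"
    and v: "v \<in> U" "v \<notin> S"
  obtains u l where "u \<in> U" "u \<notin> S" "T u - scale l u \<in> S"
proof -
  \<comment> \<open>More iterates of \<open>v\<close> than the dimension, so they satisfy a linear
    relation. For polynomials of degree below \<open>N\<close> the sum \<open>P\<close> is the full
    value p(T) v, with nothing cut off.\<close>
  define N where "N = Suc (Suc dimension)"
  define P where "P p = (\<Sum>i<N. scale (coeff p i) ((T ^^ i) v))" for p
  have PU: "P p \<in> U" for p unfolding P_def
    by (intro subspace_sum U subspace_scale funpow_stable) (use U v in auto)
  define Q where "Q p \<longleftrightarrow> p \<noteq> 0 \<and> degree p < N \<and> P p \<in> S" for p
  have "\<exists>p. Q p"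
  proof -
    have "\<exists>c. (\<exists>i<N. c i \<noteq> 0) \<and> (\<Sum>i<N. scale (c i) ((T ^^ i) v)) = 0"
    proof (cases "inj_on (\<lambda>i. (T ^^ i) v) {..<N}")
      case True
      let ?X = "(\<lambda>i. (T ^^ i) v) ` {..<N}"
      have "card ?X = N" using True by (simp add: card_image)
      then have "card ?X > dimension" by (simp add: N_def)
      then have "dependent ?X" using independent_bound_general[of ?X] dim_subset_UNIV[of ?X] by fastforce
      then obtain f where f: "(\<Sum>x\<in>?X. scale (f x) x) = 0" "\<exists>x\<in>?X. f x \<noteq> 0"
        using dependent_finite[of ?X] by auto
      have "(\<Sum>i<N. scale (f ((T ^^ i) v)) ((T ^^ i) v)) = 0"
        using f(1) sum.reindex[OF True, of "\<lambda>x. scale (f x) x"] by simp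
      then show ?thesis using f(2) by (intro exI[of _ "\<lambda>i. f ((T ^^ i) v)"]) auto
    next
      \<comment> \<open>A repeated iterate must be treated separately, because passing to the set of
        iterates forgets multiplicities; the repetition is itself the relation.\<close>
      case False
      then obtain i j where ij: "i < N" "j < N" "i \<noteq> j" "(T ^^ i) v = (T ^^ j) v"
        by (auto simp: inj_on_def)
      let ?c = "\<lambda>k. if k = i then 1 else if k = j then -1 else (0::'a)"
      have "(\<Sum>k<N. scale (?c k) ((T ^^ k) v)) = (\<Sum>k\<in>{i,j}. scale (?c k) ((T ^^ k) v))"
        by (rule sum.mono_neutral_right) (use ij in auto)
      also have "\<dots> = 0" using ij by simp
      finally show ?thesis using ij by (intro exI[of _ ?c]) auto
    qed
    then obtain c k where c: "k < N" "c k \<noteq> 0" "(\<Sum>i<N. scale (c i) ((T ^^ i) v)) = 0"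
      by blast
    define p where "p = (\<Sum>i<N. monom (c i) i)"
    have cp: "coeff p i = (if i < N then c i else 0)" for i
      by (simp add: p_def coeff_sum)
    have "degree p < N" using degree_le[of "N - 1" p] cp by (auto simp: N_def)
    moreover have "p \<noteq> 0" using cp[of k] c by auto
    moreover have "P p = 0" unfolding P_def using c(3) cp by simp
    ultimately show ?thesis using subspace_0[OF S] by (auto simp: Q_def)
  qed
  then obtain p where p: "Q p" and pmin: "\<And>q. degree q < degree p \<Longrightarrow> \<not> Q q"
    using ex_has_least_nat[of Q _ degree] by (metis leD)
  have "degree p \<noteq> 0"
  proof
    assume "degree p = 0"
    then obtain a where a: "p = [:a:]" "a \<noteq> 0"
      using p by (metis Q_def degree_eq_zeroE pCons_eq_0_iff)
    have "P p = (\<Sum>i\<in>{0}. scale (coeff p i) ((T ^^ i) v))" unfolding P_def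
      by (rule sum.mono_neutral_right) (auto simp: N_def a coeff_pCons split: nat.splits)
    then have "P p = scale a v" using a by simp
    then have "scale (inverse a) (scale a v) \<in> S" using p S by (metis Q_def subspace_scale)
    then show False using a v by simp
  qed
  then obtain l where "poly p l = 0" using alg by auto
  then obtain q where q: "p = [:-l, 1:] * q" by (metis dvdE poly_eq_0_iff_dvd)
  have qn: "q \<noteq> 0" using p q by (auto simp: Q_def)
  have dp: "degree p = Suc (degree q)" unfolding q using qn by (subst degree_mult_eq) auto
  have dq: "Suc (degree q) < N" using dp p by (simp add: Q_def)
  have "P p = T (P q) - scale l (P q)"
  proof -
    have coeff_p: "coeff p i = (case i of 0 \<Rightarrow> 0 | Suc j \<Rightarrow> coeff q j) - l * coeff q i"
      for i
      unfolding q by (simp add: coeff_pCons)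
    have "T (P q) = (\<Sum>i<N. scale (coeff q i) ((T ^^ Suc i) v))"
      unfolding P_def using T by (simp add: endo_sum endo_iff)
    also have "\<dots> = (\<Sum>i<N-1. scale (coeff q i) ((T ^^ Suc i) v))"
      by (rule sum.mono_neutral_right) (use dq in \<open>auto intro!: coeff_eq_0\<close>)
    also have "\<dots> = (\<Sum>i<N. scale (case i of 0 \<Rightarrow> 0 | Suc j \<Rightarrow> coeff q j) ((T ^^ i) v))"
      unfolding N_def by (subst sum.lessThan_Suc_shift) simp
    finally show ?thesis unfolding coeff_p P_def
      by (simp add: scale_left_diff_distrib sum_subtractf scale_sum_right)
  qed
  moreover have "P q \<notin> S" using pmin[of q] dp dq qn by (auto simp: Q_def)
  ultimately show ?thesis using that[OF PU[of q], of l] p by (auto simp: Q_def)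
qed

text \<open>Let S be the span of the generalized eigenvectors. If S is not all of \<open>U\<close>,
  there is u outside S that is an eigenvector modulo S, for some l. A Fitting argument for A = T - l
  on S + ku corrects u by an element of S to a generalized eigenvector, which would then lie in
  S.\<close>

lemma gen_eigenspace_decomp:
  assumes alg: "\<forall>p :: 'a poly. 0 < degree p \<longrightarrow> (\<exists>x. poly p x = 0)"
    and T: "endo T" and U: "subspace U" "\<And>x. x \<in> U \<Longrightarrow> T x \<in> U"
  shows "U \<subseteq> span (\<Union>l. U \<inter> gen_eigenspace T l)"
proof (rule ccontr)
  let ?S = "span (\<Union>l. U \<inter> gen_eigenspace T l)"
  assume "\<not> U \<subseteq> ?S"
  then obtain v where "v \<in> U" "v \<notin> ?S" by blast
  then obtain u l where u: "u \<in> U" "u \<notin> ?S" "T u - scale l u \<in> ?S"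
    using eigenvector_mod[OF alg T U subspace_span] by metis
  define A where "A = (\<lambda>x. T x - scale l x)"
  have A: "endo A" unfolding A_def using T by (rule endo_shift)
  have SU: "?S \<subseteq> U" by (rule span_minimal) (use U in auto)
  have geT: "T x \<in> gen_eigenspace T m" if x: "x \<in> gen_eigenspace T m" for x m
  proof -
    obtain n where "((\<lambda>x. T x - scale m x) ^^ n) x = 0"
      using x by (auto simp: gen_eigenspace_def)
    then have "((\<lambda>x. T x - scale m x) ^^ Suc n) x = 0" using endo_0[OF endo_shift[OF T]] by simp
    then have "((\<lambda>x. T x - scale m x) ^^ n) (T x - scale m x) = 0"
      by (simp only: funpow_Suc_right o_apply)
    then have "T x - scale m x \<in> gen_eigenspace T m" by (auto simp: gen_eigenspace_def)
    then have "T x - scale m x + scale m x \<in> gen_eigenspace T m"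
      using subspace_gen_eigenspace[OF T] x subspace_add subspace_scale by blast
    then show ?thesis by simp
  qed
  have TS: "T x \<in> ?S" if x: "x \<in> ?S" for x
    using x
  proof (induction rule: span_induct_alt)
    case base then show ?case using endo_0[OF T] span_zero by simp
  next
    case (step c x y)
    then have "T x \<in> ?S" using geT U(2) by (intro span_base) blast
    then show ?case using step T by (simp add: endo_iff span_add span_scale)
  qed
  have AS: "A x \<in> ?S" if "x \<in> ?S" for x
    unfolding A_def using TS[OF that] that by (simp add: span_diff span_scale)
  define V where "V = span (insert u ?S)"
  have uV: "u \<in> V" by (simp add: V_def span_base)
  have AV: "A x \<in> ?S" if x: "x \<in> V" for x
    using x unfolding V_def
  proof (induction rule: span_induct_alt)
    case base then show ?case using endo_0[OF A] span_zero by simp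
  next
    case (step c x y)
    then have "A x \<in> ?S" using AS u(3) by (auto simp: A_def)
    then show ?case using step A by (simp add: endo_iff span_add span_scale)
  qed
  have SV: "?S \<subseteq> V" unfolding V_def by (meson order_trans span_superset subset_insertI)
  have sub: "subspace ((A ^^ n) ` V)" for n
    using endo_image[OF endo_funpow[OF A]] unfolding V_def by simp
  have mono: "(A ^^ (n + m)) ` V \<subseteq> (A ^^ n) ` V" for n m
  proof -
    have "(A ^^ m) x \<in> V" if "x \<in> V" for x by (rule funpow_stable) (use AV SV that in auto)
    then show ?thesis by (auto simp: funpow_add)
  qed
  \<comment> \<open>Here the images of the powers of \<open>A\<close> are stationary, so
    \<open>A^n u = A^(2n) w\<close> for some \<open>w\<close>. The condition
    \<open>n \<ge> 1\<close> puts \<open>A^n w\<close> into the span, because already one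
    application of \<open>A\<close> maps \<open>V\<close> there.\<close>
  obtain n where n: "n \<ge> 1" "\<And>k. k \<ge> 1 \<Longrightarrow> dim ((A ^^ n) ` V) \<le> dim ((A ^^ k) ` V)"
    using ex_has_least_nat[of "\<lambda>k. k \<ge> (1::nat)" 1 "\<lambda>k. dim ((A ^^ k) ` V)"] by auto
  have "(A ^^ (n + n)) ` V = (A ^^ n) ` V"
    by (rule subspace_dim_equal[OF sub sub mono]) (use n in auto)
  then have "(A ^^ n) u \<in> (A ^^ (n + n)) ` V" using uV by blast
  then obtain w where w: "w \<in> V" "(A ^^ n) u = (A ^^ (n + n)) w" by blast
  define s where "s = (A ^^ n) w"
  have sS: "s \<in> ?S"
  proof -
    obtain k where "n = Suc k" using n(1) by (cases n) auto
    moreover have "(A ^^ k) w \<in> V" by (rule funpow_stable) (use AV SV w in auto)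
    ultimately show ?thesis using AV by (simp add: s_def)
  qed
  have "(A ^^ n) (u - s) = 0"
    using endo_minus[OF endo_funpow[OF A]] w by (simp add: s_def funpow_add)
  then have "u - s \<in> gen_eigenspace T l" by (auto simp: gen_eigenspace_def A_def)
  moreover have "u - s \<in> U" using u sS SU U by (auto intro: subspace_diff)
  ultimately have "u - s \<in> ?S" by (intro span_base) blast
  then have "(u - s) + s \<in> ?S" using sS span_add by blast
  then show False using u by simp
qed

end

section \<open>The adjoint action and Engel's theorem\<close>

locale lie_alg = finite_dimensional_vector_space sc Basis
  for sc :: "'k::field_char_0 \<Rightarrow> 'g::ab_group_add \<Rightarrow> 'g" and Basis +
  fixes br :: "'g \<Rightarrow> 'g \<Rightarrow> 'g"
  assumes lie: "lie_algebra sc br"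
begin

lemma br_add_l: "br (x + y) z = br x z + br y z"
  and br_add_r: "br x (y + z) = br x y + br x z"
  and br_sc_l: "br (sc c x) y = sc c (br x y)"
  and br_sc_r: "br x (sc c y) = sc c (br x y)"
  and br_self [simp]: "br x x = 0"
  and jacobi: "br x (br y z) + br y (br z x) + br z (br x y) = 0"
  using lie unfolding lie_algebra_def by blast+

lemma br_zero_l [simp]: "br 0 y = 0" and br_zero_r [simp]: "br y 0 = 0"
  using br_sc_l[of 0 0 y] br_sc_r[of y 0 0] by simp_all

lemma br_anti: "br x y = - br y x"
proof -
  have "br (x + y) (x + y) = 0" by simp
  then have "br x y + br y x = 0" unfolding br_add_l br_add_r by (simp add: add.commute)
  then show ?thesis by (simp add: eq_neg_iff_add_eq_0)
qed

lemma endo_br [simp]: "endo (br x)"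
  by (simp add: endo_iff br_add_r br_sc_r)

lemma endo_br_l: "endo (\<lambda>y. br y x)"
  by (simp add: endo_iff br_add_l br_sc_l)

lemma br_neg_r: "br x (- y) = - br x y"
  by (rule endo_neg) simp

lemma br_neg_l: "br (- x) y = - br x y"
  using endo_neg[OF endo_br_l[of y]] .

lemma br_leibniz: "br x (br y z) = br (br x y) z + br y (br x z)"
proof -
  have "br y (br z x) = - br y (br x z)" by (metis br_anti br_neg_r)
  moreover have "br z (br x y) = - br (br x y) z" by (rule br_anti)
  ultimately show ?thesis
    using jacobi[of x y z] by (simp add: diff_eq_eq add.commute)
qed

lemma span_br_closed:
  assumes "\<And>x y. x \<in> A \<Longrightarrow> y \<in> C \<Longrightarrow> br x y \<in> D" "subspace D" "x \<in> span A" "y \<in> span C"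
  shows "br x y \<in> D"
proof -
  have 1: "br x y \<in> D" if "x \<in> A" "y \<in> span C" for x y
    using that(2)
  proof (induction rule: span_induct_alt)
    case base then show ?case using assms(2) subspace_0 by simp
  next
    case (step c z w) then show ?case using assms(1)[OF that(1)] assms(2)
      by (simp add: br_add_r br_sc_r subspace_add subspace_scale)
  qed
  show ?thesis
    using assms(3)
  proof (induction rule: span_induct_alt)
    case base then show ?case using assms(2) subspace_0 by simp
  next
    case (step c z w) then show ?case using 1[OF _ assms(4)] assms(2)
      by (simp add: br_add_l br_sc_l subspace_add subspace_scale)
  qed
qed

text \<open>\<open>W\<close> is only closed under brackets, as homogeneous elements do not form a
  subspace, and the vector is sought in \<open>X\<close> modulo \<open>U\<close>. Induction on
  \<open>dim W\<close>: for a smaller closed subset, the statement applied to \<open>W\<close>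
  modulo its span gives a \<open>w\<close> normalising it, and applied to \<open>X\<close> modulo
  \<open>U\<close> gives an \<open>x1\<close> that it kills. Iterates of \<open>w\<close> on
  \<open>x1\<close> remain killed by it, and the last iterate outside \<open>U\<close> is killed by
  \<open>w\<close> as well.\<close>

lemma engel:
  assumes "\<And>w w'. w \<in> W \<Longrightarrow> w' \<in> W \<Longrightarrow> br w w' \<in> W"
    and "\<And>w w'. w \<in> W \<Longrightarrow> w' \<in> W \<Longrightarrow> \<exists>n. (br w ^^ n) w' = 0"
    and "\<And>w x. w \<in> W \<Longrightarrow> x \<in> X \<Longrightarrow> br w x \<in> X"
    and "\<And>w x. w \<in> W \<Longrightarrow> x \<in> X \<Longrightarrow> \<exists>n. (br w ^^ n) x \<in> U"
    and "subspace U" "\<And>w u. w \<in> W \<Longrightarrow> u \<in> U \<Longrightarrow> br w u \<in> U"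
    and "\<not> X \<subseteq> U"
  obtains x where "x \<in> X" "x \<notin> U" "\<And>w. w \<in> W \<Longrightarrow> br w x \<in> U"
proof -
  have "\<exists>x\<in>X - U. \<forall>w\<in>W. br w x \<in> U"
    using assms
  proof (induction "dim W" arbitrary: W X U rule: less_induct)
    case less
    note closed = less.prems(1) and nilW = less.prems(2) and X = less.prems(3) and nilX = less.prems(4)
      and U = less.prems(5,6) and XU = less.prems(7)
    show ?case
    proof (cases "W \<subseteq> {0}")
      case True
      then have "br w x = 0" if "w \<in> W" for w x using that by auto
      then show ?thesis using XU subspace_0[OF U(1)] by auto
    next
      case False
      \<comment> \<open>Proper inclusion would be the wrong measure: a closed proper subset may
        already span \<open>W\<close>.\<close>
      define good where "good M \<longleftrightarrow> M \<subseteq> W \<and> (\<forall>a\<in>M. \<forall>b\<in>M. br a b \<in> M) \<and> dim M < dim W"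
        for M
      have "dim W > 0" using False by (metis dim_eq_0 gr0I)
      then have "good {}" by (simp add: good_def)
      then obtain M where M: "good M" and Mmax: "\<And>M'. good M' \<Longrightarrow> dim M' \<le> dim M"
        using ex_has_greatest_nat[of good "{}" dim "dim W"] by (auto simp: good_def)
      \<comment> \<open>Saturation of \<open>M\<close> inside \<open>W\<close>: the dimension does
        not grow, and brackets known to lie in both \<open>W\<close> and the span now lie in the set
        itself.\<close>
      define M' where "M' = W \<inter> span M"
      have MM': "M \<subseteq> M'" using M by (auto simp: M'_def good_def span_base)
      have sMc: "br a b \<in> span M" if "a \<in> span M" "b \<in> span M" for a b
        by (rule span_br_closed[of M M "span M"]) (use M that in \<open>auto simp: good_def span_base\<close>)
      have M'c: "br a b \<in> M'" if "a \<in> M'" "b \<in> M'" for a b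
        using that closed sMc by (auto simp: M'_def)
      have "dim M' \<le> dim M" by (rule dim_mono) (auto simp: M'_def)
      then have dM': "dim M' < dim W" using M by (auto simp: good_def)
      have WM: "\<not> W \<subseteq> span M" using M dim_mono[of W M] by (auto simp: good_def)
      have "\<exists>w\<in>W - span M. \<forall>m\<in>M'. br m w \<in> span M"
      proof (rule less.hyps[OF dM'])
        show "\<exists>n. (br w ^^ n) x \<in> span M" if "w \<in> M'" "x \<in> W" for w x
          using nilW[of w x] that span_zero by (metis IntE M'_def)
      qed (use M'c nilW closed sMc WM in \<open>auto simp: M'_def\<close>)
      then obtain w where w: "w \<in> W" "w \<notin> span M" "\<And>m. m \<in> M' \<Longrightarrow> br m w \<in> span M"
        by blast
      have w0: "0 \<in> M'" using closed[OF w(1) w(1)] by (simp add: M'_def span_zero)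
      have wM: "br m w \<in> M'" "br w m \<in> M'" if m: "m \<in> M'" for m
      proof -
        show "br m w \<in> M'" using w m closed by (auto simp: M'_def)
        have "br w m = - br m w" by (rule br_anti)
        then have "br w m \<in> span M" using w(3)[OF m] by (simp add: span_neg)
        then show "br w m \<in> M'" using w m closed by (auto simp: M'_def)
      qed
      \<comment> \<open>\<open>N\<close> is closed and larger in dimension than \<open>M\<close>, so
        by maximality it spans \<open>W\<close>; what \<open>N\<close> sends into \<open>U\<close>
        is sent there by all of \<open>W\<close>.\<close>
      define N where "N = insert w M'"
      have NW: "N \<subseteq> W" using w by (auto simp: N_def M'_def)
      have Nc: "\<forall>a\<in>N. \<forall>b\<in>N. br a b \<in> N" using wM w0 M'c by (auto simp: N_def)
      have "dim (insert w M) = Suc (dim M)" using w(2) by (simp add: dim_insert)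
      moreover have "dim (insert w M) \<le> dim N" using MM' by (intro dim_subset) (auto simp: N_def)
      ultimately have "\<not> good N" using Mmax[of N] by auto
      then have "dim N \<ge> dim W" using NW Nc by (auto simp: good_def)
      then have "span N = span W" using dim_eq_span[OF NW] by simp
      then have WN: "W \<subseteq> span N" using span_superset by auto
      have "\<exists>x\<in>X - U. \<forall>m\<in>M'. br m x \<in> U"
        by (rule less.hyps[OF dM']) (use M'c nilW X nilX U XU in \<open>auto simp: M'_def\<close>)
      then obtain x1 where x1: "x1 \<in> X" "x1 \<notin> U" "\<And>m. m \<in> M' \<Longrightarrow> br m x1 \<in> U"
        by blast
      define n where "n = (LEAST n. (br w ^^ n) x1 \<in> U)"
      have n: "(br w ^^ n) x1 \<in> U" unfolding n_def using nilX[OF w(1) x1(1)] by (rule LeastI_ex)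
      then obtain k where k: "n = Suc k" using x1(2) by (cases n) auto
      have kU: "(br w ^^ k) x1 \<notin> U"
        using not_less_Least[of k "\<lambda>n. (br w ^^ n) x1 \<in> U"] k by (simp add: n_def)
      have inv: "(br w ^^ j) x1 \<in> X \<and> (\<forall>m\<in>M'. br m ((br w ^^ j) x1) \<in> U)" for j
      proof (induction j)
        case 0 then show ?case using x1 by simp
      next
        case (Suc j)
        have "br m (br w ((br w ^^ j) x1)) \<in> U" if m: "m \<in> M'" for m
          unfolding br_leibniz[of m w] using Suc wM(1)[OF m] U(2)[OF w(1)] m 
          by (intro subspace_add[OF U(1)]) auto
        then show ?case using Suc X[OF w(1)] by simp
      qed
      define x where "x = (br w ^^ k) x1"
      have xN: "br y x \<in> U" if "y \<in> N" for y
        using that n k inv[of k] by (auto simp: N_def x_def)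
      have "br y x \<in> U" if "y \<in> W" for y
        by (rule span_br_closed[of N "{x}" U y x]) (use xN U WN that in \<open>auto simp: span_base\<close>)
      then show ?thesis using kU inv[of k] by (auto simp: x_def)
    qed
  qed
  then show ?thesis using that by blast
qed

text \<open>By the Leibniz rule ad H - (l + m) sends [y,z] to [(ad H - l) y, z] + [y, (ad H - m) z].
  Each application lowers one of the two exponents in every term, so a + b applications leave
  nothing.\<close>

lemma gen_eigenspace_br:
  assumes "((\<lambda>x. br H x - sc l x) ^^ a) y = 0" "((\<lambda>x. br H x - sc m x) ^^ b) z = 0"
  shows "((\<lambda>x. br H x - sc (l + m) x) ^^ (a + b)) (br y z) = 0"
  using assms
proof (induction "a + b" arbitrary: a b y z)
  case 0 then show ?case by simp
next
  case (Suc n)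
  let ?A = "\<lambda>x. br H x - sc (l + m) x"
  let ?L = "\<lambda>x. br H x - sc l x"
  let ?M = "\<lambda>x. br H x - sc m x"
  have A: "endo ?A" "endo (?A ^^ k)" for k
    using endo_shift[OF endo_br] endo_funpow[OF endo_shift[OF endo_br]] by blast+
  show ?case
  proof (cases "a = 0 \<or> b = 0")
    case True
    then have "br y z = 0" using Suc.prems by auto
    then show ?thesis using endo_0[OF A(2)] by simp
  next
    case False
    then obtain a' b' where ab: "a = Suc a'" "b = Suc b'" by (metis not0_implies_Suc)
    have "?A (br y z) = br (?L y) z + br y (?M z)"
      using br_leibniz[of H y z]
      by (simp add: endo_minus[OF endo_br] endo_minus[OF endo_br_l] br_sc_l br_sc_r scale_left_distrib)
    moreover have "(?A ^^ (a + b)) (br y z) = (?A ^^ (a' + b)) (?A (br y z))"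
      unfolding ab by (simp only: funpow_Suc_right o_apply add_Suc)
    ultimately have "(?A ^^ (a + b)) (br y z) = (?A ^^ (a' + b)) (br (?L y) z) + (?A ^^ (a' + b)) (br y (?M z))"
      using A(2)[of "a' + b"] unfolding endo_iff by simp
    also have "(?A ^^ (a' + b)) (br (?L y) z) = 0"
    proof (rule Suc.hyps(1))
      show "(?L ^^ a') (?L y) = 0"
        using Suc.prems(1) unfolding ab by (simp only: funpow_Suc_right o_apply)
    qed (use Suc ab in auto)
    also have "(?A ^^ (a' + b)) (br y (?M z)) = 0"
    proof -
      have "(?A ^^ (a + b')) (br y (?M z)) = 0"
      proof (rule Suc.hyps(1))
        show "(?M ^^ b') (?M z) = 0"
          using Suc.prems(2) unfolding ab by (simp only: funpow_Suc_right o_apply)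
      qed (use Suc ab in auto)
      then show ?thesis by (simp add: ab)
    qed
    finally show ?thesis by simp
  qed
qed

end

section \<open>Generalized weight spaces of a Cartan subalgebra\<close>

locale lie_cartan = lie_alg sc Basis br
  for sc :: "'k::field_char_0 \<Rightarrow> 'g::ab_group_add \<Rightarrow> 'g" and Basis br +
  fixes h :: "'g set"
  assumes cartan_h: "cartan sc br h"
    and alg_closed: "\<forall>p :: 'k poly. 0 < degree p \<longrightarrow> (\<exists>x. poly p x = 0)"
begin

lemma subspace_h: "subspace h" and h_closed: "x \<in> h \<Longrightarrow> y \<in> h \<Longrightarrow> br x y \<in> h"
  using cartan_h by (auto simp: cartan_def lie_subalgebra_def)

text \<open>Generalized eigenvectors, because the action of \<open>h\<close> is not yet known to be
  diagonalisable; and \<open>\<alpha>\<close> is an arbitrary function, because linearity of weights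
  follows only later, from traces.\<close>

definition weight_space :: "('g \<Rightarrow> 'k) \<Rightarrow> 'g set" where
  "weight_space \<alpha> = {v. \<forall>H\<in>h. v \<in> gen_eigenspace (br H) (\<alpha> H)}"

text \<open>Weights are normalised to vanish off \<open>h\<close>, so that different weights differ on \<open>h\<close>.\<close>

definition weights :: "('g \<Rightarrow> 'k) set" where
  "weights = {\<alpha>. (\<forall>x. x \<notin> h \<longrightarrow> \<alpha> x = 0) \<and> weight_space \<alpha> \<noteq> {0}}"

lemma subspace_weight_space: "subspace (weight_space \<alpha>)"
  unfolding weight_space_def
  by (rule subspaceI)
    (auto intro: subspace_0[OF subspace_gen_eigenspace] subspace_add[OF subspace_gen_eigenspace] subspace_scale[OF subspace_gen_eigenspace])

lemma weight_space_br: "x \<in> weight_space \<alpha> \<Longrightarrow> y \<in> weight_space \<beta> \<Longrightarrow> br x y \<in> weight_space (\<alpha> + \<beta>)"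
proof -
  have "br x y \<in> gen_eigenspace (br H) (\<alpha> H + \<beta> H)"
    if H: "H \<in> h" "x \<in> weight_space \<alpha>" "y \<in> weight_space \<beta>" for H
  proof -
    obtain a b where "((\<lambda>x. br H x - sc (\<alpha> H) x) ^^ a) x = 0" "((\<lambda>x. br H x - sc (\<beta> H) x) ^^ b) y = 0"
      using H unfolding weight_space_def gen_eigenspace_def by blast
    from gen_eigenspace_br[OF this] show ?thesis by (auto simp: gen_eigenspace_def)
  qed
  then show "x \<in> weight_space \<alpha> \<Longrightarrow> y \<in> weight_space \<beta> \<Longrightarrow> br x y \<in> weight_space (\<alpha> + \<beta>)"
    by (auto simp: weight_space_def)
qed

lemma gen_eigenspace_0: "gen_eigenspace (br H) 0 = {v. \<exists>n. (br H ^^ n) v = 0}"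
  by (simp add: gen_eigenspace_def)

lemma h_gw0: "h \<subseteq> weight_space 0"
proof
  fix x assume x: "x \<in> h"
  obtain n where n: "lower_central sc br h n = {0}" using cartan_h by (auto simp: cartan_def)
  have "(br H ^^ k) x \<in> lower_central sc br h k" if H: "H \<in> h" for k H
  proof (induction k)
    case (Suc k)
    then show ?case using H by (auto simp: bracket_span_def intro!: span_base)
  qed (use x in simp)
  then have "(br H ^^ n) x = 0" if "H \<in> h" for H using n that by blast
  then show "x \<in> weight_space 0" by (auto simp: weight_space_def gen_eigenspace_0)
qed

lemma weight_space_stable: "H \<in> h \<Longrightarrow> v \<in> weight_space \<alpha> \<Longrightarrow> br H v \<in> weight_space \<alpha>"
  using weight_space_br[of H 0 v \<alpha>] h_gw0 by auto

text \<open>Otherwise Engel's theorem for \<open>h\<close> acting on \<open>weight_space 0\<close>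
  modulo \<open>h\<close> yields an element outside \<open>h\<close> that normalises
  \<open>h\<close>, and a Cartan subalgebra is its own normaliser.\<close>

lemma weight_space_0: "weight_space 0 = h"
proof (rule ccontr)
  assume "weight_space 0 \<noteq> h"
  then have ne: "\<not> weight_space 0 \<subseteq> h" using h_gw0 by auto
  have nil: "\<exists>n. (br w ^^ n) x = 0" if "w \<in> h" "x \<in> weight_space 0" for w x
    using that by (auto simp: weight_space_def gen_eigenspace_0)
  obtain x where x: "x \<in> weight_space 0" "x \<notin> h" "\<And>w. w \<in> h \<Longrightarrow> br w x \<in> h"
  proof (rule engel[of h "weight_space 0" h])
    show "\<exists>n. (br w ^^ n) x \<in> h" if "w \<in> h" "x \<in> weight_space 0" for w x
      using nil[OF that] subspace_0[OF subspace_h] by metis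
    show "\<exists>n. (br w ^^ n) w' = 0" if "w \<in> h" "w' \<in> h" for w w'
      using nil that h_gw0 by blast
  qed (use ne weight_space_stable h_closed subspace_h in auto)
  have "br x w \<in> h" if "w \<in> h" for w
    using x(3)[OF that] br_anti[of x w] subspace_neg[OF subspace_h] by simp
  then show False using cartan_h x(2) by (auto simp: cartan_def)
qed

definition restr :: "('g \<Rightarrow> 'k) \<Rightarrow> 'g \<Rightarrow> 'k" where
  "restr \<alpha> = (\<lambda>x. if x \<in> h then \<alpha> x else 0)"

lemma weight_space_restr: "weight_space (restr \<alpha>) = weight_space \<alpha>"
  by (simp add: weight_space_def restr_def)

text \<open>Split along one H in \<open>h\<close> that has more than one generalized eigenvalue on
  \<open>U\<close> and use induction on the dimension. The pieces remain stable under
  \<open>h\<close>, since every element of \<open>h\<close> has generalized eigenvalue 0 under ad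
  H.\<close>

lemma weight_space_decomp_all:
  assumes "subspace U" "\<And>H x. H \<in> h \<Longrightarrow> x \<in> U \<Longrightarrow> br H x \<in> U"
  shows "U \<subseteq> span (\<Union>\<alpha>. U \<inter> weight_space \<alpha>)"
  using assms
proof (induction "dim U" arbitrary: U rule: less_induct)
  case less
  show ?case
  proof (cases "\<forall>H\<in>h. \<exists>l. U \<subseteq> gen_eigenspace (br H) l")
    case True
    from bchoice[OF this] obtain \<alpha> where "\<forall>H\<in>h. U \<subseteq> gen_eigenspace (br H) (\<alpha> H)"
      by blast
    then have "U \<subseteq> weight_space \<alpha>" by (auto simp: weight_space_def)
    then have "U \<subseteq> (\<Union>\<alpha>. U \<inter> weight_space \<alpha>)" by auto
    then show ?thesis using span_superset by (rule order_trans)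
  next
    case False
    then obtain H where H: "H \<in> h" "\<And>l. \<not> U \<subseteq> gen_eigenspace (br H) l" by blast
    let ?S = "span (\<Union>\<alpha>. U \<inter> weight_space \<alpha>)"
    have sub: "U \<inter> gen_eigenspace (br H) l \<subseteq> ?S" for l
    proof -
      let ?U = "U \<inter> gen_eigenspace (br H) l"
      have s: "subspace ?U"
        using less.prems subspace_gen_eigenspace[OF endo_br] by (simp add: subspace_inter)
      have "?U \<subset> U" using H(2)[of l] by blast
      then have "dim ?U < dim U" 
        using dim_psubset[of ?U U] span_eq_iff[THEN iffD2, OF s] span_eq_iff[THEN iffD2, OF less.prems(1)]
        by auto
      then have "?U \<subseteq> span (\<Union>\<alpha>. ?U \<inter> weight_space \<alpha>)"
      proof (rule less.hyps[OF _ s])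
        fix H' x assume H': "H' \<in> h" "x \<in> ?U"
        have "H' \<in> gen_eigenspace (br H) 0" using H' H(1) h_gw0 by (auto simp: weight_space_def)
        then obtain a b where "((\<lambda>x. br H x - sc 0 x) ^^ a) H' = 0" "((\<lambda>x. br H x - sc l x) ^^ b) x = 0"
          using H' by (auto simp: gen_eigenspace_def)
        from gen_eigenspace_br[OF this] have "br H' x \<in> gen_eigenspace (br H) l"
          by (auto simp: gen_eigenspace_def)
        then show "br H' x \<in> ?U" using H' less.prems(2) by auto
      qed
      also have "\<dots> \<subseteq> ?S" by (rule span_mono) auto
      finally show ?thesis .
    qed
    have "U \<subseteq> span (\<Union>l. U \<inter> gen_eigenspace (br H) l)"
      by (rule gen_eigenspace_decomp[OF alg_closed endo_br]) (use less.prems H in auto)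
    also have "\<dots> \<subseteq> ?S" by (rule span_minimal) (use sub in auto)
    finally show ?thesis .
  qed
qed

lemma weight_space_decomp:
  assumes "subspace U" "\<And>H x. H \<in> h \<Longrightarrow> x \<in> U \<Longrightarrow> br H x \<in> U"
  shows "U \<subseteq> span (\<Union>\<alpha>\<in>weights. U \<inter> weight_space \<alpha>)"
proof -
  have "U \<inter> weight_space \<alpha> \<subseteq> span (\<Union>\<alpha>\<in>weights. U \<inter> weight_space \<alpha>)"
    for \<alpha>
  proof (cases "weight_space \<alpha> = {0}")
    case True then show ?thesis by (auto simp: span_zero)
  next
    case False
    then have "restr \<alpha> \<in> weights"
      using weight_space_restr[of \<alpha>] by (auto simp: weights_def restr_def)
    then have "U \<inter> weight_space (restr \<alpha>) \<subseteq> (\<Union>\<alpha>\<in>weights. U \<inter> weight_space \<alpha>)"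
      by blast
    then show ?thesis using span_superset weight_space_restr by fastforce
  qed
  then have "span (\<Union>\<alpha>. U \<inter> weight_space \<alpha>) \<subseteq> span (\<Union>\<alpha>\<in>weights. U \<inter> weight_space \<alpha>)"
    by (intro span_minimal) auto
  then show ?thesis using weight_space_decomp_all[OF assms] by blast
qed

text \<open>A power of ad H - \<gamma>(H) kills the \<gamma>-term of the relation, so by induction
  it kills every other term too. Where \<beta>(H) differs from \<gamma>(H) this contradicts
  generalized eigenvalue \<beta>(H) unless the term is zero. Vanishing off \<open>h\<close>
  guarantees that such an H lies in \<open>h\<close>.\<close>

lemma weight_space_indep:
  assumes "finite A" "A \<subseteq> {\<alpha>. \<forall>x. x \<notin> h \<longrightarrow> \<alpha> x = 0}" "\<And>\<alpha>. \<alpha> \<in> A \<Longrightarrow> v \<alpha> \<in> weight_space \<alpha>" "(\<Sum>\<alpha>\<in>A. v \<alpha>) = 0"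
    "\<alpha> \<in> A"
  shows "v \<alpha> = 0"
  using assms
proof (induction A arbitrary: v \<alpha> rule: finite_induct)
  case empty then show ?case by simp
next
  case (insert \<gamma> A)
  have z: "v \<beta> = 0" if \<beta>: "\<beta> \<in> A" for \<beta>
  proof -
    have "\<beta> \<noteq> \<gamma>" using \<beta> insert.hyps by blast
    then obtain H where "\<beta> H \<noteq> \<gamma> H" by auto
    then have H: "H \<in> h" "\<beta> H \<noteq> \<gamma> H" using insert.prems(1) \<beta> by force+
    let ?T = "\<lambda>x. br H x - sc (\<gamma> H) x"
    have T: "endo (?T ^^ n)" for n by (intro endo_funpow endo_shift endo_br)
    have "v \<gamma> \<in> gen_eigenspace (br H) (\<gamma> H)"
      using insert.prems(2)[of \<gamma>] H(1) by (auto simp: weight_space_def)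
    then obtain n where n: "(?T ^^ n) (v \<gamma>) = 0" by (auto simp: gen_eigenspace_def)
    have "(?T ^^ n) (v \<beta>) = 0"
    proof (rule insert.IH[where v = "\<lambda>\<alpha>. (?T ^^ n) (v \<alpha>)", OF _ _ _ \<beta>])
      have "0 = (?T ^^ n) (\<Sum>\<alpha>\<in>insert \<gamma> A. v \<alpha>)"
        using insert.prems(3) endo_0[OF T] by simp
      also have "\<dots> = (\<Sum>\<alpha>\<in>A. (?T ^^ n) (v \<alpha>))"
        using insert.hyps n by (simp add: endo_sum[OF T] del: sum.insert) (simp add: n)
      finally show "(\<Sum>\<alpha>\<in>A. (?T ^^ n) (v \<alpha>)) = 0" by simp
      show "(?T ^^ n) (v \<alpha>) \<in> weight_space \<alpha>" if "\<alpha> \<in> A" for \<alpha>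
      proof (rule funpow_stable)
        show "v \<alpha> \<in> weight_space \<alpha>" using insert.prems(2) that by simp
      qed (auto intro!: subspace_diff subspace_scale subspace_weight_space weight_space_stable H)
    qed (use insert.prems in auto)
    moreover obtain m where "((\<lambda>x. br H x - sc (\<beta> H) x) ^^ m) (v \<beta>) = 0"
      using insert.prems(2)[of \<beta>] \<beta> H(1) by (auto simp: weight_space_def gen_eigenspace_def)
    ultimately show ?thesis using gen_eigenspace_disjoint[OF endo_br H(2)] by blast
  qed
  then have "v \<gamma> = 0" using insert.prems(3) insert.hyps by simp
  then show ?case using z insert.prems(4) by auto
qed

lemma weight_space_disjoint:
  assumes "\<forall>x. x \<notin> h \<longrightarrow> \<alpha> x = 0" "\<forall>x. x \<notin> h \<longrightarrow> \<beta> x = 0" "x \<in> weight_space \<alpha>" "x \<in> weight_space \<beta>" "\<alpha> \<noteq> \<beta>"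
  shows "x = 0"
proof -
  have "(if \<alpha> = \<alpha> then x else - x) = 0"
    by (rule weight_space_indep[of "{\<alpha>, \<beta>}" "\<lambda>\<gamma>. if \<gamma> = \<alpha> then x else - x"]) 
      (use assms subspace_neg[OF subspace_weight_space] in auto)
  then show ?thesis by simp
qed

lemma finite_weights: "finite weights"
proof -
  have "\<forall>\<alpha>\<in>weights. \<exists>v. v \<in> weight_space \<alpha> \<and> v \<noteq> 0"
    using subspace_0[OF subspace_weight_space] by (auto simp: weights_def)
  from bchoice[OF this] obtain v where v: "\<And>\<alpha>. \<alpha> \<in> weights \<Longrightarrow> v \<alpha> \<in> weight_space \<alpha>" "\<And>\<alpha>. \<alpha> \<in> weights \<Longrightarrow> v \<alpha> \<noteq> 0"
    by blast
  have inj: "inj_on v weights"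
  proof (rule inj_onI, rule ccontr)
    fix \<alpha> \<beta> assume ab: "\<alpha> \<in> weights" "\<beta> \<in> weights" "v \<alpha> = v \<beta>" "\<alpha> \<noteq> \<beta>"
    then show False using weight_space_disjoint[of \<alpha> \<beta> "v \<alpha>"] v[of \<alpha>] v[of \<beta>]
      by (auto simp: weights_def)
  qed
  have "independent (v ` weights)"
    unfolding independent_explicit_finite_subsets
  proof (intro allI impI ballI)
    fix S u x assume S: "S \<subseteq> v ` weights" "finite S" "(\<Sum>x\<in>S. sc (u x) x) = 0" "x \<in> S"
    obtain A where A: "A \<subseteq> weights" "S = v ` A" using S(1) by (auto simp: subset_image_iff)
    have iA: "inj_on v A" using inj A(1) by (rule inj_on_subset)
    have fA: "finite A" using S(2) A(2) iA by (simp add: finite_image_iff)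
    obtain \<alpha> where \<alpha>: "\<alpha> \<in> A" "x = v \<alpha>" using S(4) A(2) by blast
    have "sc (u (v \<alpha>)) (v \<alpha>) = 0"
    proof (rule weight_space_indep[of A "\<lambda>\<alpha>. sc (u (v \<alpha>)) (v \<alpha>)"])
      show "(\<Sum>\<alpha>\<in>A. sc (u (v \<alpha>)) (v \<alpha>)) = 0"
        using S(3) A(2) iA by (simp add: sum.reindex)
      show "sc (u (v \<alpha>)) (v \<alpha>) \<in> weight_space \<alpha>" if "\<alpha> \<in> A"
        for \<alpha>
        using v(1) that A by (intro subspace_scale subspace_weight_space) auto
    qed (use fA A \<alpha> in \<open>auto simp: weights_def\<close>)
    then show "u x = 0" using \<alpha> v A by auto
  qed
  then have "finite (v ` weights)" by (rule finiteI_independent)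
  then show ?thesis using inj by (simp add: finite_image_iff)
qed

lemma span_Union_weight_space:
  assumes "finite A" "x \<in> span (\<Union>\<alpha>\<in>A. weight_space \<alpha>)"
  obtains v where "\<And>\<alpha>. \<alpha> \<in> A \<Longrightarrow> v \<alpha> \<in> weight_space \<alpha>" "x = (\<Sum>\<alpha>\<in>A. v \<alpha>)"
proof -
  have "\<exists>v. (\<forall>\<alpha>\<in>A. v \<alpha> \<in> weight_space \<alpha>) \<and> x = (\<Sum>\<alpha>\<in>A. v \<alpha>)"
    using assms(2)
  proof (induction rule: span_induct_alt)
    case base
    show ?case by (rule exI[of _ "\<lambda>_. 0"]) (auto intro: subspace_0 subspace_weight_space)
  next
    case (step c x y)
    then obtain \<alpha> v where \<alpha>: "\<alpha> \<in> A" "x \<in> weight_space \<alpha>" and v: "\<forall>\<alpha>\<in>A. v \<alpha> \<in> weight_space \<alpha>" "y = (\<Sum>\<alpha>\<in>A. v \<alpha>)"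
      by blast
    let ?v = "\<lambda>\<beta>. (if \<beta> = \<alpha> then sc c x else 0) + v \<beta>"
    have "(\<Sum>\<beta>\<in>A. ?v \<beta>) = sc c x + y"
      using \<alpha> v assms(1) by (simp add: sum.distrib sum.delta)
    moreover have "?v \<beta> \<in> weight_space \<beta>" if "\<beta> \<in> A" for \<beta>
      using \<alpha> v that by (auto intro!: subspace_add subspace_weight_space subspace_scale)
    ultimately show ?case using \<alpha>(1) by (intro exI[of _ ?v]) simp
  qed
  then show ?thesis using that by blast
qed

lemma weight_space_Int_span:
  assumes "finite A" "A \<subseteq> weights" "\<gamma> \<in> weights" "\<gamma> \<notin> A"
  shows "weight_space \<gamma> \<inter> span (\<Union>\<alpha>\<in>A. weight_space \<alpha>) = {0}"
proof -
  have "x = 0" if x: "x \<in> weight_space \<gamma>" "x \<in> span (\<Union>\<alpha>\<in>A. weight_space \<alpha>)"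
    for x
  proof -
    obtain v where v: "\<And>\<alpha>. \<alpha> \<in> A \<Longrightarrow> v \<alpha> \<in> weight_space \<alpha>" "x = (\<Sum>\<alpha>\<in>A. v \<alpha>)"
      using span_Union_weight_space[OF assms(1) x(2)] by blast
    let ?v = "v(\<gamma> := - x)"
    have "(\<Sum>\<alpha>\<in>A. ?v \<alpha>) = (\<Sum>\<alpha>\<in>A. v \<alpha>)"
      by (rule sum.cong) (use assms in auto)
    then have "(\<Sum>\<alpha>\<in>insert \<gamma> A. ?v \<alpha>) = 0"
      using assms v by (simp del: fun_upd_apply) simp
    then have "?v \<gamma> = 0"
      by (rule weight_space_indep[rotated 3]) (use assms v x in \<open>auto simp: weights_def intro: subspace_neg subspace_weight_space\<close>)
    then show ?thesis by simp
  qed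
  then show ?thesis using subspace_0[OF subspace_weight_space] span_zero by auto
qed

section \<open>Traces over weight spaces and linearity of the weights\<close>

lemma trace_on_Union_weight_space:
  assumes "finite A" "A \<subseteq> weights" "endo T" "\<And>\<alpha> x. \<alpha> \<in> A \<Longrightarrow> x \<in> weight_space \<alpha> \<Longrightarrow> T x \<in> weight_space \<alpha>"
  shows "trace_on (span (\<Union>\<alpha>\<in>A. weight_space \<alpha>)) T = (\<Sum>\<alpha>\<in>A. trace_on (weight_space \<alpha>) T)"
  using assms
proof (induction A rule: finite_induct)
  case empty
  have "trace_on {0} T = 0" 
    by (rule trace_on_nilp[OF assms(3)]) (use endo_0[OF assms(3)] in \<open>auto intro: exI[of _ 0]\<close>)
  then show ?case by simp
next
  case (insert \<gamma> A)
  let ?S = "span (\<Union>\<alpha>\<in>A. weight_space \<alpha>)"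
  have e: "span (\<Union>\<alpha>\<in>insert \<gamma> A. weight_space \<alpha>) = span (weight_space \<gamma> \<union> ?S)"
    by (simp add: span_Un span_span)
  have st: "T x \<in> ?S" if x: "x \<in> ?S" for x
    using x
  proof (induction rule: span_induct_alt)
    case base then show ?case using endo_0[OF assms(3)] span_zero by simp
  next
    case (step c x y)
    then have "T x \<in> ?S" using insert.prems(3) by (intro span_base) blast
    then show ?case using step assms(3) by (simp add: endo_iff span_add span_scale)
  qed
  have "trace_on (span (weight_space \<gamma> \<union> ?S)) T = trace_on (weight_space \<gamma>) T + trace_on ?S T"
    by (rule trace_on_direct[OF subspace_weight_space subspace_span _ assms(3) _ st])
      (use weight_space_Int_span[of A \<gamma>] insert in auto)
  then show ?case using insert e by simp
qed

lemma span_weights: "span (\<Union>\<alpha>\<in>weights. weight_space \<alpha>) = UNIV"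
  using weight_space_decomp[OF subspace_UNIV] by auto

lemma trace_UNIV_weight_space:
  assumes "endo T" "\<And>\<alpha> x. \<alpha> \<in> weights \<Longrightarrow> x \<in> weight_space \<alpha> \<Longrightarrow> T x \<in> weight_space \<alpha>"
  shows "trace_on UNIV T = (\<Sum>\<alpha>\<in>weights. trace_on (weight_space \<alpha>) T)"
  using trace_on_Union_weight_space[OF finite_weights subset_refl assms] span_weights by simp

text \<open>An unending orbit would produce weights \<open>\<beta> + n\<delta>\<close> for all n,
  pairwise distinct in characteristic 0, while the set of weights is finite.\<close>

lemma shift_nilp:
  assumes T: "endo T" and shift: "\<And>\<beta> x. x \<in> weight_space \<beta> \<Longrightarrow> T x \<in> weight_space (\<beta> + \<delta>)"
    and \<delta>: "\<forall>x. x \<notin> h \<longrightarrow> \<delta> x = 0" "\<delta> \<noteq> 0"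
  shows "\<exists>n. (T ^^ n) x = 0"
proof -
  have 1: "\<exists>n. (T ^^ n) x = 0" if x: "\<beta> \<in> weights" "x \<in> weight_space \<beta>"
    for \<beta> x
  proof (rule ccontr)
    assume c: "\<nexists>n. (T ^^ n) x = 0"
    define w where "w n = (\<beta> + (\<lambda>H. of_nat n * \<delta> H))" for n
    have "(T ^^ n) x \<in> weight_space (w n)" for n
    proof (induction n)
      case 0
      have "w 0 = \<beta>" by (rule ext) (simp add: w_def plus_fun_def)
      then show ?case using x by simp
    next
      case (Suc n)
      have "w (Suc n) = w n + \<delta>" by (rule ext) (simp add: w_def algebra_simps plus_fun_def)
      then show ?case using shift[OF Suc] by (simp only: funpow.simps o_apply)
    qed
    then have "w n \<in> weights" for n
      using c x \<delta>(1) by (fastforce simp: weights_def w_def plus_fun_def)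
    then have "range w \<subseteq> weights" by blast
    moreover have "inj w"
    proof (rule injI)
      fix n m assume "w n = w m"
      moreover obtain H where "\<delta> H \<noteq> 0"
        using \<delta>(2) by (auto simp: fun_eq_iff zero_fun_def)
      ultimately show "n = m" by (auto simp: w_def plus_fun_def fun_eq_iff)
    qed
    ultimately show False using finite_weights finite_subset finite_imageD infinite_UNIV_nat by blast
  qed
  have "subspace {x. \<exists>n. (T ^^ n) x = 0}"
    using subspace_gen_eigenspace[OF T, of 0] by (simp add: gen_eigenspace_def)
  then have "span (\<Union>\<alpha>\<in>weights. weight_space \<alpha>) \<subseteq> {x. \<exists>n. (T ^^ n) x = 0}"
    by (intro span_minimal) (use 1 in auto)
  then show ?thesis using span_weights by auto
qed

lemma trace_weight_space:
  assumes "H \<in> h"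
  shows "trace_on (weight_space \<alpha>) (br H) = of_nat (dim (weight_space \<alpha>)) * \<alpha> H"
proof -
  let ?N = "\<lambda>x. br H x - sc (\<alpha> H) x"
  have N: "endo ?N" by (intro endo_shift endo_br)
  have st: "br H x \<in> weight_space \<alpha>" if "x \<in> weight_space \<alpha>" for x
    using weight_space_stable that assms by blast
  have stN: "?N x \<in> weight_space \<alpha>" "sc (\<alpha> H) x \<in> weight_space \<alpha>"
    if "x \<in> weight_space \<alpha>" for x
    using st[OF that] that by (auto intro: subspace_diff subspace_weight_space subspace_scale)
  have "trace_on (weight_space \<alpha>) (\<lambda>x. ?N x + sc (\<alpha> H) x) = trace_on (weight_space \<alpha>) ?N + trace_on (weight_space \<alpha>) (\<lambda>x. sc (\<alpha> H) x)"
    by (intro trace_on_add subspace_weight_space N endo_ident stN)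
  moreover have "trace_on (weight_space \<alpha>) ?N = 0"
    by (rule trace_on_nilp[OF N subspace_weight_space stN(1)]) (use assms in \<open>auto simp: weight_space_def gen_eigenspace_def\<close>)
  ultimately show ?thesis by (simp add: trace_on_id[OF subspace_weight_space] mult.commute)
qed

text \<open>The operator \<open>H^2 - \<alpha>(H)^2\<close> factors into commuting factors ad H +
  \<alpha>(H) and ad H - \<alpha>(H). The second is locally nilpotent on the weight space, so the
  product is too and contributes no trace.\<close>

lemma trace_weight_space_sq:
  assumes "H \<in> h"
  shows "trace_on (weight_space \<alpha>) (\<lambda>x. br H (br H x)) = of_nat (dim (weight_space \<alpha>)) * \<alpha> H ^ 2"
proof -
  let ?N = "\<lambda>x. br H x - sc (\<alpha> H) x"
  let ?M = "\<lambda>x. br H (br H x) - sc (\<alpha> H ^ 2) x"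
  let ?P = "\<lambda>x. br H x + sc (\<alpha> H) x"
  have N: "endo ?N" by (intro endo_shift endo_br)
  have P: "endo ?P" by (intro endo_add endo_ident endo_br)
  have B: "endo (\<lambda>x. br H (br H x))" by (rule endo_compose[OF endo_br endo_br])
  have M: "endo ?M" by (intro endo_shift B)
  have st: "br H x \<in> weight_space \<alpha>" if "x \<in> weight_space \<alpha>" for x
    using weight_space_stable that assms by blast
  have stM: "?M x \<in> weight_space \<alpha>" "sc c x \<in> weight_space \<alpha>"
    if "x \<in> weight_space \<alpha>" for x c
    using st[OF st[OF that]] that by (auto intro: subspace_diff subspace_weight_space subspace_scale)
  have MN: "?M x = ?P (?N x)" for x
    by (simp add: endo_minus[OF endo_br] br_sc_r scale_right_diff_distrib power2_eq_square)
  have cPN: "?P (?N x) = ?N (?P x)" for x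
    by (simp add: endo_minus[OF endo_br] br_sc_r br_add_r scale_right_diff_distrib scale_right_distrib)
  have c: "(?N ^^ n) (?P x) = ?P ((?N ^^ n) x)" for n x
    by (induction n) (simp_all only: funpow.simps cPN o_apply id_apply)
  have Mn: "(?M ^^ n) x = (?P ^^ n) ((?N ^^ n) x)" for n x
  proof (induction n arbitrary: x)
    case (Suc n)
    have "(?M ^^ Suc n) x = (?M ^^ n) (?P (?N x))" by (simp only: funpow_Suc_right o_apply MN)
    also have "\<dots> = (?P ^^ n) (?P ((?N ^^ n) (?N x)))" by (simp only: Suc c)
    also have "\<dots> = (?P ^^ Suc n) ((?N ^^ Suc n) x)" by (simp only: funpow_Suc_right o_apply)
    finally show ?case .
  qed simp
  have "trace_on (weight_space \<alpha>) (\<lambda>x. ?M x + sc (\<alpha> H ^ 2) x) = trace_on (weight_space \<alpha>) ?M + trace_on (weight_space \<alpha>) (\<lambda>x. sc (\<alpha> H ^ 2) x)"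
    by (intro trace_on_add subspace_weight_space M endo_ident stM)
  moreover have "trace_on (weight_space \<alpha>) ?M = 0"
  proof (rule trace_on_nilp[OF M subspace_weight_space stM(1)])
    fix x assume "x \<in> weight_space \<alpha>"
    then obtain n where "(?N ^^ n) x = 0" using assms by (auto simp: weight_space_def gen_eigenspace_def)
    then have "(?M ^^ n) x = 0" using Mn endo_0[OF endo_funpow[OF P]] by simp
    then show "\<exists>n. (?M ^^ n) x = 0" ..
  qed auto
  ultimately show ?thesis by (simp add: trace_on_id[OF subspace_weight_space] mult.commute)
qed

text \<open>Up to the nonzero dimension, the weight is the trace of the action on its weight space,
  and the trace is additive.\<close>

lemma weight_add:
  assumes "\<alpha> \<in> weights" "H \<in> h" "H' \<in> h" shows "\<alpha> (H + H') = \<alpha> H + \<alpha> H'"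
proof -
  have d: "dim (weight_space \<alpha>) \<noteq> 0"
    using assms subspace_0[OF subspace_weight_space, of \<alpha>] by (auto simp: weights_def)
  have "trace_on (weight_space \<alpha>) (br (H + H')) = trace_on (weight_space \<alpha>) (\<lambda>x. br H x + br H' x)"
    by (rule trace_on_cong) (auto simp: br_add_l subspace_weight_space)
  also have "\<dots> = trace_on (weight_space \<alpha>) (br H) + trace_on (weight_space \<alpha>) (br H')"
    by (intro trace_on_add subspace_weight_space endo_br weight_space_stable assms)
  finally show ?thesis using trace_weight_space[of _ \<alpha>] assms subspace_h d
    by (simp add: subspace_add distrib_left[symmetric])
qed

lemma weight_sc:
  assumes "\<alpha> \<in> weights" "H \<in> h" shows "\<alpha> (sc c H) = c * \<alpha> H"
proof -
  have d: "dim (weight_space \<alpha>) \<noteq> 0"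
    using assms subspace_0[OF subspace_weight_space, of \<alpha>] by (auto simp: weights_def)
  have "trace_on (weight_space \<alpha>) (br (sc c H)) = trace_on (weight_space \<alpha>) (\<lambda>x. sc c (br H x))"
    by (rule trace_on_cong) (auto simp: br_sc_l subspace_weight_space)
  also have "\<dots> = c * trace_on (weight_space \<alpha>) (br H)"
    by (intro trace_on_scale subspace_weight_space endo_br weight_space_stable assms)
  finally show ?thesis using trace_weight_space[of _ \<alpha>] assms subspace_h d
    by (simp add: subspace_scale)
qed

lemma trace_br:
  assumes "subspace U" "\<And>u. u \<in> U \<Longrightarrow> br x u \<in> U" "\<And>u. u \<in> U \<Longrightarrow> br y u \<in> U"
  shows "trace_on U (br (br x y)) = 0"
proof -
  have "trace_on U (br (br x y)) = trace_on U (\<lambda>u. br x (br y u) + sc (-1) (br y (br x u)))"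
    by (rule trace_on_cong[OF assms(1)]) (simp add: br_leibniz[of x y])
  also have "\<dots> = trace_on U (\<lambda>u. br x (br y u)) + trace_on U (\<lambda>u. sc (-1) (br y (br x u)))"
    using assms
    by (intro trace_on_add endo_scale endo_compose[OF endo_br endo_br]) (auto intro!: subspace_scale subspace_neg)
  also have "trace_on U (\<lambda>u. sc (-1) (br y (br x u))) = (-1) * trace_on U (\<lambda>u. br y (br x u))"
    using assms by (intro trace_on_scale endo_compose[OF endo_br endo_br]) auto
  also have "trace_on U (\<lambda>u. br y (br x u)) = trace_on U (\<lambda>u. br x (br y u))"
    using assms by (intro trace_on_comm endo_br) auto
  finally show ?thesis by simp
qed

text \<open>A commutator has trace 0. At this stage \<open>h\<close> is only nilpotent; this becomes
  the proof that it is abelian once the weights are known to separate its points.\<close>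

lemma weight_br:
  assumes "\<alpha> \<in> weights" "H \<in> h" "H' \<in> h" shows "\<alpha> (br H H') = 0"
proof -
  have d: "dim (weight_space \<alpha>) \<noteq> 0"
    using assms subspace_0[OF subspace_weight_space, of \<alpha>] by (auto simp: weights_def)
  have "trace_on (weight_space \<alpha>) (br (br H H')) = 0"
    by (intro trace_br subspace_weight_space weight_space_stable assms)
  then show ?thesis using trace_weight_space[of _ \<alpha>] assms h_closed d by simp
qed

lemma string_rational:
  assumes "x \<in> weight_space \<alpha>" "y \<in> weight_space (- \<alpha>)" "\<beta> \<in> weights" "\<forall>x. x \<notin> h \<longrightarrow> \<alpha> x = 0"
  shows "\<exists>q::rat. \<beta> (br x y) = of_rat q * \<alpha> (br x y)"
proof -
  let ?H = "br x y"
  have H: "?H \<in> h" using weight_space_br[OF assms(1,2)] by (simp add: weight_space_0)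
  \<comment> \<open>The string extends in both directions, so its sum of weight spaces is stable
    under ad x and ad y; a bracket whose weight is missing from the string is zero. Summing
    \<open>\<gamma> = \<beta> + k\<alpha>\<close> over the string with dimensions turns the
    vanishing trace into a relation with integer coefficients.\<close>
  define Q where "Q = {\<gamma>\<in>weights. \<exists>k::int. \<gamma> = (\<lambda>z. \<beta> z + of_int k * \<alpha> z)}"
  have "\<forall>\<gamma>\<in>Q. \<exists>k::int. \<gamma> = (\<lambda>z. \<beta> z + of_int k * \<alpha> z)"
    unfolding Q_def by blast
  from bchoice[OF this] obtain k :: "_ \<Rightarrow> int" where k: "\<And>\<gamma>. \<gamma> \<in> Q \<Longrightarrow> \<gamma> = (\<lambda>z. \<beta> z + of_int (k \<gamma>) * \<alpha> z)"
    by blast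
  have fQ: "finite Q" "Q \<subseteq> weights" using finite_weights by (auto simp: Q_def)
  have \<beta>Q: "\<beta> \<in> Q" using assms(3) by (auto simp: Q_def intro!: exI[of _ 0])
  let ?U = "span (\<Union>\<gamma>\<in>Q. weight_space \<gamma>)"
  have st: "br z u \<in> ?U"
    if u: "u \<in> ?U" and z: "z \<in> weight_space (\<lambda>H. of_int m * \<alpha> H)"
      for u z and m :: int
  proof (rule span_br_closed[of "{z}" "\<Union>\<gamma>\<in>Q. weight_space \<gamma>"])
    fix z' u assume "z' \<in> {z}" "u \<in> (\<Union>\<gamma>\<in>Q. weight_space \<gamma>)"
    then obtain \<gamma> where g: "\<gamma> \<in> Q" "u \<in> weight_space \<gamma>" "z' = z" by blast
    let ?\<delta> = "(\<lambda>H. of_int m * \<alpha> H) + \<gamma>"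
    have b: "br z u \<in> weight_space ?\<delta>" using weight_space_br[OF z g(2)] .
    show "br z' u \<in> ?U"
    proof (cases "weight_space ?\<delta> = {0}")
      case True then show ?thesis using b g span_zero by auto
    next
      case False
      have "?\<delta> = (\<lambda>z. \<beta> z + of_int (k \<gamma> + m) * \<alpha> z)" 
        by (subst k[OF g(1)]) (auto simp: plus_fun_def algebra_simps)
      moreover have "?\<delta> \<in> weights"
        using False g fQ assms(4) by (auto simp: weights_def plus_fun_def)
      ultimately have "?\<delta> \<in> Q" unfolding Q_def by blast
      then show ?thesis using b g by (intro span_base) auto
    qed
  qed (use u in \<open>auto simp: span_base\<close>)
  have "trace_on ?U (br ?H) = 0"
  proof (rule trace_br)
    show "br x u \<in> ?U" if "u \<in> ?U" for u
      using st[OF that, of x 1] assms by simp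
    have "- \<alpha> = (\<lambda>H. of_int (-1) * \<alpha> H)" by (auto simp: fun_Compl_def)
    then show "br y u \<in> ?U" if "u \<in> ?U" for u
      using st[OF that, of y "-1"] assms(2) by simp
  qed simp
  moreover have "trace_on ?U (br ?H) = (\<Sum>\<gamma>\<in>Q. trace_on (weight_space \<gamma>) (br ?H))"
    using fQ by (intro trace_on_Union_weight_space endo_br weight_space_stable H)
  ultimately have "0 = (\<Sum>\<gamma>\<in>Q. of_nat (dim (weight_space \<gamma>)) * \<gamma> ?H)"
    using H by (simp add: trace_weight_space)
  also have "\<dots> = (\<Sum>\<gamma>\<in>Q. of_nat (dim (weight_space \<gamma>)) * (\<beta> ?H + of_int (k \<gamma>) * \<alpha> ?H))"
    by (rule sum.cong[OF refl]) (subst k, auto)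
  also have "\<dots> = of_nat (\<Sum>\<gamma>\<in>Q. dim (weight_space \<gamma>)) * \<beta> ?H + of_int (\<Sum>\<gamma>\<in>Q. int (dim (weight_space \<gamma>)) * k \<gamma>) * \<alpha> ?H"
    by (simp add: distrib_left sum.distrib sum_distrib_right mult.assoc)
  finally have e: "of_nat (\<Sum>\<gamma>\<in>Q. dim (weight_space \<gamma>)) * \<beta> ?H = - of_int (\<Sum>\<gamma>\<in>Q. int (dim (weight_space \<gamma>)) * k \<gamma>) * \<alpha> ?H"
    (is "of_nat ?d * _ = - of_int ?n * _") by (simp add: eq_neg_iff_add_eq_0)
  have "dim (weight_space \<beta>) \<noteq> 0"
    using assms(3) subspace_0[OF subspace_weight_space, of \<beta>] by (auto simp: weights_def)
  moreover have "dim (weight_space \<beta>) \<le> ?d" using fQ \<beta>Q by (intro member_le_sum) auto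
  ultimately have d: "?d > 0" by linarith
  have "\<beta> ?H = of_rat (- of_int ?n / of_nat ?d) * \<alpha> ?H"
    using e d by (simp add: of_rat_divide of_rat_minus field_simps del: of_nat_sum of_int_sum)
  then show ?thesis by blast
qed

end

section \<open>The Killing form of a semisimple Lie algebra\<close>

locale lie_ss = lie_cartan sc Basis br h
  for sc :: "'k::field_char_0 \<Rightarrow> 'g::ab_group_add \<Rightarrow> 'g" and Basis br h +
  assumes semisimple_g: "semisimple sc br"
begin

lemma abelian_ideal_trivial:
  assumes "subspace I" "\<And>x y. x \<in> I \<Longrightarrow> br y x \<in> I" "\<And>x y. x \<in> I \<Longrightarrow> y \<in> I \<Longrightarrow> br x y = 0"
  shows "I = {0}"
proof -
  have "\<exists>x y. br x y = 0 \<and> x \<in> I \<and> y \<in> I"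
    using subspace_0[OF assms(1)] by (intro exI[of _ 0]) simp
  then have "{br x y |x y. x \<in> I \<and> y \<in> I} = {0}" using assms(3) by (auto 0 0) metis
  then have "bracket_span sc br I I = {0}" by (simp add: bracket_span_def span_insert_0[of "{}"])
  then have "derived_series sc br I 1 = {0}" by simp
  then have "solvable sc br I" unfolding solvable_def by blast
  moreover have "lie_ideal sc br I" using assms by (auto simp: lie_ideal_def)
  ultimately show ?thesis using semisimple_g by (auto simp: semisimple_def)
qed

definition killing :: "'g \<Rightarrow> 'g \<Rightarrow> 'k" where
  "killing x y = trace_on UNIV (\<lambda>z. br x (br y z))"

lemma endo_br2: "endo (\<lambda>z. br x (br y z))"
  by (rule endo_compose[OF endo_br endo_br])

lemma endo_br3: "endo (\<lambda>z. br x (br y (br w z)))"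
  by (rule endo_compose[OF endo_br endo_br2])

lemma killing_comm: "killing x y = killing y x"
  unfolding killing_def by (rule trace_on_comm) auto

lemma killing_add_l: "killing (x + y) z = killing x z + killing y z"
  unfolding killing_def br_add_l by (rule trace_on_add) (auto simp: endo_br2)

lemma killing_sc_l: "killing (sc c x) z = c * killing x z"
  unfolding killing_def br_sc_l by (rule trace_on_scale) (auto simp: endo_br2)

lemma killing_add_r: "killing z (x + y) = killing z x + killing z y"
  by (metis killing_comm killing_add_l)

lemma killing_sc_r: "killing z (sc c x) = c * killing z x"
  by (metis killing_comm killing_sc_l)

lemma killing_0_l [simp]: "killing 0 z = 0"
  using killing_sc_l[of 0 0 z] by simp

lemma killing_0_r [simp]: "killing z 0 = 0"
  by (metis killing_comm killing_0_l)

lemma killing_neg_l: "killing (- x) z = - killing x z"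
  using killing_sc_l[of "-1" x z] by simp

lemma killing_neg_r: "killing z (- x) = - killing z x"
  by (metis killing_comm killing_neg_l)

lemma killing_inv: "killing (br x y) z = killing x (br y z)"
proof -
  have br2: "br (br x y) w = br x (br y w) + sc (-1) (br y (br x w))" for x y w
    using br_leibniz[of x y w] by simp
  have c: "trace_on UNIV (\<lambda>w. br y (br x (br z w))) = trace_on UNIV (\<lambda>w. br x (br z (br y w)))"
    by (rule trace_on_comm[where T = "br y" and S = "\<lambda>w. br x (br z w)"]) (auto simp: endo_br2)
  have "killing (br x y) z = trace_on UNIV (\<lambda>w. br x (br y (br z w)) + sc (-1) (br y (br x (br z w))))"
    by (simp only: killing_def br2)
  also have "\<dots> = trace_on UNIV (\<lambda>w. br x (br y (br z w))) + (-1) * trace_on UNIV (\<lambda>w. br y (br x (br z w)))"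
    by (subst trace_on_add[OF subspace_UNIV endo_br3 endo_scale[OF endo_br3]], simp, simp,
        subst trace_on_scale[OF subspace_UNIV endo_br3], simp, rule refl)
  also have "\<dots> = trace_on UNIV (\<lambda>w. br x (br y (br z w))) + (-1) * trace_on UNIV (\<lambda>w. br x (br z (br y w)))"
    by (simp only: c)
  also have "\<dots> = trace_on UNIV (\<lambda>w. br x (br y (br z w)) + sc (-1) (br x (br z (br y w))))"
    by (subst trace_on_add[OF subspace_UNIV endo_br3 endo_scale[OF endo_br3]], simp, simp,
        subst trace_on_scale[OF subspace_UNIV endo_br3], simp, rule refl)
  also have "\<dots> = killing x (br y z)"
    by (simp only: killing_def br2 br_add_r br_sc_r)
  finally show ?thesis .
qed

text \<open>The composition ad x ad y moves every weight by \<open>\<alpha> + \<beta>\<close>, so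
  \<open>shift_nilp\<close> makes it nilpotent.\<close>

lemma killing_orth:
  assumes "x \<in> weight_space \<alpha>" "y \<in> weight_space \<beta>" "\<alpha> + \<beta> \<noteq> 0" "\<forall>x. x \<notin> h \<longrightarrow> \<alpha> x = 0" "\<forall>x. x \<notin> h \<longrightarrow> \<beta> x = 0"
  shows "killing x y = 0"
  unfolding killing_def
proof (rule trace_on_nilp[OF endo_br2 subspace_UNIV])
  show "\<exists>n. ((\<lambda>z. br x (br y z)) ^^ n) z = 0" for z
  proof (rule shift_nilp[OF endo_br2, where \<delta> = "\<alpha> + \<beta>"])
    show "br x (br y z) \<in> weight_space (\<gamma> + (\<alpha> + \<beta>))"
      if "z \<in> weight_space \<gamma>" for \<gamma> z
      using weight_space_br[OF assms(1) weight_space_br[OF assms(2) that]] by (simp add: add_ac)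
    show "\<forall>x. x \<notin> h \<longrightarrow> (\<alpha> + \<beta>) x = 0"
      using assms(4,5) by (simp add: plus_fun_def)
  qed fact
qed auto

lemma killing_h: "H \<in> h \<Longrightarrow> killing H H = (\<Sum>\<beta>\<in>weights. of_nat (dim (weight_space \<beta>)) * \<beta> H ^ 2)"
  unfolding killing_def
  using trace_UNIV_weight_space[OF endo_br2, of H H]
  by (simp add: weight_space_stable trace_weight_space_sq)

text \<open>The Killing square of H = [x,y] is a sum of dimensions times squares of weight values,
  that is \<open>\<alpha>(H)^2\<close> times a sum of rational squares. The summand of \<alpha>
  itself is positive unless \<alpha>(H) = 0, and all other weights at H are multiples of
  \<alpha>(H).\<close>

lemma string_vanish:
  assumes "\<alpha> \<in> weights" "x \<in> weight_space \<alpha>" "y \<in> weight_space (- \<alpha>)" "killing (br x y) (br x y) = 0" "\<beta> \<in> weights"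
  shows "\<beta> (br x y) = 0"
proof -
  let ?H = "br x y"
  have o: "\<forall>x. x \<notin> h \<longrightarrow> \<alpha> x = 0"
    using assms(1) by (auto simp: weights_def)
  have H: "?H \<in> h" using weight_space_br[OF assms(2,3)] by (simp add: weight_space_0)
  have "\<forall>\<beta>\<in>weights. \<exists>q::rat. \<beta> ?H = of_rat q * \<alpha> ?H"
    using string_rational[OF assms(2,3) _ o] by blast
  from bchoice[OF this] obtain q :: "_ \<Rightarrow> rat" where q: "\<And>\<beta>. \<beta> \<in> weights \<Longrightarrow> \<beta> ?H = of_rat (q \<beta>) * \<alpha> ?H"
    by blast
  have "\<alpha> ?H = 0"
  proof (rule ccontr)
    assume n: "\<alpha> ?H \<noteq> 0"
    have "0 = (\<Sum>\<beta>\<in>weights. of_nat (dim (weight_space \<beta>)) * (of_rat (q \<beta>) * \<alpha> ?H) ^ 2)"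
      using assms(4) unfolding killing_h[OF H] by (simp add: q)
    also have "\<dots> = of_rat (\<Sum>\<beta>\<in>weights. of_nat (dim (weight_space \<beta>)) * q \<beta> ^ 2) * (\<alpha> ?H) ^ 2"
      by (simp add: of_rat_sum of_rat_mult of_rat_power sum_distrib_right power_mult_distrib mult.assoc)
    finally have "(\<Sum>\<beta>\<in>weights. of_nat (dim (weight_space \<beta>)) * q \<beta> ^ 2) = 0"
      using n by simp
    then have "\<forall>\<beta>\<in>weights. of_nat (dim (weight_space \<beta>)) * q \<beta> ^ 2 = 0"
      using finite_weights by (subst (asm) sum_nonneg_eq_0_iff) auto
    then have "of_nat (dim (weight_space \<alpha>)) * q \<alpha> ^ 2 = 0" using assms(1) by blast
    moreover have "dim (weight_space \<alpha>) \<noteq> 0"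
      using assms(1) subspace_0[OF subspace_weight_space, of \<alpha>] by (auto simp: weights_def)
    moreover have "q \<alpha> \<noteq> 0" using q[OF assms(1)] n by auto
    ultimately show False by simp
  qed
  then show ?thesis using q[OF assms(5)] by simp
qed

section \<open>The radical of the Killing form\<close>

definition rad :: "'g set" where "rad = {x. \<forall>y. killing x y = 0}"

lemma subspace_rad: "subspace rad"
  by (auto simp: rad_def killing_add_l killing_sc_l intro!: subspaceI)

lemma rad_ideal: "x \<in> rad \<Longrightarrow> br y x \<in> rad"
  unfolding rad_def using br_anti[of y x] by (auto simp: killing_neg_l killing_inv)

lemma br_eq_0I:
  assumes "\<And>\<alpha> y. \<alpha> \<in> weights \<Longrightarrow> y \<in> weight_space \<alpha> \<Longrightarrow> br y x \<in> D" "subspace D" shows "br y x \<in> D"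
  by (rule span_br_closed[of "\<Union>\<alpha>\<in>weights. weight_space \<alpha>" "{x}"]) (use assms span_weights in \<open>auto simp: span_base\<close>)

definition radhom :: "'g set" where
  "radhom = (\<Union>\<alpha>\<in>weights - {0}. rad \<inter> weight_space \<alpha>) \<union> {H \<in> rad \<inter> h. \<forall>\<beta>\<in>weights. \<beta> H = 0}"

text \<open>The critical case is opposite weights: the bracket then lies in \<open>h\<close> and in
  the radical, so its Killing square vanishes and \<open>string_vanish\<close> supplies the extra
  condition demanded in weight 0.\<close>

lemma radhom_br:
  assumes y: "y \<in> weight_space \<beta>" and \<beta>: "\<forall>x. x \<notin> h \<longrightarrow> \<beta> x = 0" and x: "x \<in> radhom"
  shows "br y x \<in> radhom"
proof -
  have x': "x \<in> rad" using x by (auto simp: radhom_def)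
  have r: "br y x \<in> rad" by (rule rad_ideal[OF x'])
  have mem: "br y x \<in> radhom"
    if "br y x \<in> weight_space \<gamma>" "\<forall>x. x \<notin> h \<longrightarrow> \<gamma> x = 0" "\<gamma> \<noteq> 0"
      for \<gamma>
  proof (cases "weight_space \<gamma> = {0}")
    case True
    have "0 \<in> radhom" using subspace_0[OF subspace_rad] subspace_0[OF subspace_h] weight_sc[of _ 0 0]
      by (auto simp: radhom_def)
    then show ?thesis using True that by auto
  next
    case False
    then have "\<gamma> \<in> weights - {0}" using that by (auto simp: weights_def)
    then show ?thesis using r that(1) unfolding radhom_def by blast
  qed
  show ?thesis
  proof (cases "\<exists>\<alpha>\<in>weights - {0}. x \<in> weight_space \<alpha>")
    case True
    then obtain \<alpha> where \<alpha>: "\<alpha> \<in> weights" "\<alpha> \<noteq> 0" "x \<in> weight_space \<alpha>"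
      by blast
    have b: "br y x \<in> weight_space (\<beta> + \<alpha>)" using weight_space_br[OF y \<alpha>(3)] .
    show ?thesis
    proof (cases "\<beta> + \<alpha> = 0")
      case True
      then have "\<beta> = - \<alpha>" by (simp add: eq_neg_iff_add_eq_0)
      then have y': "y \<in> weight_space (- \<alpha>)" using y by simp
      have H: "br y x \<in> h" using b True weight_space_0 by simp
      have e: "br x y = - br y x" by (rule br_anti)
      have "br x y \<in> rad" using r subspace_neg[OF subspace_rad] e by simp
      then have k: "killing (br x y) (br x y) = 0" by (simp add: rad_def)
      have "\<gamma> (br y x) = 0" if "\<gamma> \<in> weights" for \<gamma>
      proof -
        have "\<gamma> (br x y) = 0" by (rule string_vanish[OF \<alpha>(1,3) y' k that])
        moreover have "\<gamma> (br x y) = - \<gamma> (br y x)"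
          using weight_sc[OF that H, of "-1"] e by simp
        ultimately show ?thesis by simp
      qed
      then show ?thesis using H r by (auto simp: radhom_def)
    next
      case False
      then show ?thesis using mem[OF b] \<alpha>(1) \<beta> by (auto simp: weights_def plus_fun_def)
    qed
  next
    case False
    then have x0: "x \<in> h" "\<And>\<gamma>. \<gamma> \<in> weights \<Longrightarrow> \<gamma> x = 0"
      using x by (auto simp: radhom_def)
    show ?thesis
    proof (cases "\<beta> = 0")
      case True
      then have "y \<in> h" using y weight_space_0 by simp
      then show ?thesis using x0 r weight_br h_closed by (auto simp: radhom_def)
    next
      case False
      have "br y x \<in> weight_space \<beta>"
        using weight_space_br[OF y, of x 0] x0(1) weight_space_0 by simp
      then show ?thesis using mem \<beta> False by blast
    qed
  qed
qed

lemma radhom_weight_space: assumes "w \<in> radhom" obtains \<beta> where "w \<in> weight_space \<beta>" "\<forall>x. x \<notin> h \<longrightarrow> \<beta> x = 0" 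
  "\<beta> \<noteq> 0 \<or> (\<forall>\<gamma>\<in>weights. \<gamma> w = 0)"
proof (cases "\<exists>\<alpha>\<in>weights - {0}. w \<in> weight_space \<alpha>")
  case True
  then show ?thesis using that by (auto simp: weights_def)
next
  case False
  then show ?thesis using assms that[of 0] weight_space_0 by (auto simp: radhom_def)
qed

lemma radhom_nilp:
  assumes "w \<in> radhom" shows "\<exists>n. (br w ^^ n) x = 0"
proof -
  obtain \<beta> where b: "w \<in> weight_space \<beta>" "\<forall>x. x \<notin> h \<longrightarrow> \<beta> x = 0" "\<beta> \<noteq> 0 \<or> (\<forall>\<gamma>\<in>weights. \<gamma> w = 0)"
    using radhom_weight_space[OF assms] .
  show ?thesis
  proof (cases "\<beta> = 0")
    case False
    show ?thesis
      by (rule shift_nilp[OF endo_br _ b(2) False]) (use weight_space_br[OF b(1)] in \<open>simp add: add.commute\<close>)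
  next
    case True
    then have "w \<in> h" using b weight_space_0 by simp
    then have "weight_space \<gamma> \<subseteq> gen_eigenspace (br w) 0"
      if "\<gamma> \<in> weights" for \<gamma>
      using that b(3) True by (fastforce simp: weight_space_def)
    then have "span (\<Union>\<alpha>\<in>weights. weight_space \<alpha>) \<subseteq> gen_eigenspace (br w) 0"
      by (intro span_minimal subspace_gen_eigenspace endo_br) auto
    then show ?thesis using span_weights by (auto simp: gen_eigenspace_0)
  qed
qed

text \<open>The abelian ideal is the centre \<open>Z\<close> of the ideal spanned by
  \<open>radhom\<close>. Engel's theorem for \<open>radhom\<close> acting on itself provides a
  nonzero element of it.\<close>

lemma radhom_trivial: "radhom \<subseteq> {0}"
proof (rule ccontr)
  assume ne: "\<not> radhom \<subseteq> {0}"
  have cl: "br w w' \<in> radhom" if "w \<in> radhom" "w' \<in> radhom" for w w'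
    using radhom_weight_space[OF that(1)] radhom_br that(2) by metis
  obtain w where w: "w \<in> radhom" "w \<noteq> 0" "\<And>w'. w' \<in> radhom \<Longrightarrow> br w' w = 0"
  proof (rule engel[of radhom radhom "{0}"])
    show "\<exists>n. (br w ^^ n) x \<in> {0}" if "w \<in> radhom" for w x
      using radhom_nilp[OF that] by simp
  qed (use ne cl radhom_nilp in auto)
  let ?P = "span radhom"
  have id: "br y x \<in> ?P" if x: "x \<in> ?P" for x y
    by (rule span_br_closed[of "\<Union>\<alpha>\<in>weights. weight_space \<alpha>" radhom])
      (use radhom_br span_base x span_weights in \<open>auto simp: weights_def\<close>)
  define Z where "Z = {x \<in> ?P. \<forall>y\<in>?P. br y x = 0}"
  have "Z = {0}"
  proof (rule abelian_ideal_trivial)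
    show "subspace Z" unfolding Z_def
      by (rule subspaceI) (auto simp: br_add_r br_sc_r span_add span_zero span_scale)
    show "br x y = 0" if "x \<in> Z" "y \<in> Z" for x y using that by (auto simp: Z_def)
    show "br y x \<in> Z" if "x \<in> Z" for x y
    proof -
      have x: "x \<in> ?P" "\<And>z. z \<in> ?P \<Longrightarrow> br z x = 0"
        using that by (auto simp: Z_def)
      have "br z (br y x) = 0" if z: "z \<in> ?P" for z
      proof -
        have "br z y = - br y z" by (rule br_anti)
        then have "br z y \<in> ?P" using id[OF z, of y] by (simp add: span_neg)
        then show ?thesis using br_leibniz[of z y x] x z by simp
      qed
      then show ?thesis using id[OF x(1)] by (auto simp: Z_def)
    qed
  qed
  moreover have "w \<in> Z"
  proof -
    have "br y w \<in> {0}" if "y \<in> ?P" for y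
      by (rule span_br_closed[of radhom "{w}"]) (use w that in \<open>auto simp: span_base\<close>)
    then show ?thesis using w span_base by (auto simp: Z_def)
  qed
  ultimately show False using w by simp
qed

text \<open>With \<open>radhom\<close> trivial, the radical has no part of nonzero weight and lies
  in \<open>h\<close>. Its brackets with root vectors are then radical elements of nonzero weight,
  its brackets with \<open>h\<close> are annihilated by all weights, and both kinds vanish. So the
  radical is central, hence an abelian ideal.\<close>

lemma killing_nondeg:
  assumes "\<And>y. killing x y = 0" shows "x = 0"
proof -
  have g: "rad \<inter> weight_space \<alpha> \<subseteq> {0}"
    if "\<alpha> \<in> weights" "\<alpha> \<noteq> 0" for \<alpha>
    using radhom_trivial that unfolding radhom_def by blast
  have "rad \<subseteq> span (\<Union>\<alpha>\<in>weights. rad \<inter> weight_space \<alpha>)"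
    by (rule weight_space_decomp) (auto simp: subspace_rad rad_ideal)
  also have "\<dots> \<subseteq> h"
  proof (rule span_minimal[OF _ subspace_h], rule UN_least)
    fix \<alpha> assume "\<alpha> \<in> weights" then show "rad \<inter> weight_space \<alpha> \<subseteq> h"
      using g[of \<alpha>] weight_space_0 subspace_0[OF subspace_h] by (cases "\<alpha> = 0") auto
  qed
  finally have rh: "rad \<subseteq> h" .
  have z: "br y x = 0" if x: "x \<in> rad" for x y
  proof -
    have "br y x \<in> {0}"
    proof (rule br_eq_0I)
      fix \<alpha> y assume a: "\<alpha> \<in> weights" "y \<in> weight_space \<alpha>"
      have r: "br y x \<in> rad" using x rad_ideal by blast
      have xh: "x \<in> h" using x rh by blast
      show "br y x \<in> {0}"
      proof (cases "\<alpha> = 0")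
        case True
        then have "y \<in> h" using a weight_space_0 by simp
        then have "br y x \<in> radhom" using r xh h_closed weight_br by (auto simp: radhom_def)
        then show ?thesis using radhom_trivial by blast
      next
        case False
        have "br y x \<in> weight_space \<alpha>"
          using weight_space_br[OF a(2), of x 0] xh weight_space_0 by simp
        then show ?thesis using g[OF a(1) False] r by blast
      qed
    qed simp
    then show ?thesis by simp
  qed
  have "rad = {0}"
    by (rule abelian_ideal_trivial) (use z subspace_0[OF subspace_rad] in \<open>auto simp: subspace_rad\<close>)
  then show ?thesis using assms by (auto simp: rad_def)
qed

section \<open>Diagonal action of the Cartan subalgebra\<close>

lemma killing_hh:
  assumes "x \<in> h" "y \<in> h"
  shows "killing x y = (\<Sum>\<beta>\<in>weights. of_nat (dim (weight_space \<beta>)) * (\<beta> x * \<beta> y))"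
proof -
  have "killing (x + y) (x + y) = (\<Sum>\<beta>\<in>weights. of_nat (dim (weight_space \<beta>)) * (\<beta> x + \<beta> y) ^ 2)"
    using assms by (subst killing_h) (auto intro: subspace_add subspace_h simp: weight_add)
  also have "\<dots> = (\<Sum>\<beta>\<in>weights. of_nat (dim (weight_space \<beta>)) * \<beta> x ^ 2) + (\<Sum>\<beta>\<in>weights. of_nat (dim (weight_space \<beta>)) * \<beta> y ^ 2)
     + 2 * (\<Sum>\<beta>\<in>weights. of_nat (dim (weight_space \<beta>)) * (\<beta> x * \<beta> y))"
    by (simp add: power2_sum distrib_left sum.distrib sum_distrib_left mult_ac)
  also have "\<dots> = killing x x + killing y y + 2 * (\<Sum>\<beta>\<in>weights. of_nat (dim (weight_space \<beta>)) * (\<beta> x * \<beta> y))"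
    using assms by (simp add: killing_h)
  finally have "2 * killing x y = 2 * (\<Sum>\<beta>\<in>weights. of_nat (dim (weight_space \<beta>)) * (\<beta> x * \<beta> y))"
    by (simp add: killing_add_l killing_add_r killing_comm[of y x])
  then show ?thesis by simp
qed

lemma killing_weight_space_nondeg:
  assumes "x \<in> weight_space \<alpha>" "x \<noteq> 0" "\<forall>x. x \<notin> h \<longrightarrow> \<alpha> x = 0"
  obtains y where "y \<in> weight_space (- \<alpha>)" "killing x y \<noteq> 0"
proof -
  have "\<exists>y\<in>weight_space (- \<alpha>). killing x y \<noteq> 0"
  proof (rule ccontr)
    assume c: "\<not> (\<exists>y\<in>weight_space (- \<alpha>). killing x y \<noteq> 0)"
    have "killing x y = 0" if "\<beta> \<in> weights" "y \<in> weight_space \<beta>" for \<beta> y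
    proof (cases "\<alpha> + \<beta> = 0")
      case True
      then have "\<beta> = - \<alpha>" by (metis add_eq_0_iff)
      then show ?thesis using c that by auto
    next
      case False
      then show ?thesis using killing_orth assms that by (auto simp: weights_def)
    qed
    moreover have "subspace {y. killing x y = 0}"
      by (rule subspaceI) (auto simp: killing_add_r killing_sc_r)
    ultimately have "span (\<Union>\<alpha>\<in>weights. weight_space \<alpha>) \<subseteq> {y. killing x y = 0}"
      by (intro span_minimal) auto
    then have "x = 0" using span_weights by (intro killing_nondeg) auto
    then show False using assms by simp
  qed
  then show ?thesis using that by blast
qed

text \<open>On \<open>h\<close> the Killing form is a combination of products of weight values, and
  it is nondegenerate there because weight 0 pairs with weight 0.\<close>

lemma weights_sep:
  assumes "H \<in> h" "\<And>\<beta>. \<beta> \<in> weights \<Longrightarrow> \<beta> H = 0" shows "H = 0"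
proof (rule ccontr)
  assume n: "H \<noteq> 0"
  obtain y where y: "y \<in> weight_space (- 0)" "killing H y \<noteq> 0"
    using killing_weight_space_nondeg[of H 0] n assms(1) weight_space_0 by (auto simp: zero_fun_def)
  have "y \<in> h" using y weight_space_0 by simp
  then have "killing H y = 0"
    unfolding killing_hh[OF assms(1) \<open>y \<in> h\<close>]
    by (intro sum.neutral ballI) (simp add: assms(2))
  then show False using y(2) by simp
qed

lemma h_abelian: "x \<in> h \<Longrightarrow> y \<in> h \<Longrightarrow> br x y = 0"
  by (rule weights_sep) (auto simp: h_closed weight_br)

text \<open>In a nonzero \<open>h\<close>-stable subspace of least dimension, the true eigenspace of
  each H is nonzero by nilpotency and again \<open>h\<close>-stable because \<open>h\<close> is
  abelian. By minimality it is everything.\<close>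

lemma common_eigenvector:
  assumes "\<beta> \<in> weights"
  obtains v where "v \<in> weight_space \<beta>" "v \<noteq> 0" "\<And>H. H \<in> h \<Longrightarrow> br H v = sc (\<beta> H) v"
proof -
  define good where "good U \<longleftrightarrow> subspace U \<and> U \<subseteq> weight_space \<beta> \<and> U \<noteq> {0} \<and> (\<forall>H\<in>h. \<forall>u\<in>U. br H u \<in> U)"
    for U
  have "good (weight_space \<beta>)"
    using assms by (auto simp: good_def subspace_weight_space weight_space_stable weights_def)
  then obtain U where U: "good U" "\<And>U'. good U' \<Longrightarrow> dim U \<le> dim U'"
    using ex_has_least_nat[of good _ dim] by blast
  obtain v where v: "v \<in> U" "v \<noteq> 0" using U subspace_0 by (auto simp: good_def)
  have "br H v = sc (\<beta> H) v" if H: "H \<in> h" for H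
  proof -
    let ?T = "\<lambda>x. br H x - sc (\<beta> H) x"
    let ?K = "{u \<in> U. br H u = sc (\<beta> H) u}"
    have T: "endo ?T" by (intro endo_shift endo_br)
    have TU: "?T u \<in> U" if "u \<in> U" for u
      using that U(1) H by (auto simp: good_def intro!: subspace_diff subspace_scale)
    have "subspace ?K" using U(1)
      by (intro subspaceI) (auto simp: good_def br_add_r br_sc_r scale_right_distrib mult.commute
      intro: subspace_add subspace_scale subspace_0)
    moreover have "?K \<noteq> {0}"
    proof -
      have "v \<in> gen_eigenspace (br H) (\<beta> H)"
        using v U(1) H by (auto simp: good_def weight_space_def)
      then obtain n where n: "(?T ^^ n) v = 0" unfolding gen_eigenspace_def by blast
      define m where "m = (LEAST n. (?T ^^ n) v = 0)"
      have m: "(?T ^^ m) v = 0" unfolding m_def using n by (rule LeastI)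
      then obtain k where k: "m = Suc k" using v(2) by (cases m) auto
      have "(?T ^^ k) v \<noteq> 0"
        using not_less_Least[of k "\<lambda>n. (?T ^^ n) v = 0"] k m_def by auto
      moreover have "(?T ^^ k) v \<in> U" by (rule funpow_stable) (use TU v in auto)
      moreover have "?T ((?T ^^ k) v) = 0" using m k by simp
      ultimately have "(?T ^^ k) v \<in> ?K" "(?T ^^ k) v \<noteq> 0" by simp_all
      then show ?thesis by blast
    qed
    moreover have "br H' u \<in> ?K" if "H' \<in> h" "u \<in> ?K" for H' u
      using that U(1) h_abelian[OF H that(1)] br_leibniz[of H H' u] by (auto simp: good_def br_sc_r)
    ultimately have "good ?K" using U(1) by (auto simp: good_def)
    then have "dim U \<le> dim ?K" by (rule U(2))
    then have "?K = U" using \<open>subspace ?K\<close> U(1)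
      by (intro subspace_dim_equal) (auto simp: good_def)
    then show ?thesis using v by blast
  qed
  then show ?thesis using that v U(1) by (auto simp: good_def)
qed

section \<open>Roots and one-dimensional root spaces\<close>

definition root_set :: "('g \<Rightarrow> 'k) set" where "root_set = weights - {0}"

lemma root_set_out: "\<alpha> \<in> root_set \<Longrightarrow> x \<notin> h \<Longrightarrow> \<alpha> x = 0"
  by (auto simp: root_set_def weights_def)

lemma weight_space_ne: "\<alpha> \<in> weights \<Longrightarrow> \<exists>x\<in>weight_space \<alpha>. x \<noteq> 0"
  using subspace_0[OF subspace_weight_space] by (auto simp: weights_def)

lemma root_set_neg: assumes "\<alpha> \<in> root_set" shows "- \<alpha> \<in> root_set"
proof -
  obtain x where x: "x \<in> weight_space \<alpha>" "x \<noteq> 0"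
    using assms weight_space_ne by (auto simp: root_set_def)
  obtain y where "y \<in> weight_space (- \<alpha>)" "killing x y \<noteq> 0"
    using killing_weight_space_nondeg[OF x] assms root_set_out by blast
  then have "weight_space (- \<alpha>) \<noteq> {0}" by auto
  then show ?thesis using assms by (auto simp: root_set_def weights_def)
qed

text \<open>One trace gives all three claims. The sum of a line in weight \<open>-\<alpha>\<close>,
  of \<open>h\<close>, and of the spaces of weight \<open>k\<alpha>\<close> for k positive is stable
  under ad x and ad y, so H = [x,y] has trace 0 on it. Dividing by \<alpha>(H), the sum of k times
  the dimension in weight \<open>k\<alpha>\<close> equals 1, which leaves only k = 1 with dimension
  1.\<close>

lemma root_triple:
  assumes \<alpha>: "\<alpha> \<in> root_set"
  shows "\<exists>x\<in>weight_space \<alpha>. \<exists>y\<in>weight_space (- \<alpha>). \<alpha> (br x y) = 2" (is ?A)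
    and "dim (weight_space \<alpha>) = 1" (is ?B)
    and "\<And>k. k \<ge> 2 \<Longrightarrow> (\<lambda>H. of_nat k * \<alpha> H) \<notin> weights" (is "PROP ?C")
proof -
  have out: "\<forall>x. x \<notin> h \<longrightarrow> \<alpha> x = 0"
    using root_set_out[OF \<alpha>] by blast
  have \<alpha>w: "\<alpha> \<in> weights" and m\<alpha>: "- \<alpha> \<in> weights"
    using \<alpha> root_set_neg by (auto simp: root_set_def)
  obtain H0 where H0: "\<alpha> H0 \<noteq> 0"
    using \<alpha> by (auto simp: root_set_def fun_eq_iff zero_fun_def)
  have H0h: "H0 \<in> h" using H0 out by blast
  \<comment> \<open>A true eigenvector of \<open>h\<close>, so that brackets of \<open>y\<close>
    with \<open>h\<close> stay on its line.\<close>
  obtain y where y: "y \<in> weight_space (- \<alpha>)" "y \<noteq> 0" "\<And>H. H \<in> h \<Longrightarrow> br H y = sc ((- \<alpha>) H) y"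
    using common_eigenvector[OF m\<alpha>] by blast
  have out': "\<forall>x. x \<notin> h \<longrightarrow> (- \<alpha>) x = 0"
    using out by (simp add: fun_Compl_def)
  obtain x where x: "x \<in> weight_space \<alpha>" "killing y x \<noteq> 0"
    using killing_weight_space_nondeg[OF y(1,2) out'] unfolding minus_minus by blast
  define H where "H = br x y"
  have Hh: "H \<in> h" using weight_space_br[OF x(1) y(1)] by (simp add: weight_space_0 H_def)
  have kH: "killing H' H = \<alpha> H' * killing x y" if "H' \<in> h" for H'
  proof -
    have "killing H' H = killing (br H' x) y" unfolding H_def by (simp add: killing_inv)
    also have "\<dots> = - killing (br x H') y" by (subst br_anti) (simp add: killing_neg_l)
    also have "\<dots> = - killing x (sc ((- \<alpha>) H') y)"
      using y(3)[OF that] by (simp add: killing_inv)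
    also have "\<dots> = \<alpha> H' * killing x y"
      by (simp only: killing_sc_r) (simp add: fun_Compl_def)
    finally show ?thesis .
  qed
  have "H \<noteq> 0" using kH[OF H0h] H0 x(2) killing_comm[of x y] by auto
  have aH: "\<alpha> H \<noteq> 0"
  proof
    assume z: "\<alpha> H = 0"
    have "\<beta> H = 0" if "\<beta> \<in> weights" for \<beta>
      using string_rational[OF x(1) y(1) that out] z by (auto simp: H_def)
    then show False using weights_sep[OF Hh] \<open>H \<noteq> 0\<close> by blast
  qed
  show ?A
  proof (intro bexI)
    have "br (sc (2 / \<alpha> H) x) y = sc (2 / \<alpha> H) H" by (simp add: br_sc_l H_def)
    then show "\<alpha> (br (sc (2 / \<alpha> H) x) y) = 2" using weight_sc[OF \<alpha>w Hh] aH by simp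
  qed (use x y in \<open>auto intro: subspace_scale subspace_weight_space\<close>)
  define m where "m k = (\<lambda>H. of_nat k * \<alpha> H)" for k
  have m_inj: "k = k'" if "m k = m k'" for k k'
  proof -
    have "m k H = m k' H" using that by simp
    then show ?thesis using aH by (simp add: m_def)
  qed
  have m_add: "\<alpha> + m k = m (Suc k)" for k by (auto simp: m_def plus_fun_def algebra_simps)
  have m_sub: "- \<alpha> + m (Suc k) = m k" for k
    by (auto simp: m_def plus_fun_def algebra_simps fun_Compl_def)
  have m0: "m 0 = 0" by (auto simp: m_def zero_fun_def)
  have m1: "m 1 = \<alpha>" by (auto simp: m_def)
  have m_out: "\<forall>x. x \<notin> h \<longrightarrow> m k x = 0" for k using out by (simp add: m_def)
  define A where "A = {\<gamma>\<in>weights. \<exists>k. \<gamma> = m k}"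
  have A: "finite A" "A \<subseteq> weights" using finite_weights by (auto simp: A_def)
  define Q where "Q = span (\<Union>\<gamma>\<in>A. weight_space \<gamma>)"
  have gQ: "weight_space (m k) \<subseteq> Q" for k
  proof (cases "weight_space (m k) = {0}")
    case True then show ?thesis by (simp add: Q_def span_zero)
  next
    case False
    then have "m k \<in> A" using m_out by (auto simp: A_def weights_def)
    then show ?thesis unfolding Q_def using span_superset by blast
  qed
  \<comment> \<open>Only a line in weight \<open>-\<alpha>\<close>, not the full weight space, so
    that its trace is exactly \<open>- \<alpha> H\<close>.\<close>
  define Y where "Y = span {y}"
  have sQ: "subspace Q" and sY: "subspace Y" by (auto simp: Q_def Y_def)
  have nA: "- \<alpha> \<notin> A"
  proof
    assume "- \<alpha> \<in> A"
    then obtain k where "- \<alpha> = m k" by (auto simp: A_def)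
    then have "(- \<alpha>) H = m k H" by simp
    then have "- \<alpha> H = of_nat k * \<alpha> H" by (simp add: m_def fun_Compl_def)
    then have "\<alpha> H + of_nat k * \<alpha> H = 0" by (metis add.right_inverse)
    then have "of_nat (Suc k) * \<alpha> H = 0" by (simp add: algebra_simps)
    then show False using aH by (simp del: of_nat_Suc)
  qed
  have Yg: "Y \<subseteq> weight_space (- \<alpha>)"
    unfolding Y_def by (rule span_minimal) (auto simp: y subspace_weight_space)
  have YQ: "Y \<inter> Q = {0}"
    using weight_space_Int_span[OF A m\<alpha> nA] Yg subspace_0[OF sY] subspace_0[OF sQ]
    by (auto simp: Q_def)
  let ?U = "span (Y \<union> Q)"
  have YU: "Y \<subseteq> ?U" and QU: "Q \<subseteq> ?U" using span_superset by blast+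
  have eU: "?U = span ({y} \<union> (\<Union>\<gamma>\<in>A. weight_space \<gamma>))"
    by (simp only: Y_def Q_def span_Un span_span)
  have HY: "br H u \<in> Y" if "u \<in> Y" for u
    by (rule span_br_closed[of "{H}" "{y}" Y]) (use that y(3)[OF Hh] sY in \<open>auto simp: Y_def span_base span_scale intro!: span_neg\<close>)
  have HQ: "br H u \<in> Q" if "u \<in> Q" for u
    by (rule span_br_closed[of "{H}" "\<Union>\<gamma>\<in>A. weight_space \<gamma>" Q]) 
      (use that weight_space_stable[OF Hh] sQ in \<open>auto simp: Q_def intro: span_base\<close>)
  have "trace_on ?U (br H) = 0"
    unfolding H_def
  proof (rule trace_br)
    show "br x u \<in> ?U" if "u \<in> ?U" for u
    proof (rule span_br_closed[of "{x}" "{y} \<union> (\<Union>\<gamma>\<in>A. weight_space \<gamma>)" ?U])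
      fix x' u assume "x' \<in> {x}" "u \<in> {y} \<union> (\<Union>\<gamma>\<in>A. weight_space \<gamma>)"
      then consider "x' = x" "u = y" | k where "x' = x" "u \<in> weight_space (m k)"
        by (auto simp: A_def)
      then have "br x' u \<in> Q"
      proof cases
        case 1 then show ?thesis using Hh gQ[of 0] m0 weight_space_0 by (auto simp: H_def)
      next
        case 2
        then show ?thesis using weight_space_br[OF x(1) 2(2)] gQ[of "Suc k"] by (auto simp: m_add)
      qed
      then show "br x' u \<in> ?U" using QU by blast
    qed (use that eU in \<open>auto simp: span_base\<close>)
    show "br y u \<in> ?U" if "u \<in> ?U" for u
    proof (rule span_br_closed[of "{y}" "{y} \<union> (\<Union>\<gamma>\<in>A. weight_space \<gamma>)" ?U])
      fix x' u assume "x' \<in> {y}" "u \<in> {y} \<union> (\<Union>\<gamma>\<in>A. weight_space \<gamma>)"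
      then consider "x' = y" "u = y" | k where "x' = y" "u \<in> weight_space (m k)"
        by (auto simp: A_def)
      then show "br x' u \<in> ?U"
      proof cases
        case 1 then show ?thesis by (simp add: span_zero)
      next
        case 2
        show ?thesis
        proof (cases k)
          case 0
          then have "u \<in> h" using 2 m0 weight_space_0 by simp
          then have "br y u = - sc ((- \<alpha>) u) y" using y(3) br_anti[of y u] by simp
          then have "br y u \<in> Y" using sY by (simp add: Y_def span_neg span_scale span_base)
          then show ?thesis using 2 YU by auto
        next
          case (Suc j)
          have "br y u \<in> weight_space (m j)"
            using weight_space_br[OF y(1) 2(2)] unfolding Suc m_sub .
          then show ?thesis using gQ[of j] QU 2(1) by auto
        qed
      qed
    qed (use that eU in \<open>auto simp: span_base\<close>)
  qed simp
  moreover have "trace_on ?U (br H) = trace_on Y (br H) + trace_on Q (br H)"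
    by (rule trace_on_direct[OF sY sQ YQ endo_br HY HQ])
  moreover have "trace_on Y (br H) = - \<alpha> H"
  proof -
    have "br H u = sc (- \<alpha> H) u" if "u \<in> Y" for u
      using that y(3)[OF Hh] by (auto simp: Y_def span_singleton br_sc_r mult.commute)
    then have "trace_on Y (br H) = trace_on Y (\<lambda>u. sc (- \<alpha> H) u)"
      by (rule trace_on_cong[OF sY])
    moreover have "dim Y = 1" using y(2) by (simp add: Y_def)
    moreover have "trace_on Y (\<lambda>u. sc (- \<alpha> H) u) = - \<alpha> H * of_nat (dim Y)"
      by (rule trace_on_id[OF sY])
    ultimately show ?thesis by (metis mult.right_neutral of_nat_1)
  qed
  moreover have "trace_on Q (br H) = (\<Sum>\<gamma>\<in>A. of_nat (dim (weight_space \<gamma>)) * \<gamma> H)"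
    unfolding Q_def using trace_on_Union_weight_space[OF A endo_br weight_space_stable[OF Hh]] Hh
    by (simp add: trace_weight_space)
  ultimately have s: "(\<Sum>\<gamma>\<in>A. of_nat (dim (weight_space \<gamma>)) * \<gamma> H) = \<alpha> H"
    by simp
  have "\<forall>\<gamma>\<in>A. \<exists>k. \<gamma> = m k" unfolding A_def by blast
  from bchoice[OF this] obtain k where k: "\<And>\<gamma>. \<gamma> \<in> A \<Longrightarrow> \<gamma> = m (k \<gamma>)"
    by blast
  have "(\<Sum>\<gamma>\<in>A. of_nat (dim (weight_space \<gamma>)) * \<gamma> H) = (\<Sum>\<gamma>\<in>A. of_nat (dim (weight_space \<gamma>) * k \<gamma>) * \<alpha> H)"
  proof (rule sum.cong[OF refl])
    fix \<gamma> assume "\<gamma> \<in> A"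
    then have "\<gamma> H = of_nat (k \<gamma>) * \<alpha> H"
      using k[of \<gamma>] unfolding m_def by metis
    then show "of_nat (dim (weight_space \<gamma>)) * \<gamma> H = of_nat (dim (weight_space \<gamma>) * k \<gamma>) * \<alpha> H"
      by (simp add: mult.assoc)
  qed
  also have "\<dots> = of_nat (\<Sum>\<gamma>\<in>A. dim (weight_space \<gamma>) * k \<gamma>) * \<alpha> H"
    by (simp add: sum_distrib_right)
  finally have "of_nat (\<Sum>\<gamma>\<in>A. dim (weight_space \<gamma>) * k \<gamma>) * \<alpha> H = 1 * \<alpha> H"
    using s by simp
  then have "of_nat (\<Sum>\<gamma>\<in>A. dim (weight_space \<gamma>) * k \<gamma>) = (1::'k)"
    using aH mult_right_cancel by blast
  then have S: "(\<Sum>\<gamma>\<in>A. dim (weight_space \<gamma>) * k \<gamma>) = 1"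
    by (metis of_nat_1 of_nat_eq_iff)
  have le: "dim (weight_space \<gamma>) * k \<gamma> \<le> 1" if "\<gamma> \<in> A" for \<gamma>
    using member_le_sum[of \<gamma> A "\<lambda>\<gamma>. dim (weight_space \<gamma>) * k \<gamma>"] A that S
    by simp
  have d0: "dim (weight_space \<gamma>) \<noteq> 0" if "\<gamma> \<in> weights" for \<gamma>
    using weight_space_ne[OF that] by auto
  have \<alpha>A: "\<alpha> \<in> A" using \<alpha>w m1 unfolding A_def by blast
  have "k \<alpha> = 1" using k[OF \<alpha>A] m1 m_inj by metis
  then have "dim (weight_space \<alpha>) \<le> 1" using le[OF \<alpha>A] by (simp only: mult_1_right)
  then show ?B using d0[OF \<alpha>w] by linarith
  show "(\<lambda>H. of_nat j * \<alpha> H) \<notin> weights" if j: "j \<ge> 2" for j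
  proof
    assume "(\<lambda>H. of_nat j * \<alpha> H) \<in> weights"
    then have mA: "m j \<in> A" by (auto simp: A_def m_def)
    then have "k (m j) = j" using k[OF mA] m_inj by metis
    then have "dim (weight_space (m j)) * j \<le> 1" using le[OF mA] by (simp only:)
    moreover have "dim (weight_space (m j)) \<noteq> 0" using d0 mA A by blast
    then have "1 * j \<le> dim (weight_space (m j)) * j" by (intro mult_le_mono1) linarith
    ultimately show False using j by linarith
  qed
qed

end

section \<open>Coroots and root strings\<close>

context lie_ss
begin

lemma weight_space_span:
  assumes "\<alpha> \<in> root_set" "x \<in> weight_space \<alpha>" "x \<noteq> 0" shows "weight_space \<alpha> = span {x}"
proof -
  have "span {x} \<subseteq> weight_space \<alpha>"
    by (rule span_minimal) (use assms subspace_weight_space in auto)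
  then have "span {x} = weight_space \<alpha>"
    using assms root_triple(2)[OF assms(1)]
    by (intro subspace_dim_equal) (auto simp: subspace_weight_space)
  then show ?thesis by simp
qed

lemma weight_space_multiple:
  assumes "\<alpha> \<in> root_set" "x \<in> weight_space \<alpha>" "x \<noteq> 0" "z \<in> weight_space \<alpha>" obtains c where "z = sc c x"
  using weight_space_span[OF assms(1-3)] assms(4) by (auto simp: span_singleton)

text \<open>A root space is a line that contains a common eigenvector, and \<open>h\<close> is
  abelian; so generalized weight spaces are honest ones. This identifies \<open>root_set\<close>
  with \<open>roots\<close>.\<close>

lemma h_act:
  assumes "v \<in> weight_space \<gamma>" "\<forall>x. x \<notin> h \<longrightarrow> \<gamma> x = 0" "H \<in> h"
  shows "br H v = sc (\<gamma> H) v"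
proof (cases "\<gamma> = 0 \<or> weight_space \<gamma> = {0}")
  case True
  then show ?thesis using assms h_abelian weight_space_0 by (auto simp: zero_fun_def)
next
  case False
  then have g: "\<gamma> \<in> root_set" using assms by (auto simp: root_set_def weights_def)
  then have "\<gamma> \<in> weights" by (simp add: root_set_def)
  from common_eigenvector[OF this] obtain w where w: "w \<in> weight_space \<gamma>" "w \<noteq> 0" "\<And>H. H \<in> h \<Longrightarrow> br H w = sc (\<gamma> H) w" 
    by blast
  obtain c where "v = sc c w" using weight_space_multiple[OF g w(1,2) assms(1)] .
  then show ?thesis using w(3)[OF assms(3)] by (simp add: br_sc_r mult.commute)
qed

lemma weight_space_sup_root_space: "root_space sc br h \<alpha> \<subseteq> weight_space \<alpha>"
proof
  fix x assume "x \<in> root_space sc br h \<alpha>"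
  then have "((\<lambda>x. br H x - sc (\<alpha> H) x) ^^ 1) x = 0" if "H \<in> h" for H
    using that by (simp add: root_space_def)
  then show "x \<in> weight_space \<alpha>" unfolding weight_space_def gen_eigenspace_def by blast
qed

lemma root_space_eq: "\<forall>x. x \<notin> h \<longrightarrow> \<alpha> x = 0 \<Longrightarrow> root_space sc br h \<alpha> = weight_space \<alpha>"
  using weight_space_sup_root_space h_act by (auto simp: root_space_def)

lemma roots_eq: "roots sc br h = root_set"
proof
  show "roots sc br h \<subseteq> root_set"
    using root_space_eq by (auto simp: roots_def root_set_def weights_def hdual_def)
  show "root_set \<subseteq> roots sc br h"
  proof
    fix \<alpha> assume \<alpha>: "\<alpha> \<in> root_set"
    then have w: "\<alpha> \<in> weights" by (simp add: root_set_def)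
    then show "\<alpha> \<in> roots sc br h"
      using \<alpha> weight_add[OF w] weight_sc[OF w] root_space_eq[of \<alpha>]
      by (simp add: roots_def root_set_def weights_def hdual_def dual_on_def)
  qed
qed

abbreviation co :: "('g \<Rightarrow> 'k) \<Rightarrow> 'g" where "co \<equiv> coroot sc br h"

text \<open>Both root spaces are lines, so the span of their brackets is the line of
  \<open>br x y\<close>, on which the normalisation singles out one point.\<close>

lemma co_eq:
  assumes \<alpha>: "\<alpha> \<in> root_set" and x: "x \<in> weight_space \<alpha>" and y: "y \<in> weight_space (- \<alpha>)" and 2: "\<alpha> (br x y) = 2"
  shows "co \<alpha> = br x y"
proof -
  have w: "\<alpha> \<in> weights" using \<alpha> by (simp add: root_set_def)
  have out: "\<forall>x. x \<notin> h \<longrightarrow> \<alpha> x = 0"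
    using root_set_out[OF \<alpha>] by blast
  have out': "\<forall>x. x \<notin> h \<longrightarrow> (- \<alpha>) x = 0"
    using out by (simp add: fun_Compl_def)
  have H: "br x y \<in> h" using weight_space_br[OF x y] weight_space_0 by simp
  have "\<alpha> 0 = 0" using weight_sc[OF w H, of 0] by simp
  then have n: "x \<noteq> 0" "y \<noteq> 0" using 2 by auto
  have "bracket_span sc br (weight_space \<alpha>) (weight_space (- \<alpha>)) = span {br x y}"
  proof
    show "bracket_span sc br (weight_space \<alpha>) (weight_space (- \<alpha>)) \<subseteq> span {br x y}"
      unfolding bracket_span_def weight_space_span[OF \<alpha> x n(1)] weight_space_span[OF root_set_neg[OF \<alpha>] y n(2)]
    proof (rule span_minimal)
      show "{br u v |u v. u \<in> span {x} \<and> v \<in> span {y}} \<subseteq> span {br x y}"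
        using span_br_closed[of "{x}" "{y}" "span {br x y}"] by (auto simp: span_base)
    qed simp
    show "span {br x y} \<subseteq> bracket_span sc br (weight_space \<alpha>) (weight_space (- \<alpha>))"
      unfolding bracket_span_def by (rule span_mono) (use x y in auto)
  qed
  then have b: "bracket_span sc br (root_space sc br h \<alpha>) (root_space sc br h (- \<alpha>)) = span {br x y}"
    using out out' by (simp add: root_space_eq)
  show ?thesis unfolding coroot_def b
  proof (rule the_equality)
    show "br x y \<in> span {br x y} \<and> \<alpha> (br x y) = 2" using 2 by (simp add: span_base)
    fix H assume "H \<in> span {br x y} \<and> \<alpha> H = 2"
    then obtain c where c: "H = sc c (br x y)" "\<alpha> H = 2" by (auto simp: span_singleton)
    then have "c * 2 = 2" using weight_sc[OF w H] 2 by simp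
    then have "c = 1" by simp
    then show "H = br x y" using c by simp
  qed
qed

lemma co_triple:
  assumes "\<alpha> \<in> root_set" obtains x y where "x \<in> weight_space \<alpha>" "y \<in> weight_space (- \<alpha>)" "br x y = co \<alpha>" "\<alpha> (co \<alpha>) = 2"
  using root_triple(1)[OF assms] co_eq[OF assms] that by metis

lemma co_h: "\<alpha> \<in> root_set \<Longrightarrow> co \<alpha> \<in> h"
proof -
  assume "\<alpha> \<in> root_set"
  then obtain x y where "x \<in> weight_space \<alpha>" "y \<in> weight_space (- \<alpha>)" "br x y = co \<alpha>" "\<alpha> (co \<alpha>) = 2"
    by (rule co_triple)
  then show ?thesis using weight_space_br[of x \<alpha> y "- \<alpha>"] weight_space_0 by simp
qed

lemma co_2: "\<alpha> \<in> root_set \<Longrightarrow> \<alpha> (co \<alpha>) = 2"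
  by (rule co_triple)

lemma weight_neg: "\<alpha> \<in> weights \<Longrightarrow> H \<in> h \<Longrightarrow> \<alpha> (- H) = - \<alpha> H"
  using weight_sc[of \<alpha> H "-1"] by simp

lemma co_neg: assumes "\<alpha> \<in> root_set" shows "co (- \<alpha>) = - co \<alpha>"
proof -
  obtain x y where t: "x \<in> weight_space \<alpha>" "y \<in> weight_space (- \<alpha>)" "br x y = co \<alpha>" "\<alpha> (co \<alpha>) = 2"
    using co_triple[OF assms] .
  have e: "br y x = - co \<alpha>" using t(3) br_anti[of y x] by simp
  have "co (- \<alpha>) = br y x"
  proof (rule co_eq[OF root_set_neg[OF assms] t(2)])
    show "(- \<alpha>) (br y x) = 2"
      unfolding e using t(4) weight_neg[OF _ co_h[OF assms], of \<alpha>] assms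
      by (simp add: root_set_def fun_Compl_def)
  qed (use t in simp)
  then show ?thesis using e by simp
qed

text \<open>With H = [x,y] and \<open>b\<close> killed by y, induction gives
  \<open>y x^(k+1) b = -(k+1) (\<beta>(H) + k) x^k b\<close>. At the last nonzero power r the left
  side vanishes, which forces \<beta>(H) = -r.\<close>

lemma sl2_low:
  assumes \<alpha>: "\<alpha> \<in> root_set" and x: "x \<in> weight_space \<alpha>" and y: "y \<in> weight_space (- \<alpha>)" and 2: "\<alpha> (br x y) = 2"
    and \<beta>: "\<forall>x. x \<notin> h \<longrightarrow> \<beta> x = 0" and b: "b \<in> weight_space \<beta>" "b \<noteq> 0" "br y b = 0"
  shows "\<exists>r. \<beta> (br x y) = - of_nat r \<and> (\<forall>k\<le>r. (br x ^^ k) b \<noteq> 0)"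
proof -
  let ?H = "br x y"
  have H: "?H \<in> h" using weight_space_br[OF x y] weight_space_0 by simp
  have \<alpha>o: "\<forall>x. x \<notin> h \<longrightarrow> \<alpha> x = 0"
    using root_set_out[OF \<alpha>] by blast
  have g: "(br x ^^ k) b \<in> weight_space (\<lambda>H. \<beta> H + of_nat k * \<alpha> H)" for k
  proof (induction k)
    case 0 then show ?case using b by simp
  next
    case (Suc k)
    have e: "\<alpha> + (\<lambda>H. \<beta> H + of_nat k * \<alpha> H) = (\<lambda>H. \<beta> H + of_nat (Suc k) * \<alpha> H)"
      by (auto simp: plus_fun_def algebra_simps)
    show ?case using weight_space_br[OF x Suc] unfolding e by simp
  qed
  have act: "br ?H ((br x ^^ k) b) = sc (\<beta> ?H + of_nat k * 2) ((br x ^^ k) b)" for k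
    using h_act[OF g _ H, of k] \<alpha>o \<beta> 2 by simp
  have low: "br y ((br x ^^ Suc k) b) = sc (- (of_nat (Suc k) * (\<beta> ?H + of_nat k))) ((br x ^^ k) b)"
    for k
  proof (induction k)
    case 0
    have "br y (br x b) = br (br y x) b + br x (br y b)" by (rule br_leibniz)
    also have "br y x = - ?H" by (rule br_anti)
    finally show ?case using act[of 0] b(3) by (simp add: br_neg_l)
  next
    case (Suc k)
    have "br y ((br x ^^ Suc (Suc k)) b) = br y (br x ((br x ^^ Suc k) b))" by simp
    also have "\<dots> = br (br y x) ((br x ^^ Suc k) b) + br x (br y ((br x ^^ Suc k) b))"
      by (rule br_leibniz)
    also have "br y x = - ?H" by (rule br_anti)
    also have "br (- ?H) ((br x ^^ Suc k) b) = sc (- (\<beta> ?H + of_nat (Suc k) * 2)) ((br x ^^ Suc k) b)"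
      by (simp only: br_neg_l act scale_minus_left)
    also have "br x (br y ((br x ^^ Suc k) b)) = sc (- (of_nat (Suc k) * (\<beta> ?H + of_nat k))) ((br x ^^ Suc k) b)"
      unfolding Suc.IH by (simp add: br_sc_r br_neg_r)
    finally show ?case by (simp only: scale_left_distrib[symmetric]) (simp add: algebra_simps)
  qed
  have "\<exists>n. (br x ^^ n) b = 0"
    by (rule shift_nilp[OF endo_br _ \<alpha>o]) (use weight_space_br[OF x] \<alpha> in \<open>auto simp: add.commute root_set_def\<close>)
  define n where "n = (LEAST n. (br x ^^ n) b = 0)"
  have n: "(br x ^^ n) b = 0" unfolding n_def using \<open>\<exists>n. _ n\<close> by (rule LeastI_ex)
  have nm: "(br x ^^ k) b \<noteq> 0" if "k < n" for k
    using not_less_Least[of k "\<lambda>n. (br x ^^ n) b = 0"] that by (simp add: n_def)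
  obtain r where r: "n = Suc r" using n b(2) by (cases n) auto
  have "sc (- (of_nat (Suc r) * (\<beta> ?H + of_nat r))) ((br x ^^ r) b) = 0"
    using low[of r] n r by (metis br_zero_r)
  then have "of_nat (Suc r) * (\<beta> ?H + of_nat r) = 0" using nm[of r] r by simp
  then have "\<beta> ?H + of_nat r = 0" by (metis mult_eq_0_iff of_nat_eq_0_iff nat.distinct(1))
  then have "\<beta> ?H = - of_nat r" by (simp add: eq_neg_iff_add_eq_0)
  then show ?thesis using nm r by auto
qed

text \<open>Climb i steps along \<alpha> until x kills the vector, then descend with the opposite
  triple. \<open>sl2_low\<close> gives the value r at the top, hence r - 2i at \<beta>, and r
  nonzero steps down. Weight \<open>\<beta> - k\<alpha>\<close> is reached after i + k steps, which
  is at most r when k is at most r - 2i.\<close>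

lemma pairing_string:
  assumes \<alpha>: "\<alpha> \<in> root_set" and \<beta>: "\<beta> \<in> weights"
  shows "\<exists>n::int. \<beta> (co \<alpha>) = of_int n \<and> (\<forall>k. int k \<le> n \<longrightarrow> weight_space (\<lambda>H. \<beta> H - of_nat k * \<alpha> H) \<noteq> {0})"
proof -
  obtain x y where t: "x \<in> weight_space \<alpha>" "y \<in> weight_space (- \<alpha>)" "br x y = co \<alpha>" "\<alpha> (co \<alpha>) = 2"
    using co_triple[OF \<alpha>] .
  have \<alpha>w: "\<alpha> \<in> weights" using \<alpha> by (simp add: root_set_def)
  have out: "\<forall>x. x \<notin> h \<longrightarrow> \<alpha> x = 0" "\<forall>x. x \<notin> h \<longrightarrow> \<beta> x = 0"
    using root_set_out[OF \<alpha>] \<beta> by (auto simp: weights_def)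
  obtain b where b: "b \<in> weight_space \<beta>" "b \<noteq> 0"
    using weight_space_ne[OF \<beta>] by blast
  have g: "(br x ^^ k) b \<in> weight_space (\<lambda>H. \<beta> H + of_nat k * \<alpha> H)" for k
  proof (induction k)
    case 0 then show ?case using b by simp
  next
    case (Suc k)
    have e: "\<alpha> + (\<lambda>H. \<beta> H + of_nat k * \<alpha> H) = (\<lambda>H. \<beta> H + of_nat (Suc k) * \<alpha> H)"
      by (auto simp: plus_fun_def algebra_simps)
    show ?case using weight_space_br[OF t(1) Suc] unfolding e by simp
  qed
  have ex: "\<exists>n. (br x ^^ n) b = 0"
    by (rule shift_nilp[OF endo_br _ out(1)]) (use weight_space_br[OF t(1)] \<alpha> in \<open>auto simp: add.commute root_set_def\<close>)
  define n where "n = (LEAST n. (br x ^^ n) b = 0)"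
  have n: "(br x ^^ n) b = 0" unfolding n_def using ex by (rule LeastI_ex)
  obtain i where i: "n = Suc i" using n b(2) by (cases n) auto
  define c where "c = (br x ^^ i) b"
  have c0: "c \<noteq> 0"
    using not_less_Least[of i "\<lambda>n. (br x ^^ n) b = 0"] i by (simp add: n_def c_def)
  have xc: "br x c = 0" using n i by (simp add: c_def)
  let ?\<gamma> = "\<lambda>H. \<beta> H + of_nat i * \<alpha> H"
  have cg: "c \<in> weight_space ?\<gamma>" using g by (simp add: c_def)
  have go: "\<forall>x. x \<notin> h \<longrightarrow> ?\<gamma> x = 0" using out by simp
  have weight_space\<gamma>: "?\<gamma> \<in> weights" using cg c0 go by (auto simp: weights_def)
  have e: "br y x = - co \<alpha>" using t(3) br_anti[of y x] by simp
  have 2: "(- \<alpha>) (br y x) = 2"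
    unfolding e using t(4) weight_neg[OF \<alpha>w co_h[OF \<alpha>]] by (simp add: fun_Compl_def)
  have x': "x \<in> weight_space (- (- \<alpha>))" using t(1) by (simp only: minus_minus)
  obtain r where r: "?\<gamma> (br y x) = - of_nat r" "\<forall>k\<le>r. (br y ^^ k) c \<noteq> 0"
    using sl2_low[OF root_set_neg[OF \<alpha>] t(2) x' 2 go cg c0 xc] by blast
  have "?\<gamma> (- co \<alpha>) = - ?\<gamma> (co \<alpha>)"
    using weight_neg[OF weight_space\<gamma> co_h[OF \<alpha>]] .
  then have "- ?\<gamma> (co \<alpha>) = - of_nat r" using r(1) unfolding e by (simp only:)
  then have "?\<gamma> (co \<alpha>) = of_nat r" by (simp only: neg_equal_iff_equal)
  then have "\<beta> (co \<alpha>) + of_nat i * 2 = of_nat r" using t(4) by simp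
  then have v: "\<beta> (co \<alpha>) = of_int (int r - 2 * int i)" by (simp add: algebra_simps)
  have gy: "(br y ^^ k) c \<in> weight_space (\<lambda>H. \<beta> H + of_int (int i - int k) * \<alpha> H)"
    for k
  proof (induction k)
    case 0 then show ?case using cg by simp
  next
    case (Suc k)
    have e: "- \<alpha> + (\<lambda>H. \<beta> H + of_int (int i - int k) * \<alpha> H) = (\<lambda>H. \<beta> H + of_int (int i - int (Suc k)) * \<alpha> H)"
      by (auto simp: plus_fun_def algebra_simps fun_Compl_def)
    show ?case using weight_space_br[OF t(2) Suc] unfolding e by simp
  qed
  have "weight_space (\<lambda>H. \<beta> H - of_nat k * \<alpha> H) \<noteq> {0}"
    if k: "int k \<le> int r - 2 * int i" for k
  proof -
    have "(br y ^^ (i + k)) c \<in> weight_space (\<lambda>H. \<beta> H - of_nat k * \<alpha> H)"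
      using gy[of "i + k"] by simp
    moreover have "(br y ^^ (i + k)) c \<noteq> 0" using r(2) k by simp
    ultimately show ?thesis by blast
  qed
  then show ?thesis using v by blast
qed

text \<open>The pairing of \<beta> with the coroot of \<alpha>, read as an integer so that its sign
  makes sense.\<close>

definition cartan_int :: "('g \<Rightarrow> 'k) \<Rightarrow> ('g \<Rightarrow> 'k) \<Rightarrow> int" where
  "cartan_int \<beta> \<alpha> = (THE n. \<beta> (co \<alpha>) = of_int n)"

lemma cartan_intI: "\<beta> (co \<alpha>) = of_int n \<Longrightarrow> cartan_int \<beta> \<alpha> = n"
  unfolding cartan_int_def by (rule the_equality) auto

lemma cartan_int_wt: "\<alpha> \<in> root_set \<Longrightarrow> \<beta> \<in> weights \<Longrightarrow> of_int (cartan_int \<beta> \<alpha>) = \<beta> (co \<alpha>)"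
  using pairing_string cartan_intI by metis

lemma cartan_int_of: "\<alpha> \<in> root_set \<Longrightarrow> \<beta> \<in> root_set \<Longrightarrow> of_int (cartan_int \<beta> \<alpha>) = \<beta> (co \<alpha>)"
  using cartan_int_wt by (simp add: root_set_def)

lemma cartan_int_self: "\<alpha> \<in> root_set \<Longrightarrow> cartan_int \<alpha> \<alpha> = 2"
  by (rule cartan_intI) (simp add: co_2)

lemma cartan_int_neg_r: "\<alpha> \<in> root_set \<Longrightarrow> \<beta> \<in> root_set \<Longrightarrow> cartan_int \<beta> (- \<alpha>) = - cartan_int \<beta> \<alpha>"
  by (rule cartan_intI) (simp add: co_neg cartan_int_of weight_neg[of \<beta>] co_h, simp add: root_set_def weight_neg co_h)

text \<open>The conclusion is about \<open>weights\<close> because the string may pass through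
  0.\<close>

lemma cartan_int_string:
  assumes "\<alpha> \<in> root_set" "\<beta> \<in> root_set" "int k \<le> cartan_int \<beta> \<alpha>"
  shows "(\<lambda>H. \<beta> H - of_nat k * \<alpha> H) \<in> weights"
proof -
  have "\<beta> \<in> weights" using assms by (simp add: root_set_def)
  then obtain n :: int where n: "\<beta> (co \<alpha>) = of_int n" "\<forall>k. int k \<le> n \<longrightarrow> weight_space (\<lambda>H. \<beta> H - of_nat k * \<alpha> H) \<noteq> {0}"
    using pairing_string[OF assms(1)] by blast
  moreover have "cartan_int \<beta> \<alpha> = n" by (rule cartan_intI) (rule n(1))
  moreover have "\<forall>x. x \<notin> h \<longrightarrow> \<beta> x - of_nat k * \<alpha> x = 0"
    using root_set_out[OF assms(1)] root_set_out[OF assms(2)] by simp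
  ultimately show ?thesis using assms(3) by (simp add: weights_def)
qed

lemma root_diff:
  assumes "\<alpha> \<in> root_set" "\<beta> \<in> root_set" "cartan_int \<beta> \<alpha> > 0" "\<beta> \<noteq> \<alpha>" shows "\<beta> - \<alpha> \<in> root_set"
proof -
  have "(\<lambda>H. \<beta> H - of_nat 1 * \<alpha> H) = \<beta> - \<alpha>" by (simp add: fun_diff_def)
  then show ?thesis using cartan_int_string[OF assms(1,2), of 1] assms(3,4) by (simp add: root_set_def)
qed

lemma root_diff2:
  assumes "\<alpha> \<in> root_set" "\<beta> \<in> root_set" "cartan_int \<beta> \<alpha> \<ge> 2" "\<beta> - \<alpha> \<noteq> \<alpha>" shows "\<beta> - \<alpha> - \<alpha> \<in> root_set"
proof -
  have "(\<lambda>H. \<beta> H - of_nat 2 * \<alpha> H) = \<beta> - \<alpha> - \<alpha>"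
    by (simp add: fun_diff_def)
  then show ?thesis using cartan_int_string[OF assms(1,2), of 2] assms(3,4) by (simp add: root_set_def)
qed

lemma root_double: "\<alpha> \<in> root_set \<Longrightarrow> \<alpha> + \<alpha> \<notin> root_set"
proof -
  assume "\<alpha> \<in> root_set"
  moreover have "(\<lambda>H. of_nat 2 * \<alpha> H) = \<alpha> + \<alpha>" by (simp add: plus_fun_def)
  ultimately show ?thesis using root_triple(3)[of \<alpha> 2] by (simp add: root_set_def)
qed

text \<open>If y killed \<open>b\<close>, then \<open>b\<close> would be a lowest vector and
  \<open>sl2_low\<close> would make the pairing nonpositive.\<close>

lemma br_pos_ne:
  assumes "\<alpha> \<in> root_set" "\<beta> \<in> root_set" "cartan_int \<beta> \<alpha> > 0" "b \<in> weight_space \<beta>" "b \<noteq> 0" "y \<in> weight_space (- \<alpha>)" "y \<noteq> 0"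
  shows "br y b \<noteq> 0"
proof
  assume z: "br y b = 0"
  obtain x y' where t: "x \<in> weight_space \<alpha>" "y' \<in> weight_space (- \<alpha>)" "br x y' = co \<alpha>" "\<alpha> (co \<alpha>) = 2"
    using co_triple[OF assms(1)] .
  obtain c where c: "y' = sc c y"
    using weight_space_multiple[OF root_set_neg[OF assms(1)] assms(6,7) t(2)] .
  then have "br y' b = 0" using z by (simp add: br_sc_l)
  then obtain r where "\<beta> (co \<alpha>) = - of_nat r"
    using sl2_low[OF assms(1) t(1,2) _ _ assms(4,5)] t(3,4) root_set_out[OF assms(2)] by auto
  then have "cartan_int \<beta> \<alpha> = - int r" by (intro cartan_intI) simp
  then show False using assms(3) by simp
qed

lemma killing_ne:
  assumes "\<alpha> \<in> root_set" "x \<in> weight_space \<alpha>" "x \<noteq> 0" "y \<in> weight_space (- \<alpha>)" "y \<noteq> 0" shows "killing x y \<noteq> 0"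
proof -
  obtain z where z: "z \<in> weight_space (- \<alpha>)" "killing x z \<noteq> 0"
    using killing_weight_space_nondeg[OF assms(2,3)] root_set_out[OF assms(1)] by blast
  obtain c where "z = sc c y" using weight_space_multiple[OF root_set_neg[OF assms(1)] assms(4,5) z(1)] .
  then show ?thesis using z by (auto simp: killing_sc_r)
qed

text \<open>By invariance of the Killing form, [x,z] is tested against y of weight
  \<open>-(\<alpha> + \<beta>)\<close> by pairing z with [y,x]. The latter is nonzero by
  \<open>br_pos_ne\<close>, and opposite root lines pair nontrivially.\<close>

lemma br_sum_ne:
  assumes "\<alpha> \<in> root_set" "\<beta> \<in> root_set" "\<alpha> + \<beta> \<in> root_set" "cartan_int \<alpha> (\<alpha> + \<beta>) > 0" "x \<in> weight_space \<alpha>" "x \<noteq> 0" "z \<in> weight_space \<beta>" "z \<noteq> 0"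
  shows "br x z \<noteq> 0"
proof -
  have "- (\<alpha> + \<beta>) \<in> weights" using root_set_neg[OF assms(3)] by (simp add: root_set_def)
  then obtain y where y: "y \<in> weight_space (- (\<alpha> + \<beta>))" "y \<noteq> 0"
    using weight_space_ne by blast
  have n: "br y x \<noteq> 0" by (rule br_pos_ne[OF assms(3,1,4,5,6) y])
  have "br y x \<in> weight_space (- (\<alpha> + \<beta>) + \<alpha>)"
    by (rule weight_space_br[OF y(1) assms(5)])
  then have "br y x \<in> weight_space (- \<beta>)" by simp
  then have "killing z (br y x) \<noteq> 0" using killing_ne[OF assms(2,7,8) _ n] by simp
  then have "killing y (br x z) \<noteq> 0" by (metis killing_comm killing_inv)
  then show ?thesis by auto
qed

text \<open>The squared Killing length of the coroot, as an integer. It takes the place of a scalar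
  product on the dual of \<open>h\<close>, for which the field has no notion of positivity.\<close>

definition coroot_norm :: "('g \<Rightarrow> 'k) \<Rightarrow> int" where
  "coroot_norm \<alpha> = (\<Sum>\<gamma>\<in>weights. int (dim (weight_space \<gamma>)) * cartan_int \<gamma> \<alpha> ^ 2)"

lemma coroot_norm_pos: assumes "\<alpha> \<in> root_set" shows "coroot_norm \<alpha> > 0"
proof -
  have "int (dim (weight_space \<alpha>)) * cartan_int \<alpha> \<alpha> ^ 2 \<le> coroot_norm \<alpha>"
    unfolding coroot_norm_def
    by (rule member_le_sum) (use assms finite_weights in \<open>auto simp: root_set_def\<close>)
  then show ?thesis using root_triple(2)[OF assms] cartan_int_self[OF assms] by simp
qed

lemma coroot_norm_killing: assumes "\<alpha> \<in> root_set" shows "killing (co \<alpha>) (co \<alpha>) = of_int (coroot_norm \<alpha>)"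
  unfolding coroot_norm_def killing_h[OF co_h[OF assms]] using assms by (simp add: cartan_int_wt)

lemma killing_co:
  assumes "\<alpha> \<in> root_set" "H \<in> h" shows "2 * killing H (co \<alpha>) = \<alpha> H * of_int (coroot_norm \<alpha>)"
proof -
  obtain x y where t: "x \<in> weight_space \<alpha>" "y \<in> weight_space (- \<alpha>)" "br x y = co \<alpha>" "\<alpha> (co \<alpha>) = 2"
    using co_triple[OF assms(1)] .
  have k: "killing H (co \<alpha>) = \<alpha> H * killing x y" if "H \<in> h" for H
  proof -
    have "killing H (co \<alpha>) = killing (br H x) y"
      unfolding t(3)[symmetric] by (simp add: killing_inv)
    also have "br H x = sc (\<alpha> H) x" using h_act[OF t(1) _ that] root_set_out[OF assms(1)] by blast
    finally show ?thesis by (simp add: killing_sc_l)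
  qed
  have "of_int (coroot_norm \<alpha>) = 2 * killing x y"
    using k[OF co_h[OF assms(1)]] t(4) coroot_norm_killing[OF assms(1)] by simp
  then show ?thesis using k[OF assms(2)] by simp
qed

text \<open>Both sides equal twice the Killing product of the two coroots. Since the norms are
  positive, the sign and the vanishing of \<open>cartan_int\<close> are symmetric.\<close>

lemma cartan_int_sym:
  assumes "\<alpha> \<in> root_set" "\<beta> \<in> root_set" shows "cartan_int \<alpha> \<beta> * coroot_norm \<alpha> = cartan_int \<beta> \<alpha> * coroot_norm \<beta>"
proof -
  have "of_int (cartan_int \<alpha> \<beta> * coroot_norm \<alpha>) = (of_int (cartan_int \<beta> \<alpha> * coroot_norm \<beta>) :: 'k)"
    using killing_co[OF assms(1) co_h[OF assms(2)]] killing_co[OF assms(2) co_h[OF assms(1)]] killing_comm[of "co \<alpha>" "co \<beta>"]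
    by (simp add: cartan_int_of assms)
  then show ?thesis by (simp only: of_int_eq_iff)
qed

end

section \<open>Highest roots and the cascade\<close>

locale lie_base = lie_ss sc Basis br h
  for sc :: "'k::field_char_0 \<Rightarrow> 'g::ab_group_add \<Rightarrow> 'g" and Basis br h +
  fixes B :: "('g \<Rightarrow> 'k) set"
  assumes base: "is_base sc br h B"
begin

lemma finB: "finite B" and B_root_set: "B \<subseteq> root_set" and B_indep: "\<not> module.dependent fscale B"
  using base by (auto simp: is_base_def roots_eq)

sublocale fs: vector_space "fscale :: 'k \<Rightarrow> ('g \<Rightarrow> 'k) \<Rightarrow> ('g \<Rightarrow> 'k)"
  by unfold_locales (auto simp: fscale_def algebra_simps)

section \<open>Integer coordinates with respect to the base\<close>

definition lin :: "(('g \<Rightarrow> 'k) \<Rightarrow> int) \<Rightarrow> 'g \<Rightarrow> 'k" where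
  "lin c = (\<lambda>x. \<Sum>\<gamma>\<in>B. of_int (c \<gamma>) * \<gamma> x)"

definition root_lattice :: "('g \<Rightarrow> 'k) set" where "root_lattice = range lin"

lemma sum_apply: "(\<Sum>i\<in>A. f i) x = (\<Sum>i\<in>A. f i x)" for f :: "'i \<Rightarrow> 'g \<Rightarrow> 'k"
  by (induction A rule: infinite_finite_induct) auto

lemma lin_cong: "(\<And>\<gamma>. \<gamma> \<in> B \<Longrightarrow> c \<gamma> = d \<gamma>) \<Longrightarrow> lin c = lin d"
  unfolding lin_def by (rule ext, rule sum.cong) auto

lemma lin_zero_iff:
  assumes "lin c = 0" "\<gamma> \<in> B" shows "c \<gamma> = 0"
proof -
  have "(\<Sum>\<gamma>\<in>B. fscale (of_int (c \<gamma>)) \<gamma>) = lin c"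
    by (rule ext) (simp add: lin_def fscale_def sum_apply)
  then have "of_int (c \<gamma>) = (0::'k)"
    using fs.independentD[OF B_indep finB subset_refl, of "\<lambda>\<gamma>. of_int (c \<gamma>)" \<gamma>] assms
    by simp
  then show ?thesis by simp
qed

lemma lin_add: "lin c + lin d = lin (\<lambda>\<gamma>. c \<gamma> + d \<gamma>)"
  by (rule ext) (simp add: lin_def algebra_simps sum.distrib)

lemma lin_diff: "lin c - lin d = lin (\<lambda>\<gamma>. c \<gamma> - d \<gamma>)"
  by (rule ext) (simp add: lin_def algebra_simps sum_subtractf)

lemma lin_inj: "lin c = lin d \<Longrightarrow> \<gamma> \<in> B \<Longrightarrow> c \<gamma> = d \<gamma>"
  using lin_zero_iff[of "\<lambda>\<gamma>. c \<gamma> - d \<gamma>" \<gamma>] lin_diff[of c d] by simp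

text \<open>Set to 0 outside \<open>B\<close>, so that sign conditions can be stated for all
  arguments.\<close>

definition base_coeff :: "('g \<Rightarrow> 'k) \<Rightarrow> ('g \<Rightarrow> 'k) \<Rightarrow> int" where
  "base_coeff l = (\<lambda>\<gamma>. if \<gamma> \<in> B then (SOME c. l = lin c) \<gamma> else 0)"

lemma base_coeff_lin: "base_coeff (lin c) \<gamma> = (if \<gamma> \<in> B then c \<gamma> else 0)"
proof -
  have "lin c = lin (SOME d. lin c = lin d)" by (rule someI[of "\<lambda>d. lin c = lin d", OF refl])
  then show ?thesis using lin_inj[of c "SOME d. lin c = lin d" \<gamma>] by (auto simp: base_coeff_def)
qed

lemma lin_base_coeff: "l \<in> root_lattice \<Longrightarrow> lin (base_coeff l) = l"
proof -
  assume "l \<in> root_lattice"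
  then obtain c where "l = lin c" by (auto simp: root_lattice_def)
  moreover have "lin (base_coeff (lin c)) = lin c" by (rule lin_cong) (simp add: base_coeff_lin)
  ultimately show ?thesis by simp
qed

lemma base_coeff_out: "\<gamma> \<notin> B \<Longrightarrow> base_coeff l \<gamma> = 0"
  by (simp add: base_coeff_def)

lemma root_lattice_eqI: "l \<in> root_lattice \<Longrightarrow> m \<in> root_lattice \<Longrightarrow> (\<And>\<gamma>. \<gamma> \<in> B \<Longrightarrow> base_coeff l \<gamma> = base_coeff m \<gamma>) \<Longrightarrow> l = m"
proof -
  assume a: "l \<in> root_lattice" "m \<in> root_lattice" "\<And>\<gamma>. \<gamma> \<in> B \<Longrightarrow> base_coeff l \<gamma> = base_coeff m \<gamma>"
  have "base_coeff l = base_coeff m" using a(3) base_coeff_out by (intro ext) metis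
  then have "lin (base_coeff l) = lin (base_coeff m)" by (rule arg_cong)
  then show "l = m" unfolding lin_base_coeff[OF a(1)] lin_base_coeff[OF a(2)] .
qed

lemma root_lattice_add [intro]: "l \<in> root_lattice \<Longrightarrow> m \<in> root_lattice \<Longrightarrow> l + m \<in> root_lattice"
  by (auto simp: root_lattice_def lin_add)

lemma root_lattice_diff [intro]: "l \<in> root_lattice \<Longrightarrow> m \<in> root_lattice \<Longrightarrow> l - m \<in> root_lattice"
  by (auto simp: root_lattice_def lin_diff)

lemma base_coeff_add: "l \<in> root_lattice \<Longrightarrow> m \<in> root_lattice \<Longrightarrow> base_coeff (l + m) \<gamma> = base_coeff l \<gamma> + base_coeff m \<gamma>"
  by (auto simp: root_lattice_def lin_add base_coeff_lin)

lemma base_coeff_diff: "l \<in> root_lattice \<Longrightarrow> m \<in> root_lattice \<Longrightarrow> base_coeff (l - m) \<gamma> = base_coeff l \<gamma> - base_coeff m \<gamma>"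
  by (auto simp: root_lattice_def lin_diff base_coeff_lin)

lemma root_lattice_0: "0 \<in> root_lattice" and base_coeff_0: "base_coeff 0 \<gamma> = 0"
proof -
  have "lin (\<lambda>_. 0) = 0" by (rule ext) (simp add: lin_def)
  then show "0 \<in> root_lattice" "base_coeff 0 \<gamma> = 0"
    using base_coeff_lin[of "\<lambda>_. 0" \<gamma>]
    by (auto simp: root_lattice_def intro: range_eqI[OF sym])
qed

lemma root_lattice_neg [intro]: "l \<in> root_lattice \<Longrightarrow> - l \<in> root_lattice"
  using root_lattice_diff[OF root_lattice_0, of l] by simp

lemma base_coeff_neg: "l \<in> root_lattice \<Longrightarrow> base_coeff (- l) \<gamma> = - base_coeff l \<gamma>"
  using base_coeff_diff[OF root_lattice_0, of l \<gamma>] by (simp add: base_coeff_0)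

lemma root_set_root_lattice: "\<alpha> \<in> root_set \<Longrightarrow> \<alpha> \<in> root_lattice"
  using base by (fastforce simp: is_base_def roots_eq root_lattice_def lin_def)

lemma root_set_sign: assumes "\<alpha> \<in> root_set" shows "(\<forall>\<gamma>. base_coeff \<alpha> \<gamma> \<ge> 0) \<or> (\<forall>\<gamma>. base_coeff \<alpha> \<gamma> \<le> 0)"
proof -
  obtain c where c: "(\<forall>\<gamma>\<in>B. 0 \<le> c \<gamma>) \<or> (\<forall>\<gamma>\<in>B. c \<gamma> \<le> 0)" "\<alpha> = lin c"
    using base assms unfolding is_base_def roots_eq lin_def by blast
  then show ?thesis by (auto simp: base_coeff_lin)
qed

lemma base_coeff_base: assumes "\<delta> \<in> B" shows "base_coeff \<delta> \<gamma> = (if \<gamma> = \<delta> then 1 else 0)"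
proof -
  have "(\<lambda>x. \<Sum>\<gamma>\<in>B. of_int (if \<gamma> = \<delta> then 1 else 0) * \<gamma> x) = \<delta>"
  proof
    fix x
    have "(\<Sum>\<gamma>\<in>B. of_int (if \<gamma> = \<delta> then 1 else 0) * \<gamma> x) = (\<Sum>\<gamma>\<in>B. if \<gamma> = \<delta> then \<gamma> x else 0)"
      by (rule sum.cong) auto
    then show "(\<Sum>\<gamma>\<in>B. of_int (if \<gamma> = \<delta> then 1 else 0) * \<gamma> x) = \<delta> x"
      using assms finB by simp
  qed
  then have "lin (\<lambda>\<gamma>. if \<gamma> = \<delta> then 1 else 0) = \<delta>"
    by (simp add: lin_def)
  then show ?thesis using base_coeff_lin[of "\<lambda>\<gamma>. if \<gamma> = \<delta> then 1 else 0" \<gamma>] assms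
    by (auto split: if_splits)
qed

lemma cartan_int_root_lattice:
  assumes "l \<in> root_lattice" "\<alpha> \<in> root_set" shows "cartan_int l \<alpha> = (\<Sum>\<gamma>\<in>B. base_coeff l \<gamma> * cartan_int \<gamma> \<alpha>)"
proof (rule cartan_intI)
  have "l (co \<alpha>) = lin (base_coeff l) (co \<alpha>)" using lin_base_coeff[OF assms(1)] by simp
  also have "\<dots> = (\<Sum>\<gamma>\<in>B. of_int (base_coeff l \<gamma>) * of_int (cartan_int \<gamma> \<alpha>))"
    unfolding lin_def
    by (rule sum.cong[OF refl], subst cartan_int_of[OF assms(2)]) (use B_root_set in auto)
  finally show "l (co \<alpha>) = of_int (\<Sum>\<gamma>\<in>B. base_coeff l \<gamma> * cartan_int \<gamma> \<alpha>)"
    by simp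
qed

lemma cartan_int_add: "l \<in> root_lattice \<Longrightarrow> m \<in> root_lattice \<Longrightarrow> \<alpha> \<in> root_set \<Longrightarrow> cartan_int (l + m) \<alpha> = cartan_int l \<alpha> + cartan_int m \<alpha>"
  by (subst (1 2 3) cartan_int_root_lattice) (auto simp: base_coeff_add distrib_right sum.distrib)

lemma cartan_int_pos_sym: assumes "\<alpha> \<in> root_set" "\<beta> \<in> root_set" shows "cartan_int \<alpha> \<beta> > 0 \<longleftrightarrow> cartan_int \<beta> \<alpha> > 0"
  using cartan_int_sym[OF assms] coroot_norm_pos[OF assms(1)] coroot_norm_pos[OF assms(2)]
  by (metis zero_less_mult_pos2 mult_pos_pos)

lemma cartan_int_zero_sym: assumes "\<alpha> \<in> root_set" "\<beta> \<in> root_set" shows "cartan_int \<alpha> \<beta> = 0 \<longleftrightarrow> cartan_int \<beta> \<alpha> = 0"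
  using cartan_int_sym[OF assms] coroot_norm_pos[OF assms(1)] coroot_norm_pos[OF assms(2)]
  by (metis mult_eq_0_iff less_irrefl)

lemma cartan_int_ge0_sym: assumes "\<alpha> \<in> root_set" "\<beta> \<in> root_set" "cartan_int \<alpha> \<beta> \<ge> 0" shows "cartan_int \<beta> \<alpha> \<ge> 0"
  using cartan_int_pos_sym[OF assms(1,2)] cartan_int_zero_sym[OF assms(1,2)] assms(3) by linarith

section \<open>Supports, heights and positive roots\<close>

definition supp :: "('g \<Rightarrow> 'k) \<Rightarrow> ('g \<Rightarrow> 'k) set" where "supp l = {\<gamma>\<in>B. base_coeff l \<gamma> \<noteq> 0}"
definition ht :: "('g \<Rightarrow> 'k) \<Rightarrow> int" where "ht l = (\<Sum>\<gamma>\<in>B. base_coeff l \<gamma>)"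
definition pos_roots :: "('g \<Rightarrow> 'k) set \<Rightarrow> ('g \<Rightarrow> 'k) set" where
  "pos_roots S = {\<beta>\<in>root_set. (\<forall>\<gamma>. base_coeff \<beta> \<gamma> \<ge> 0) \<and> supp \<beta> \<subseteq> S}"

lemma comb_lin: 
  assumes "S \<subseteq> B" shows "(\<lambda>x. \<Sum>\<alpha>\<in>S. of_int (c \<alpha>) * \<alpha> x) = lin (\<lambda>\<gamma>. if \<gamma> \<in> S then c \<gamma> else 0)"
  unfolding lin_def by (rule ext, rule sum.mono_neutral_cong_left) (use assms finB in auto)

lemma mem_int_comb: assumes "S \<subseteq> B" shows "l \<in> int_comb S \<longleftrightarrow> l \<in> root_lattice \<and> supp l \<subseteq> S"
proof
  assume "l \<in> int_comb S"
  then obtain c where "l = lin (\<lambda>\<gamma>. if \<gamma> \<in> S then c \<gamma> else 0)"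
    using comb_lin[OF assms] by (auto simp: int_comb_def)
  then show "l \<in> root_lattice \<and> supp l \<subseteq> S"
    by (auto simp: root_lattice_def supp_def base_coeff_lin)
next
  assume a: "l \<in> root_lattice \<and> supp l \<subseteq> S"
  have "l = lin (base_coeff l)" using a lin_base_coeff by simp
  also have "\<dots> = lin (\<lambda>\<gamma>. if \<gamma> \<in> S then base_coeff l \<gamma> else 0)"
    unfolding lin_def
    by (rule ext, rule sum.cong) (use a in \<open>auto simp: supp_def\<close>)
  finally show "l \<in> int_comb S" unfolding int_comb_def
    using comb_lin[OF assms, of "base_coeff l"] by (intro CollectI exI[of _ "base_coeff l"]) simp
qed

lemma mem_nat_comb: assumes "S \<subseteq> B" 
  shows "l \<in> nat_comb S \<longleftrightarrow> l \<in> root_lattice \<and> (\<forall>\<gamma>. base_coeff l \<gamma> \<ge> 0) \<and> supp l \<subseteq> S"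
proof
  assume "l \<in> nat_comb S"
  then obtain c :: "_ \<Rightarrow> nat" where "l = (\<lambda>x. \<Sum>\<alpha>\<in>S. of_nat (c \<alpha>) * \<alpha> x)"
    by (auto simp: nat_comb_def)
  then have "l = lin (\<lambda>\<gamma>. if \<gamma> \<in> S then int (c \<gamma>) else 0)"
    using comb_lin[OF assms, of "\<lambda>\<gamma>. int (c \<gamma>)"] by simp
  then show "l \<in> root_lattice \<and> (\<forall>\<gamma>. base_coeff l \<gamma> \<ge> 0) \<and> supp l \<subseteq> S"
    by (auto simp: root_lattice_def supp_def base_coeff_lin)
next
  assume a: "l \<in> root_lattice \<and> (\<forall>\<gamma>. base_coeff l \<gamma> \<ge> 0) \<and> supp l \<subseteq> S"
  have "l = lin (base_coeff l)" using a lin_base_coeff by simp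
  also have "\<dots> = lin (\<lambda>\<gamma>. if \<gamma> \<in> S then int (nat (base_coeff l \<gamma>)) else 0)"
    unfolding lin_def
    by (rule ext, rule sum.cong) (use a in \<open>auto simp: supp_def\<close>)
  also have "\<dots> = (\<lambda>x. \<Sum>\<alpha>\<in>S. of_nat (nat (base_coeff l \<alpha>)) * \<alpha> x)"
    using comb_lin[OF assms, of "\<lambda>\<gamma>. int (nat (base_coeff l \<gamma>))"]
    by (simp only: of_int_of_nat_eq)
  finally have "l = (\<lambda>x. \<Sum>\<alpha>\<in>S. of_nat (nat (base_coeff l \<alpha>)) * \<alpha> x)" .
  then show "l \<in> nat_comb S"
    unfolding nat_comb_def
    by (intro CollectI exI[of _ "\<lambda>\<gamma>. nat (base_coeff l \<gamma>)"]) simp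
qed

lemma rootsS_pos_eq: "S \<subseteq> B \<Longrightarrow> rootsS_pos sc br h S = pos_roots S"
  using root_set_root_lattice by (auto simp: rootsS_pos_def pos_roots_def roots_eq mem_nat_comb)

lemma pos_roots_root_set: "\<alpha> \<in> pos_roots S \<Longrightarrow> \<alpha> \<in> root_set" and pos_roots_root_lattice: "\<alpha> \<in> pos_roots S \<Longrightarrow> \<alpha> \<in> root_lattice"
  using root_set_root_lattice by (auto simp: pos_roots_def)

lemma pos_roots_ge0: "\<alpha> \<in> pos_roots S \<Longrightarrow> base_coeff \<alpha> \<gamma> \<ge> 0" by (auto simp: pos_roots_def)

lemma pos_roots_mono: "S \<subseteq> S' \<Longrightarrow> pos_roots S \<subseteq> pos_roots S'" by (auto simp: pos_roots_def)

lemma supp_neg: "l \<in> root_lattice \<Longrightarrow> supp (- l) = supp l" by (auto simp: supp_def base_coeff_neg)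

lemma supp_add: "l \<in> root_lattice \<Longrightarrow> m \<in> root_lattice \<Longrightarrow> supp (l + m) \<subseteq> supp l \<union> supp m" by (auto simp: supp_def base_coeff_add)

lemma supp_diff: "l \<in> root_lattice \<Longrightarrow> m \<in> root_lattice \<Longrightarrow> supp (l - m) \<subseteq> supp l \<union> supp m" by (auto simp: supp_def base_coeff_diff)

lemma pos_roots_supp: "\<alpha> \<in> pos_roots S \<Longrightarrow> supp \<alpha> \<subseteq> S" by (simp add: pos_roots_def)

lemma ht_add: "l \<in> root_lattice \<Longrightarrow> m \<in> root_lattice \<Longrightarrow> ht (l + m) = ht l + ht m"
  by (simp add: ht_def base_coeff_add sum.distrib)

lemma ht_neg: "l \<in> root_lattice \<Longrightarrow> ht (- l) = - ht l"
  by (simp add: ht_def base_coeff_neg sum_negf)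

lemma supp_ne: assumes "\<alpha> \<in> root_set" shows "supp \<alpha> \<noteq> {}"
proof
  assume "supp \<alpha> = {}"
  then have "\<alpha> = 0"
    using root_set_root_lattice[OF assms]
    by (intro root_lattice_eqI root_lattice_0) (auto simp: supp_def base_coeff_0)
  then show False using assms by (simp add: root_set_def)
qed

lemma pos_roots_pos: assumes "\<alpha> \<in> pos_roots S" shows "ht \<alpha> > 0"
proof -
  obtain \<gamma> where "\<gamma> \<in> B" "base_coeff \<alpha> \<gamma> \<noteq> 0"
    using supp_ne[OF pos_roots_root_set[OF assms]] by (auto simp: supp_def)
  then show ?thesis unfolding ht_def
    using pos_roots_ge0[OF assms] finB by (intro sum_pos2[of B \<gamma>]) (auto simp: less_le)
qed

lemma root_set_cases: assumes "\<alpha> \<in> root_set" shows "\<alpha> \<in> pos_roots (supp \<alpha>) \<or> - \<alpha> \<in> pos_roots (supp \<alpha>)"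
  using root_set_sign[OF assms] assms root_set_neg[OF assms] root_set_root_lattice[OF assms]
  by (auto simp: pos_roots_def base_coeff_neg supp_neg)

lemma rootsS_neg_eq: assumes "S \<subseteq> B" shows "rootsS_neg sc br h S = uminus ` pos_roots S"
proof
  show "rootsS_neg sc br h S \<subseteq> uminus ` pos_roots S"
  proof
    fix \<alpha> assume "\<alpha> \<in> rootsS_neg sc br h S"
    then have a: "\<alpha> \<in> root_set" "supp \<alpha> \<subseteq> S" "\<alpha> \<notin> pos_roots S"
      by (auto simp: rootsS_neg_def rootsS_pos_eq[OF assms] rootsS_def roots_eq mem_int_comb[OF assms])
    then have "- \<alpha> \<in> pos_roots S"
      using root_set_cases[OF a(1)] pos_roots_mono[OF a(2)] by blast
    then show "\<alpha> \<in> uminus ` pos_roots S" by (intro image_eqI[of _ _ "- \<alpha>"]) auto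
  qed
  show "uminus ` pos_roots S \<subseteq> rootsS_neg sc br h S"
  proof
    fix \<alpha> assume "\<alpha> \<in> uminus ` pos_roots S"
    then obtain \<beta> where b: "\<alpha> = - \<beta>" "\<beta> \<in> pos_roots S" by blast
    have "\<alpha> \<notin> pos_roots S"
      using pos_roots_pos[OF b(2)] pos_roots_pos[of \<alpha> S] ht_neg[OF pos_roots_root_lattice[OF b(2)]] b(1)
      by auto
    then show "\<alpha> \<in> rootsS_neg sc br h S"
      using b pos_roots_root_lattice[OF b(2)] pos_roots_root_set[OF b(2)]
      by (auto simp: rootsS_neg_def rootsS_pos_eq[OF assms] rootsS_def roots_eq mem_int_comb[OF assms] root_set_neg supp_neg pos_roots_def)
  qed
qed

lemma finite_root_set: "finite root_set" using finite_weights by (simp add: root_set_def)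
lemma finite_pos_roots: "finite (pos_roots S)" using finite_root_set by (rule finite_subset[rotated]) (auto simp: pos_roots_def)

lemma base_pos_roots: "\<gamma> \<in> S \<Longrightarrow> S \<subseteq> B \<Longrightarrow> \<gamma> \<in> pos_roots S"
  using B_root_set by (auto simp: pos_roots_def base_coeff_base supp_def split: if_splits)

text \<open>A positive value would make \<open>\<delta> - \<gamma>\<close> a root with coefficients
  of both signs.\<close>

lemma cartan_int_base_le0:
  assumes "\<gamma> \<in> B" "\<delta> \<in> B" "\<gamma> \<noteq> \<delta>" shows "cartan_int \<delta> \<gamma> \<le> 0"
proof (rule ccontr)
  assume "\<not> cartan_int \<delta> \<gamma> \<le> 0"
  then have "\<delta> - \<gamma> \<in> root_set"
    using root_diff[of \<gamma> \<delta>] assms B_root_set by auto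
  moreover have "base_coeff (\<delta> - \<gamma>) \<gamma> = -1" "base_coeff (\<delta> - \<gamma>) \<delta> = 1"
    using assms B_root_set root_set_root_lattice
    by (auto simp: base_coeff_diff base_coeff_base subset_iff)
  ultimately show False using root_set_sign by (metis neg_0_le_iff_le not_one_le_zero)
qed

lemma adj_iff: "\<alpha> \<in> B \<Longrightarrow> \<beta> \<in> B \<Longrightarrow> dynkin_adj sc br h \<alpha> \<beta> \<longleftrightarrow> \<alpha> \<noteq> \<beta> \<and> cartan_int \<alpha> \<beta> \<noteq> 0"
proof -
  assume "\<alpha> \<in> B" "\<beta> \<in> B"
  then have "of_int (cartan_int \<alpha> \<beta>) = \<alpha> (co \<beta>)"
    using cartan_int_of B_root_set by blast
  then show ?thesis by (metis dynkin_adj_def pairing_def of_int_eq_0_iff)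
qed

section \<open>Connectedness in the Dynkin diagram\<close>

abbreviation conn :: "('g \<Rightarrow> 'k) set \<Rightarrow> bool" where "conn \<equiv> dynkin_connected sc br h"

lemma conn_cross:
  assumes "conn S" "A \<subseteq> S" "A \<noteq> {}" "A \<noteq> S"
  obtains \<alpha> \<beta> where "\<alpha> \<in> A" "\<beta> \<in> S - A" "dynkin_adj sc br h \<alpha> \<beta>"
proof -
  obtain a b where ab: "a \<in> A" "b \<in> S" "b \<notin> A" using assms by blast
  have "(\<lambda>a b. a \<in> S \<and> b \<in> S \<and> dynkin_adj sc br h a b)\<^sup>*\<^sup>* a b"
    using assms ab by (auto simp: dynkin_connected_def)
  then have "a \<in> A \<longrightarrow> b \<notin> A \<longrightarrow> (\<exists>\<alpha>\<in>A. \<exists>\<beta>\<in>S - A. dynkin_adj sc br h \<alpha> \<beta>)"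
    by (induction rule: rtranclp_induct) auto
  then show ?thesis using ab that by blast
qed

lemma conn_Un:
  assumes "conn A" "conn C" "A \<inter> C \<noteq> {}" shows "conn (A \<union> C)"
proof -
  let ?r = "\<lambda>S a b. a \<in> S \<and> b \<in> S \<and> dynkin_adj sc br h a b"
  have m: "(?r (A \<union> C))\<^sup>*\<^sup>* a b"
    if "(?r S)\<^sup>*\<^sup>* a b" "S \<subseteq> A \<union> C" for S a b
    using that(1) by (rule rtranclp_mono[THEN predicate2D, rotated]) (use that(2) in auto)
  obtain z where z: "z \<in> A" "z \<in> C" using assms(3) by blast
  have "(?r (A \<union> C))\<^sup>*\<^sup>* a z \<and> (?r (A \<union> C))\<^sup>*\<^sup>* z a"
    if a: "a \<in> A \<union> C" for a
  proof (cases "a \<in> A")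
    case True
    then have "(?r A)\<^sup>*\<^sup>* a z \<and> (?r A)\<^sup>*\<^sup>* z a"
      using assms(1) z by (auto simp: dynkin_connected_def)
    then show ?thesis using m[of A] by blast
  next
    case False
    then have "(?r C)\<^sup>*\<^sup>* a z \<and> (?r C)\<^sup>*\<^sup>* z a"
      using assms(2) z a by (auto simp: dynkin_connected_def)
    then show ?thesis using m[of C] by blast
  qed
  then show ?thesis using z unfolding dynkin_connected_def by (auto intro: rtranclp_trans)
qed

lemma component_exists:
  assumes "conn A" "A \<subseteq> S" "finite S"
  obtains C where "dynkin_component sc br h C S" "A \<subseteq> C"
proof -
  define P where "P C \<longleftrightarrow> A \<subseteq> C \<and> C \<subseteq> S \<and> conn C" for C
  have "P A" using assms by (simp add: P_def)
  moreover have "\<forall>C. P C \<longrightarrow> card C < Suc (card S)"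
    using assms(3) card_mono by (auto simp: P_def less_Suc_eq_le)
  ultimately obtain C where C: "P C" "\<And>C'. P C' \<Longrightarrow> card C' \<le> card C"
    using ex_has_greatest_nat[of P A card "Suc (card S)"] by auto
  have "C' = C" if "C \<subseteq> C'" "C' \<subseteq> S" "conn C'" for C'
  proof -
    have "P C'" using that C(1) by (auto simp: P_def)
    moreover have "finite C'" using that(2) assms(3) finite_subset by blast
    ultimately show ?thesis using C(2) that(1) by (metis card_seteq)
  qed
  then show ?thesis using C(1) by (intro that[of C]) (auto simp: dynkin_component_def P_def)
qed

lemma component_meets:
  assumes "dynkin_component sc br h C S" "conn A" "A \<subseteq> S" "A \<inter> C \<noteq> {}" shows "A \<subseteq> C"
proof -
  have "conn (A \<union> C)" using assms conn_Un by (auto simp: dynkin_component_def)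
  then have "A \<union> C = C" using assms(1,3) by (auto simp: dynkin_component_def)
  then show ?thesis by blast
qed

lemma cartan_int_pos_roots_sum:
  assumes "\<alpha> \<in> pos_roots S" "S \<subseteq> B" "\<beta> \<in> root_set" shows "cartan_int \<alpha> \<beta> = (\<Sum>\<gamma>\<in>S. base_coeff \<alpha> \<gamma> * cartan_int \<gamma> \<beta>)"
  unfolding cartan_int_root_lattice[OF pos_roots_root_lattice[OF assms(1)] assms(3)]
  by (rule sum.mono_neutral_right) (use assms finB in \<open>auto simp: pos_roots_def supp_def\<close>)

text \<open>Induction on the height. As \<beta> pairs to 2 with its own coroot, some simple \<gamma>
  in its support has positive pairing, and \<open>\<beta> - \<gamma>\<close> is a root. If the half
  containing \<gamma> is not exhausted, the support of the smaller root still splits.\<close>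

lemma supp_no_split:
  assumes "\<beta> \<in> pos_roots B" "supp \<beta> = A \<union> A'" "A \<inter> A' = {}" "A \<noteq> {}" "A' \<noteq> {}"
    "\<And>\<gamma> \<delta>. \<gamma> \<in> A \<Longrightarrow> \<delta> \<in> A' \<Longrightarrow> cartan_int \<gamma> \<delta> = 0 \<and> cartan_int \<delta> \<gamma> = 0"
  shows False
  using assms
proof (induction "nat (ht \<beta>)" arbitrary: \<beta> A A' rule: less_induct)
  case less
  have \<beta>: "\<beta> \<in> root_set" "\<beta> \<in> root_lattice"
    using less.prems(1) pos_roots_root_set pos_roots_root_lattice by auto
  have "\<exists>\<gamma>\<in>supp \<beta>. cartan_int \<beta> \<gamma> > 0"
  proof (rule ccontr)
    assume c: "\<not> (\<exists>\<gamma>\<in>supp \<beta>. cartan_int \<beta> \<gamma> > 0)"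
    have "base_coeff \<beta> \<gamma> * cartan_int \<gamma> \<beta> \<le> 0" if "\<gamma> \<in> B"
      for \<gamma>
    proof (cases "\<gamma> \<in> supp \<beta>")
      case True
      then have "cartan_int \<gamma> \<beta> \<le> 0"
        using c cartan_int_pos_sym[OF \<beta>(1), of \<gamma>] that B_root_set by force
      then show ?thesis using pos_roots_ge0[OF less.prems(1), of \<gamma>]
        by (simp add: mult_nonneg_nonpos)
    next
      case False
      then show ?thesis using that by (simp add: supp_def)
    qed
    then have "cartan_int \<beta> \<beta> \<le> 0"
      unfolding cartan_int_root_lattice[OF \<beta>(2,1)] by (rule sum_nonpos)
    then show False using cartan_int_self[OF \<beta>(1)] by simp
  qed
  then obtain \<gamma> where \<gamma>: "\<gamma> \<in> supp \<beta>" "cartan_int \<beta> \<gamma> > 0"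
    by blast
  have key: False
    if A: "\<gamma> \<in> A" "supp \<beta> = A \<union> A'" "A \<inter> A' = {}" "A' \<noteq> {}"
    "\<And>\<gamma> \<delta>. \<gamma> \<in> A \<Longrightarrow> \<delta> \<in> A' \<Longrightarrow> cartan_int \<gamma> \<delta> = 0 \<and> cartan_int \<delta> \<gamma> = 0"
      for A A'
  proof -
    have \<gamma>B: "\<gamma> \<in> B" using \<gamma> by (simp add: supp_def)
    then have \<gamma>R: "\<gamma> \<in> root_set" "\<gamma> \<in> root_lattice"
      using B_root_set root_set_root_lattice by auto
    obtain \<delta> where \<delta>: "\<delta> \<in> A'" using A(4) by blast
    then have \<delta>': "\<delta> \<in> B" "base_coeff \<beta> \<delta> > 0" "\<delta> \<noteq> \<gamma>"
      using A pos_roots_ge0[OF less.prems(1), of \<delta>] by (auto simp: supp_def less_le)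
    have ne: "\<beta> \<noteq> \<gamma>" using \<delta>' base_coeff_base[OF \<gamma>B] by auto
    let ?b = "\<beta> - \<gamma>"
    have b: "?b \<in> root_set" by (rule root_diff[OF \<gamma>R(1) \<beta>(1) \<gamma>(2) ne])
    have cb: "base_coeff ?b \<eta> = base_coeff \<beta> \<eta> - (if \<eta> = \<gamma> then 1 else 0)"
      for \<eta>
      using base_coeff_diff[OF \<beta>(2) \<gamma>R(2)] base_coeff_base[OF \<gamma>B] by simp
    have "base_coeff ?b \<delta> > 0" using cb \<delta>' by simp
    then have bp: "\<forall>\<eta>. base_coeff ?b \<eta> \<ge> 0"
      using root_set_sign[OF b] by (metis linorder_not_less)
    have bRS: "?b \<in> pos_roots B" using b bp by (auto simp: pos_roots_def supp_def)
    have sb: "supp ?b = (A \<inter> supp ?b) \<union> A'"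
    proof -
      have "supp ?b \<subseteq> supp \<beta>"
        using \<gamma>(1) by (auto simp: supp_def cb split: if_splits)
      moreover have "A' \<subseteq> supp ?b" using A by (auto simp: supp_def cb)
      ultimately show ?thesis using A(2) by blast
    qed
    show False
    proof (cases "A \<inter> supp ?b = {}")
      case False
      have "ht ?b < ht \<beta>"
        using ht_add[of ?b \<gamma>] \<beta> \<gamma>R pos_roots_pos[OF base_pos_roots[OF \<gamma>B subset_refl]] root_set_root_lattice[OF b]
        by auto
      then have "nat (ht ?b) < nat (ht \<beta>)" using pos_roots_pos[OF bRS] by simp
      then show False
        by (rule less.hyps[OF _ bRS sb]) (use A False in auto)
    next
      \<comment> \<open>The half of \<gamma> was \<gamma> alone with coefficient 1. Orthogonality to
        the other half makes the pairing equal to 2, so \<open>\<beta> - 2\<gamma>\<close> would be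
        a root with coefficients of both signs.\<close>
      case True
      have s': "supp ?b \<subseteq> A'" using sb True by blast
      have "cartan_int ?b \<gamma> = 0"
        unfolding cartan_int_root_lattice[OF root_set_root_lattice[OF b] \<gamma>R(1)]
        by (rule sum.neutral) (use s' A(1,5) in \<open>auto simp: supp_def\<close>)
      moreover have "cartan_int \<beta> \<gamma> = cartan_int ?b \<gamma> + cartan_int \<gamma> \<gamma>"
        using cartan_int_add[of ?b \<gamma> \<gamma>] \<beta> \<gamma>R by auto
      ultimately have "cartan_int \<beta> \<gamma> = 2" using cartan_int_self[OF \<gamma>R(1)] by simp
      moreover have "?b \<noteq> \<gamma>"
        using \<delta>' cb[of \<delta>] base_coeff_base[OF \<gamma>B, of \<delta>] by auto
      ultimately have r: "?b - \<gamma> \<in> root_set"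
        using root_diff2[OF \<gamma>R(1) \<beta>(1)] by simp
      have "base_coeff ?b \<gamma> = 0" using True A(1) \<gamma>B by (auto simp: supp_def)
      then have "base_coeff (?b - \<gamma>) \<gamma> = -1" "base_coeff (?b - \<gamma>) \<delta> > 0"
        using base_coeff_diff[OF root_set_root_lattice[OF b] \<gamma>R(2)] base_coeff_base[OF \<gamma>B] \<delta>' cb[of \<delta>]
        by auto
      then show False using root_set_sign[OF r]
        by (metis linorder_not_less neg_0_le_iff_le not_one_le_zero)
    qed
  qed
  show False
  proof (cases "\<gamma> \<in> A")
    case True
    then show ?thesis by (rule key[of A A']) (use less.prems in auto)
  next
    case False
    then have "\<gamma> \<in> A'" using \<gamma>(1) less.prems(2) by blast
    then show ?thesis by (rule key[of A' A]) (use less.prems in auto)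
  qed
qed

lemma supp_conn:
  assumes "\<beta> \<in> pos_roots B" shows "conn (supp \<beta>)"
proof -
  let ?S = "supp \<beta>" 
  let ?r = "\<lambda>a b. a \<in> ?S \<and> b \<in> ?S \<and> dynkin_adj sc br h a b"
  have SB: "?S \<subseteq> B" by (auto simp: supp_def)
  have "?r\<^sup>*\<^sup>* a b" if ab: "a \<in> ?S" "b \<in> ?S" for a b
  proof (rule ccontr)
    assume n: "\<not> ?r\<^sup>*\<^sup>* a b"
    define A where "A = {c\<in>?S. ?r\<^sup>*\<^sup>* a c}"
    show False
    proof (rule supp_no_split[OF assms, of A "?S - A"])
      show "cartan_int \<gamma> \<delta> = 0 \<and> cartan_int \<delta> \<gamma> = 0"
        if g: "\<gamma> \<in> A" "\<delta> \<in> ?S - A" for \<gamma> \<delta>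
      proof -
        have gB: "\<gamma> \<in> B" "\<delta> \<in> B" "\<gamma> \<noteq> \<delta>"
          using g SB by (auto simp: A_def)
        have "\<not> dynkin_adj sc br h \<gamma> \<delta>"
        proof
          assume "dynkin_adj sc br h \<gamma> \<delta>"
          then have "?r \<gamma> \<delta>" using g by (auto simp: A_def)
          moreover have "?r\<^sup>*\<^sup>* a \<gamma>" using g by (simp add: A_def)
          ultimately have "?r\<^sup>*\<^sup>* a \<delta>"
            by (rule rtranclp.rtrancl_into_rtrancl[rotated])
          then show False using g by (simp add: A_def)
        qed
        then have "cartan_int \<gamma> \<delta> = 0" using gB by (simp add: adj_iff)
        then show ?thesis using cartan_int_zero_sym[of \<gamma> \<delta>] gB B_root_set by auto
      qed
    qed (use ab n in \<open>auto simp: A_def\<close>)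
  qed
  then show ?thesis using supp_ne[OF pos_roots_root_set[OF assms]] by (simp add: dynkin_connected_def)
qed

section \<open>Maximal roots and the highest root\<close>

definition dom_max :: "('g \<Rightarrow> 'k) set \<Rightarrow> ('g \<Rightarrow> 'k) \<Rightarrow> bool" where
  "dom_max S \<epsilon> \<longleftrightarrow> \<epsilon> \<in> pos_roots S \<and> (\<forall>\<beta>\<in>pos_roots S. \<beta> - \<epsilon> \<in> nat_comb S \<longrightarrow> \<beta> = \<epsilon>)"

lemma dom_maxD: "dom_max S \<epsilon> \<Longrightarrow> \<epsilon> \<in> pos_roots S" "dom_max S \<epsilon> \<Longrightarrow> \<epsilon> \<in> root_set" "dom_max S \<epsilon> \<Longrightarrow> \<epsilon> \<in> root_lattice"
proof -
  show 1: "\<epsilon> \<in> pos_roots S" if "dom_max S \<epsilon>"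
    using that unfolding dom_max_def by (rule conjunct1)
  show "\<epsilon> \<in> root_set" if "dom_max S \<epsilon>" by (rule pos_roots_root_set[OF 1[OF that]])
  show "\<epsilon> \<in> root_lattice" if "dom_max S \<epsilon>"
    by (rule pos_roots_root_lattice[OF 1[OF that]])
qed

lemma dom_max_above:
  assumes "S \<subseteq> B" "\<beta> \<in> pos_roots S"
  obtains \<epsilon> where "dom_max S \<epsilon>" "\<epsilon> - \<beta> \<in> nat_comb S"
proof -
  define P where "P \<epsilon> \<longleftrightarrow> \<epsilon> \<in> pos_roots S \<and> \<epsilon> - \<beta> \<in> nat_comb S"
    for \<epsilon>
  have "P \<beta>" using assms root_lattice_0 by (simp add: P_def mem_nat_comb base_coeff_0 supp_def)
  let ?X = "{\<epsilon>. P \<epsilon>}"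
  have fin: "finite ?X" using finite_pos_roots by (rule finite_subset[rotated]) (auto simp: P_def)
  have "?X \<noteq> {}" using \<open>P \<beta>\<close> by blast
  then have "Max (ht ` ?X) \<in> ht ` ?X" using fin by (intro Max_in) auto
  then obtain \<epsilon> where e0: "P \<epsilon>" "ht \<epsilon> = Max (ht ` ?X)" by auto
  have e: "P \<epsilon>" "\<And>\<epsilon>'. P \<epsilon>' \<Longrightarrow> ht \<epsilon>' \<le> ht \<epsilon>"
    using e0 fin by auto
  have "\<beta>' = \<epsilon>"
    if b: "\<beta>' \<in> pos_roots S" "\<beta>' - \<epsilon> \<in> nat_comb S" for \<beta>'
  proof -
    have l: "\<beta>' \<in> root_lattice" "\<epsilon> \<in> root_lattice" "\<beta> \<in> root_lattice"
      using b e assms pos_roots_root_lattice by (auto simp: P_def)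
    have n: "\<And>\<gamma>. base_coeff \<beta>' \<gamma> \<ge> base_coeff \<epsilon> \<gamma>"
      using b(2) l by (simp add: mem_nat_comb[OF assms(1)] base_coeff_diff)
    have "\<And>\<gamma>. base_coeff \<epsilon> \<gamma> \<ge> base_coeff \<beta> \<gamma>"
      using e(1) l by (simp add: P_def mem_nat_comb[OF assms(1)] base_coeff_diff)
    then have "\<And>\<gamma>. base_coeff \<beta>' \<gamma> \<ge> base_coeff \<beta> \<gamma>"
      using n order_trans by blast
    moreover have "supp (\<beta>' - \<beta>) \<subseteq> S"
      using pos_roots_supp[OF b(1)] pos_roots_supp[OF assms(2)] supp_diff[OF l(1,3)] by blast
    ultimately have "P \<beta>'"
      using b(1) l by (auto simp: P_def mem_nat_comb[OF assms(1)] base_coeff_diff)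
    then have "ht \<beta>' \<le> ht \<epsilon>" by (rule e(2))
    then have "(\<Sum>\<gamma>\<in>B. base_coeff \<beta>' \<gamma> - base_coeff \<epsilon> \<gamma>) \<le> 0"
      by (simp add: ht_def sum_subtractf)
    moreover have "0 \<le> (\<Sum>\<gamma>\<in>B. base_coeff \<beta>' \<gamma> - base_coeff \<epsilon> \<gamma>)"
      using n by (intro sum_nonneg) simp
    ultimately have "(\<Sum>\<gamma>\<in>B. base_coeff \<beta>' \<gamma> - base_coeff \<epsilon> \<gamma>) = 0"
      by simp
    then have "\<forall>\<gamma>\<in>B. base_coeff \<beta>' \<gamma> - base_coeff \<epsilon> \<gamma> = 0"
      using finB n by (subst (asm) sum_nonneg_eq_0_iff) auto
    then show ?thesis using l by (intro root_lattice_eqI) auto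
  qed
  then show ?thesis using that e(1) by (auto simp: dom_max_def P_def)
qed

text \<open>A negative pairing would make \<open>\<epsilon> + \<gamma>\<close> a larger root of the
  same subsystem.\<close>

lemma dom_max_dominant:
  assumes "S \<subseteq> B" "dom_max S \<epsilon>" "\<gamma> \<in> S" shows "cartan_int \<epsilon> \<gamma> \<ge> 0" "cartan_int \<gamma> \<epsilon> \<ge> 0"
proof -
  have e: "\<epsilon> \<in> pos_roots S" "\<epsilon> \<in> root_set" "\<epsilon> \<in> root_lattice"
    using assms pos_roots_root_set pos_roots_root_lattice by (auto simp: dom_max_def)
  have g: "\<gamma> \<in> B" "\<gamma> \<in> root_set" "\<gamma> \<in> root_lattice" "\<gamma> \<in> pos_roots S"
    using assms B_root_set root_set_root_lattice base_pos_roots by auto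
  show *: "cartan_int \<epsilon> \<gamma> \<ge> 0"
  proof (rule ccontr)
    assume "\<not> cartan_int \<epsilon> \<gamma> \<ge> 0"
    then have "cartan_int \<epsilon> (- \<gamma>) > 0" using cartan_int_neg_r[OF g(2) e(2)] by simp
    moreover have "\<epsilon> \<noteq> - \<gamma>"
      using pos_roots_pos[OF e(1)] pos_roots_pos[OF g(4)] ht_neg[OF g(3)] by auto
    ultimately have "\<epsilon> - - \<gamma> \<in> root_set" by (intro root_diff root_set_neg g e)
    then have r: "\<epsilon> + \<gamma> \<in> root_set" by simp
    have "supp (\<epsilon> + \<gamma>) \<subseteq> S"
      using pos_roots_supp[OF e(1)] pos_roots_supp[OF g(4)] supp_add[OF e(3) g(3)] by blast
    moreover have "base_coeff (\<epsilon> + \<gamma>) \<delta> \<ge> 0" for \<delta>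
      using base_coeff_add[OF e(3) g(3), of \<delta>] pos_roots_ge0[OF e(1), of \<delta>] pos_roots_ge0[OF g(4), of \<delta>]
      by simp
    ultimately have "\<epsilon> + \<gamma> \<in> pos_roots S" using r by (simp add: pos_roots_def)
    moreover have "(\<epsilon> + \<gamma>) - \<epsilon> \<in> nat_comb S"
      using g by (simp add: mem_nat_comb[OF assms(1)] pos_roots_def)
    ultimately have "\<epsilon> + \<gamma> = \<epsilon>" using assms(2) unfolding dom_max_def by blast
    then show False using g(2) by (simp add: root_set_def)
  qed
  show "cartan_int \<gamma> \<epsilon> \<ge> 0" using cartan_int_ge0_sym[OF e(2) g(2) *] .
qed

text \<open>If the support were proper, an edge would leave it to some simple \<gamma>. Every simple
  root in the support pairs nonpositively with \<gamma> and the end of the edge pairs negatively,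
  which contradicts dominance.\<close>

lemma dom_max_supp:
  assumes "S \<subseteq> B" "conn S" "dom_max S \<epsilon>" shows "supp \<epsilon> = S"
proof (rule ccontr)
  assume n: "supp \<epsilon> \<noteq> S"
  have e: "\<epsilon> \<in> pos_roots S" using assms(3) by (simp add: dom_max_def)
  have s: "supp \<epsilon> \<subseteq> S" using e by (simp add: pos_roots_def)
  obtain \<alpha> \<gamma> where a: "\<alpha> \<in> supp \<epsilon>" "\<gamma> \<in> S - supp \<epsilon>" "dynkin_adj sc br h \<alpha> \<gamma>"
    using conn_cross[OF assms(2) s supp_ne[OF pos_roots_root_set[OF e]] n] by blast
  have B: "\<alpha> \<in> B" "\<gamma> \<in> B" "\<alpha> \<noteq> \<gamma>" "base_coeff \<epsilon> \<gamma> = 0" "base_coeff \<epsilon> \<alpha> > 0"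
    using a assms(1) pos_roots_ge0[OF e, of \<alpha>] by (auto simp: supp_def less_le)
  have "cartan_int \<alpha> \<gamma> < 0"
    using a(3) cartan_int_base_le0[OF B(2,1)] B by (auto simp: adj_iff)
  then have neg: "base_coeff \<epsilon> \<alpha> * cartan_int \<alpha> \<gamma> < 0"
    using B(5) by (simp add: mult_pos_neg)
  have "cartan_int \<epsilon> \<gamma> = (\<Sum>\<delta>\<in>B. base_coeff \<epsilon> \<delta> * cartan_int \<delta> \<gamma>)"
    using cartan_int_root_lattice pos_roots_root_lattice[OF e] B B_root_set by blast
  also have "\<dots> = base_coeff \<epsilon> \<alpha> * cartan_int \<alpha> \<gamma> + (\<Sum>\<delta>\<in>B - {\<alpha>}. base_coeff \<epsilon> \<delta> * cartan_int \<delta> \<gamma>)"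
    using finB B(1) by (simp add: sum.remove)
  also have "(\<Sum>\<delta>\<in>B - {\<alpha>}. base_coeff \<epsilon> \<delta> * cartan_int \<delta> \<gamma>) \<le> 0"
  proof (rule sum_nonpos)
    fix \<delta> assume d: "\<delta> \<in> B - {\<alpha>}"
    show "base_coeff \<epsilon> \<delta> * cartan_int \<delta> \<gamma> \<le> 0"
      using pos_roots_ge0[OF e, of \<delta>] cartan_int_base_le0[OF B(2), of \<delta>] B(4) d
      by (cases "\<delta> = \<gamma>") (auto simp: mult_nonneg_nonpos)
  qed
  finally have "cartan_int \<epsilon> \<gamma> < 0" using neg by simp
  then show False using dom_max_dominant(1)[OF assms(1,3), of \<gamma>] a by simp
qed

text \<open>Full support of one maximal root and dominance of the other make their pairing positive,
  so their difference is a root, and its sign contradicts one of the maximalities. As every positive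
  root lies below some maximal one, this also gives a root above all others.\<close>

lemma dom_max_unique:
  assumes "S \<subseteq> B" "conn S" "dom_max S \<epsilon>" "dom_max S \<epsilon>'" shows "\<epsilon> = \<epsilon>'"
proof (rule ccontr)
  assume ne: "\<epsilon> \<noteq> \<epsilon>'"
  have e: "\<epsilon> \<in> pos_roots S" "\<epsilon> \<in> root_set" "\<epsilon> \<in> root_lattice" "\<epsilon>' \<in> pos_roots S" "\<epsilon>' \<in> root_set" "\<epsilon>' \<in> root_lattice"
    using assms(3,4) dom_maxD by blast+
  have "\<exists>\<gamma>\<in>S. cartan_int \<gamma> \<epsilon> > 0"
  proof (rule ccontr)
    assume c: "\<not> (\<exists>\<gamma>\<in>S. cartan_int \<gamma> \<epsilon> > 0)"
    have "cartan_int \<epsilon> \<epsilon> \<le> 0"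
      unfolding cartan_int_pos_roots_sum[OF e(1) assms(1) e(2)]
      by (rule sum_nonpos) (use c pos_roots_ge0[OF e(1)] in \<open>auto intro!: mult_nonneg_nonpos simp: not_less\<close>)
    then show False using cartan_int_self[OF e(2)] by simp
  qed
  then obtain \<gamma> where g: "\<gamma> \<in> S" "cartan_int \<gamma> \<epsilon> > 0" by blast
  have "\<gamma> \<in> supp \<epsilon>'" using dom_max_supp[OF assms(1,2,4)] g by simp
  then have "base_coeff \<epsilon>' \<gamma> > 0"
    using pos_roots_ge0[OF e(4), of \<gamma>] by (auto simp: supp_def less_le)
  then have "base_coeff \<epsilon>' \<gamma> * cartan_int \<gamma> \<epsilon> > 0" using g by simp
  moreover have "cartan_int \<epsilon>' \<epsilon> = (\<Sum>\<gamma>\<in>S. base_coeff \<epsilon>' \<gamma> * cartan_int \<gamma> \<epsilon>)"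
    by (rule cartan_int_pos_roots_sum[OF e(4) assms(1) e(2)])
  ultimately have "cartan_int \<epsilon>' \<epsilon> > 0"
    using g(1) pos_roots_ge0[OF e(4)] dom_max_dominant(2)[OF assms(1,3)] finB assms(1)
    by (simp add: sum_pos2[of S \<gamma>] finite_subset)
  then have d: "\<epsilon>' - \<epsilon> \<in> root_set" using root_diff[OF e(2,5)] ne by blast
  have s: "supp (\<epsilon>' - \<epsilon>) \<subseteq> S"
    using pos_roots_supp[OF e(1)] pos_roots_supp[OF e(4)] supp_diff[OF e(6,3)] by blast
  consider "\<epsilon>' - \<epsilon> \<in> pos_roots S" | "- (\<epsilon>' - \<epsilon>) \<in> pos_roots S"
    using root_set_cases[OF d] pos_roots_mono[OF s] by blast
  then show False
  proof cases
    case 1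
    then have "\<epsilon>' - \<epsilon> \<in> nat_comb S"
      using pos_roots_root_lattice by (simp add: mem_nat_comb[OF assms(1)] pos_roots_def)
    then show False using assms(3) e(4) ne by (auto simp: dom_max_def)
  next
    case 2
    then have "\<epsilon> - \<epsilon>' \<in> nat_comb S"
      using pos_roots_root_lattice by (simp add: mem_nat_comb[OF assms(1)] pos_roots_def)
    then show False using assms(4) e(1) ne by (auto simp: dom_max_def)
  qed
qed

abbreviation hr :: "('g \<Rightarrow> 'k) set \<Rightarrow> ('g \<Rightarrow> 'k)" where "hr \<equiv> highest_root sc br h"

lemma highest_root:
  assumes "S \<subseteq> B" "conn S"
  shows "dom_max S (hr S)" "\<And>\<beta>. \<beta> \<in> pos_roots S \<Longrightarrow> hr S - \<beta> \<in> nat_comb S"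
proof -
  obtain \<gamma> where "\<gamma> \<in> S" using assms(2) by (auto simp: dynkin_connected_def)
  then have "\<gamma> \<in> pos_roots S" using base_pos_roots assms(1) by blast
  then obtain \<epsilon> where e: "dom_max S \<epsilon>" using dom_max_above[OF assms(1)] by blast
  have ab: "\<epsilon> - \<beta> \<in> nat_comb S" if b: "\<beta> \<in> pos_roots S" for \<beta>
  proof -
    obtain \<epsilon>' where e': "dom_max S \<epsilon>'" "\<epsilon>' - \<beta> \<in> nat_comb S"
      using dom_max_above[OF assms(1) b] .
    then show ?thesis using dom_max_unique[OF assms e e'(1)] by simp
  qed
  have eRS: "\<epsilon> \<in> pos_roots S" "\<epsilon> \<in> root_lattice" using e dom_maxD by blast+
  have "hr S = \<epsilon>"
    unfolding highest_root_def rootsS_pos_eq[OF assms(1)]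
  proof (rule the_equality)
    have "\<epsilon> - \<beta> \<in> nat_comb S" if "\<beta> \<in> rootsS sc br h S" for \<beta>
    proof -
      have b: "\<beta> \<in> root_set" "supp \<beta> \<subseteq> S"
        using that by (auto simp: rootsS_def roots_eq mem_int_comb[OF assms(1)])
      then consider "\<beta> \<in> pos_roots S" | "- \<beta> \<in> pos_roots S"
        using root_set_cases[OF b(1)] pos_roots_mono[OF b(2)] by blast
      then show ?thesis
      proof cases
        case 1 then show ?thesis by (rule ab)
      next
        case 2
        have bl: "\<beta> \<in> root_lattice" using b root_set_root_lattice by blast
        have "0 \<le> base_coeff \<epsilon> \<gamma> - base_coeff \<beta> \<gamma>" for \<gamma>
          using pos_roots_ge0[OF 2, of \<gamma>] pos_roots_ge0[OF eRS(1), of \<gamma>] bl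
          by (simp add: base_coeff_neg)
        moreover have "supp (\<epsilon> - \<beta>) \<subseteq> S"
          using pos_roots_supp[OF eRS(1)] b(2) supp_diff[OF eRS(2) bl] by blast
        ultimately show ?thesis using eRS bl by (auto simp: mem_nat_comb[OF assms(1)] base_coeff_diff)
      qed
    qed
    then show "\<epsilon> \<in> pos_roots S \<and> (\<forall>\<beta>\<in>rootsS sc br h S. \<epsilon> - \<beta> \<in> nat_comb S)"
      using eRS by blast
    fix \<epsilon>' assume e': "\<epsilon>' \<in> pos_roots S \<and> (\<forall>\<beta>\<in>rootsS sc br h S. \<epsilon>' - \<beta> \<in> nat_comb S)"
    have "\<epsilon> \<in> rootsS sc br h S" using eRS pos_roots_root_set[OF eRS(1)]
      by (auto simp: rootsS_def roots_eq mem_int_comb[OF assms(1)] pos_roots_def)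
    then have "\<epsilon>' - \<epsilon> \<in> nat_comb S" using e' by blast
    then show "\<epsilon>' = \<epsilon>" using e e' by (auto simp: dom_max_def)
  qed
  then show "dom_max S (hr S)" "\<And>\<beta>. \<beta> \<in> pos_roots S \<Longrightarrow> hr S - \<beta> \<in> nat_comb S"
    using e ab by auto
qed

lemma hr_pos_roots: "S \<subseteq> B \<Longrightarrow> conn S \<Longrightarrow> hr S \<in> pos_roots S"
  by (rule dom_maxD(1)[OF highest_root(1)])

text \<open>A pairing of 2 or more would make \<open>hr S + (hr S - \<alpha>)\<close> a root, lying
  above the highest one. A pairing of 1 makes \<open>hr S - \<alpha>\<close> a root, positive by
  maximality.\<close>

lemma hr_pairing:
  assumes S: "S \<subseteq> B" "conn S" and a: "\<alpha> \<in> pos_roots S" "\<alpha> \<noteq> hr S"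
  shows "cartan_int \<alpha> (hr S) \<ge> 0" "cartan_int \<alpha> (hr S) \<le> 1" "cartan_int \<alpha> (hr S) = 1 \<Longrightarrow> hr S - \<alpha> \<in> pos_roots S"
proof -
  let ?e = "hr S"
  have e: "?e \<in> pos_roots S" "?e \<in> root_set" "?e \<in> root_lattice"
    using hr_pos_roots[OF S] pos_roots_root_set pos_roots_root_lattice by auto
  have al: "\<alpha> \<in> root_set" "\<alpha> \<in> root_lattice"
    using a pos_roots_root_set pos_roots_root_lattice by auto
  have nc: "?e - \<alpha> \<in> nat_comb S" using highest_root(2)[OF S a(1)] .
  then have ge: "\<And>\<gamma>. base_coeff \<alpha> \<gamma> \<le> base_coeff ?e \<gamma>"
    using e al by (simp add: mem_nat_comb[OF S(1)] base_coeff_diff)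
  show "cartan_int \<alpha> ?e \<ge> 0" unfolding cartan_int_pos_roots_sum[OF a(1) S(1) e(2)]
    by (rule sum_nonneg) (use pos_roots_ge0[OF a(1)] dom_max_dominant(2)[OF S(1) highest_root(1)[OF S]] in auto)
  show "cartan_int \<alpha> ?e \<le> 1"
  proof (rule ccontr)
    assume "\<not> cartan_int \<alpha> ?e \<le> 1"
    moreover have "\<alpha> - ?e \<noteq> ?e"
    proof
      assume "\<alpha> - ?e = ?e"
      then have "\<alpha> = ?e + ?e" by (simp add: diff_eq_eq)
      then show False using root_double[OF e(2)] al(1) by simp
    qed
    ultimately have "\<alpha> - ?e - ?e \<in> root_set" by (intro root_diff2 e al) auto
    then have r0: "- (\<alpha> - ?e - ?e) \<in> root_set" by (rule root_set_neg)
    define z where "z = ?e + (?e - \<alpha>)"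
    have "- (\<alpha> - ?e - ?e) = z" by (simp add: z_def)
    then have r: "z \<in> root_set" using r0 by (simp only:)
    have c: "base_coeff z \<gamma> = base_coeff ?e \<gamma> + (base_coeff ?e \<gamma> - base_coeff \<alpha> \<gamma>)"
      for \<gamma>
      unfolding z_def base_coeff_add[OF e(3) root_lattice_diff[OF e(3) al(2)]] base_coeff_diff[OF e(3) al(2)]
      by (rule refl)
    have c0: "base_coeff z \<gamma> \<ge> 0" for \<gamma>
      using c[of \<gamma>] ge[of \<gamma>] pos_roots_ge0[OF e(1), of \<gamma>] by linarith
    have "supp z \<subseteq> S"
      using pos_roots_supp[OF e(1)] pos_roots_supp[OF a(1)] supp_add[OF e(3) root_lattice_diff[OF e(3) al(2)]]
      supp_diff[OF e(3) al(2)] unfolding z_def by blast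
    then have "z \<in> pos_roots S" using r c0 by (simp add: pos_roots_def)
    moreover have "z - ?e \<in> nat_comb S" using nc by (simp add: z_def)
    ultimately have "z = ?e" using highest_root(1)[OF S] unfolding dom_max_def by blast
    then have "?e - \<alpha> = 0" by (simp only: z_def add_cancel_left_right)
    then have "\<alpha> = ?e" by simp
    then show False using a(2) by simp
  qed
  show "?e - \<alpha> \<in> pos_roots S" if "cartan_int \<alpha> ?e = 1"
  proof -
    have "\<alpha> - ?e \<in> root_set" using root_diff[OF e(2) al(1)] that a(2) by simp
    then have "- (\<alpha> - ?e) \<in> root_set" by (rule root_set_neg)
    then show ?thesis using nc by (simp add: pos_roots_def mem_nat_comb[OF S(1)])
  qed
qed

section \<open>Heisenberg pieces of the cascade\<close>

definition cascade_part :: "('g \<Rightarrow> 'k) set \<Rightarrow> ('g \<Rightarrow> 'k) set" where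
  "cascade_part K = {\<alpha>\<in>pos_roots K. cartan_int \<alpha> (hr K) \<noteq> 0}"

lemma hr_cascade_part: "K \<subseteq> B \<Longrightarrow> conn K \<Longrightarrow> hr K \<in> cascade_part K"
proof -
  assume "K \<subseteq> B" "conn K"
  then have "hr K \<in> pos_roots K" by (rule hr_pos_roots)
  then show ?thesis using cartan_int_self[OF pos_roots_root_set] by (simp add: cascade_part_def)
qed

text \<open>Subtraction from \<open>hr K\<close> is an involution on the piece without its centre,
  since the two pairings with the coroot of \<open>hr K\<close> add up to 2.\<close>

lemma cascade_part_partner:
  assumes K: "K \<subseteq> B" "conn K" and a: "\<alpha> \<in> cascade_part K" "\<alpha> \<noteq> hr K"
  shows "cartan_int \<alpha> (hr K) = 1" "hr K - \<alpha> \<in> cascade_part K" "hr K - \<alpha> \<noteq> hr K"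
proof -
  have aR: "\<alpha> \<in> pos_roots K" "\<alpha> \<in> root_set" "\<alpha> \<in> root_lattice"
    using a pos_roots_root_set pos_roots_root_lattice by (auto simp: cascade_part_def)
  have e: "hr K \<in> root_set" "hr K \<in> root_lattice"
    using hr_pos_roots[OF K] pos_roots_root_set pos_roots_root_lattice by blast+
  show 1: "cartan_int \<alpha> (hr K) = 1"
    using hr_pairing[OF K aR(1) a(2)] a(1) by (auto simp: cascade_part_def)
  have r: "hr K - \<alpha> \<in> pos_roots K" using hr_pairing(3)[OF K aR(1) a(2) 1] .
  have "cartan_int (hr K - \<alpha>) (hr K) + cartan_int \<alpha> (hr K) = 2"
    using cartan_int_add[of "hr K - \<alpha>" \<alpha> "hr K"] e aR cartan_int_self[OF e(1)] by auto
  then show "hr K - \<alpha> \<in> cascade_part K" using r 1 by (simp add: cascade_part_def)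
  show "hr K - \<alpha> \<noteq> hr K" using aR(2) by (auto simp: root_set_def)
qed

text \<open>Coefficients of positive roots cannot cancel, so both summands are supported in
  \<open>K\<close>. Their pairings with the coroot of \<open>hr K\<close> are at most 1 and add up
  to 2, hence both are 1.\<close>

lemma cascade_part_sum:
  assumes K: "K \<subseteq> B" "conn K" and a: "\<alpha> \<in> pos_roots B" "\<beta> \<in> pos_roots B" "\<alpha> + \<beta> = hr K"
  shows "\<alpha> \<in> cascade_part K" "\<alpha> \<noteq> hr K"
proof -
  have l: "\<alpha> \<in> root_lattice" "\<beta> \<in> root_lattice"
    using a pos_roots_root_lattice by auto
  have e: "hr K \<in> pos_roots K" "hr K \<in> root_set"
    using hr_pos_roots[OF K] pos_roots_root_set by auto
  have c: "base_coeff (hr K) \<gamma> = base_coeff \<alpha> \<gamma> + base_coeff \<beta> \<gamma>"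
    for \<gamma> using base_coeff_add[OF l] a(3) by simp
  have "base_coeff \<alpha> \<gamma> = 0 \<and> base_coeff \<beta> \<gamma> = 0"
    if "base_coeff (hr K) \<gamma> = 0" for \<gamma>
    using c[of \<gamma>] pos_roots_ge0[OF a(1), of \<gamma>] pos_roots_ge0[OF a(2), of \<gamma>] that
    by linarith
  then have "supp \<alpha> \<subseteq> supp (hr K)" "supp \<beta> \<subseteq> supp (hr K)"
    by (auto simp: supp_def)
  then have r: "\<alpha> \<in> pos_roots K" "\<beta> \<in> pos_roots K"
    using a e(1) by (auto simp: pos_roots_def)
  show n: "\<alpha> \<noteq> hr K" using a pos_roots_root_set[OF a(2)] by (auto simp: root_set_def)
  have n': "\<beta> \<noteq> hr K" using a pos_roots_root_set[OF a(1)] by (auto simp: root_set_def)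
  have "cartan_int \<alpha> (hr K) + cartan_int \<beta> (hr K) = 2"
    using cartan_int_add[OF l e(2)] a(3) cartan_int_self[OF e(2)] by simp
  then have "cartan_int \<alpha> (hr K) = 1"
    using hr_pairing(2)[OF K r(1) n] hr_pairing(2)[OF K r(2) n'] by linarith
  then show "\<alpha> \<in> cascade_part K" using r by (simp add: cascade_part_def)
qed

section \<open>The recursion for K(S) and the partition of the positive roots\<close>

lemma orth_part_eq:
  assumes "S \<subseteq> B" "conn S" shows "orth_part sc br h S = {\<gamma>\<in>S. cartan_int \<gamma> (hr S) = 0}"
proof -
  have "pairing sc br h \<gamma> (hr S) = 0 \<longleftrightarrow> cartan_int \<gamma> (hr S) = 0"
    if "\<gamma> \<in> S" for \<gamma>
  proof -
    have "of_int (cartan_int \<gamma> (hr S)) = \<gamma> (co (hr S))" 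
      using cartan_int_of[OF pos_roots_root_set[OF hr_pos_roots[OF assms]]] that assms(1) B_root_set
      by blast
    then show ?thesis by (metis pairing_def of_int_eq_0_iff)
  qed
  then show ?thesis unfolding orth_part_def by blast
qed

lemma orth_psubset:
  assumes "S \<subseteq> B" "conn S" shows "orth_part sc br h S \<subset> S"
proof -
  have e: "hr S \<in> pos_roots S" "hr S \<in> root_set"
    using hr_pos_roots[OF assms] pos_roots_root_set by blast+
  have "\<exists>\<gamma>\<in>S. cartan_int \<gamma> (hr S) \<noteq> 0"
  proof (rule ccontr)
    assume "\<not> ?thesis"
    then have "cartan_int (hr S) (hr S) = 0"
      unfolding cartan_int_pos_roots_sum[OF e(1) assms(1) e(2)] by (intro sum.neutral) auto
    then show False using cartan_int_self[OF e(2)] by simp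
  qed
  then show ?thesis unfolding orth_part_eq[OF assms] by auto
qed

text \<open>The pairing is a sum of nonnegative terms, so it vanishes only if each simple root in
  the support is orthogonal to \<open>hr S\<close>.\<close>

lemma pos_roots_orth:
  assumes S: "S \<subseteq> B" "conn S" and a: "\<alpha> \<in> pos_roots S" "cartan_int \<alpha> (hr S) = 0"
  shows "\<alpha> \<in> pos_roots (orth_part sc br h S)"
proof -
  have e: "hr S \<in> pos_roots S" "hr S \<in> root_set"
    using hr_pos_roots[OF S] pos_roots_root_set by auto
  have "\<forall>\<gamma>\<in>S. base_coeff \<alpha> \<gamma> * cartan_int \<gamma> (hr S) = 0"
    using a(2) unfolding cartan_int_pos_roots_sum[OF a(1) S(1) e(2)]
    using pos_roots_ge0[OF a(1)] dom_max_dominant(2)[OF S(1) highest_root(1)[OF S]] finite_subset[OF S(1) finB]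
    by (subst (asm) sum_nonneg_eq_0_iff) auto
  then show ?thesis using a(1) unfolding orth_part_eq[OF S] by (auto simp: pos_roots_def supp_def)
qed

lemma inK_conn: "inK sc br h S K \<Longrightarrow> K \<subseteq> S \<and> conn K"
proof (induction rule: inK.induct)
  case (orth S K)
  then show ?case unfolding orth_part_def by blast
next
  case (comp S C K)
  then show ?case unfolding dynkin_component_def by blast
qed simp

lemma component_psubset: "\<not> conn S \<Longrightarrow> dynkin_component sc br h C S \<Longrightarrow> C \<subset> S"
  unfolding dynkin_component_def by blast

text \<open>Follow \<alpha> through the recursion: in a connected stage it either pairs nontrivially
  with the highest root or lives on the orthogonal part; in a disconnected stage its connected
  support picks a component.\<close>

lemma inK_cover:
  assumes "S \<subseteq> B" "\<alpha> \<in> pos_roots S" shows "\<exists>K. inK sc br h S K \<and> \<alpha> \<in> cascade_part K"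
  using assms
proof (induction "card S" arbitrary: S rule: less_induct)
  case less
  have f: "finite S" using less.prems finB finite_subset by blast
  show ?case
  proof (cases "conn S")
    case True
    show ?thesis
    proof (cases "cartan_int \<alpha> (hr S) = 0")
      case False
      then have "\<alpha> \<in> cascade_part S" using less.prems by (simp add: cascade_part_def)
      then show ?thesis using inK.self[OF True] by blast
    next
      case z: True
      have ps: "orth_part sc br h S \<subset> S" by (rule orth_psubset[OF less.prems(1) True])
      obtain K where "inK sc br h (orth_part sc br h S) K" "\<alpha> \<in> cascade_part K"
        using less.hyps[OF psubset_card_mono[OF f ps] _ pos_roots_orth[OF less.prems(1) True less.prems(2) z]] ps less.prems(1)
        by blast
      then show ?thesis using inK.orth[OF True] by blast
    qed
  next
    case False
    have "\<alpha> \<in> pos_roots B" using less.prems pos_roots_mono by blast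
    then have "conn (supp \<alpha>)" by (rule supp_conn)
    moreover have sS: "supp \<alpha> \<subseteq> S" using less.prems by (simp add: pos_roots_def)
    ultimately obtain C where C: "dynkin_component sc br h C S" "supp \<alpha> \<subseteq> C"
      using component_exists f by metis
    have ps: "C \<subset> S" by (rule component_psubset[OF False C(1)])
    have "\<alpha> \<in> pos_roots C" using C(2) less.prems by (simp add: pos_roots_def)
    then obtain K where "inK sc br h C K" "\<alpha> \<in> cascade_part K"
      using less.hyps[OF psubset_card_mono[OF f ps]] ps less.prems(1) by blast
    then show ?thesis using inK.comp[OF False C(1)] by blast
  qed
qed

lemma cascade_part_orth_disjoint:
  assumes S: "S \<subseteq> B" "conn S" and K: "inK sc br h (orth_part sc br h S) K" "\<alpha> \<in> cascade_part K"
  shows "cartan_int \<alpha> (hr S) = 0"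
proof -
  have KS: "K \<subseteq> orth_part sc br h S" using inK_conn[OF K(1)] by blast
  have OB: "orth_part sc br h S \<subseteq> B" using S by (auto simp: orth_part_def)
  have "\<alpha> \<in> pos_roots (orth_part sc br h S)"
    using K(2) pos_roots_mono[OF KS] by (auto simp: cascade_part_def)
  from cartan_int_pos_roots_sum[OF this OB pos_roots_root_set[OF hr_pos_roots[OF S]]] show ?thesis
    unfolding orth_part_eq[OF S] by (simp add: sum.neutral)
qed

text \<open>The path through the recursion is determined by \<alpha>: the pairing with
  \<open>hr S\<close> decides whether a connected stage stops, and the nonempty support decides
  which component is entered.\<close>

lemma inK_disjoint:
  assumes "S \<subseteq> B" "inK sc br h S K" "inK sc br h S K'" "\<alpha> \<in> cascade_part K" "\<alpha> \<in> cascade_part K'"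
  shows "K = K'"
  using assms
proof (induction "card S" arbitrary: S rule: less_induct)
  case less
  note S = less.prems(1)
  have f: "finite S" using S finB finite_subset by blast
  show ?case
  proof (cases "conn S")
    case True
    have c: "X = S \<or> inK sc br h (orth_part sc br h S) X" if "inK sc br h S X" for X
      using that True by (cases rule: inK.cases) auto
    have ps: "orth_part sc br h S \<subset> S" by (rule orth_psubset[OF S True])
    have d: "X = S \<longleftrightarrow> cartan_int \<alpha> (hr S) \<noteq> 0"
      if "inK sc br h S X" "\<alpha> \<in> cascade_part X" for X
      using c[OF that(1)] that(2) cascade_part_orth_disjoint[OF S True] by (auto simp: cascade_part_def)
    show ?thesis
    proof (cases "cartan_int \<alpha> (hr S) = 0")
      case False then show ?thesis using d less.prems by blast
    next
      case z: True
      then have "inK sc br h (orth_part sc br h S) K" "inK sc br h (orth_part sc br h S) K'"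
        using c d less.prems by blast+
      then show ?thesis using less.hyps[OF psubset_card_mono[OF f ps]] ps less.prems by blast
    qed
  next
    case False
    have c: "\<exists>C. dynkin_component sc br h C S \<and> inK sc br h C X" if "inK sc br h S X" for X
      using that False by (cases rule: inK.cases) auto
    obtain C where C: "dynkin_component sc br h C S" "inK sc br h C K" using c less.prems by blast
    obtain C' where C': "dynkin_component sc br h C' S" "inK sc br h C' K'" using c less.prems by blast
    have a: "\<alpha> \<in> pos_roots K" "\<alpha> \<in> pos_roots K'"
      using less.prems by (auto simp: cascade_part_def)
    have "supp \<alpha> \<subseteq> C \<inter> C'"
      using a inK_conn[OF C(2)] inK_conn[OF C'(2)] by (auto simp: pos_roots_def)
    then have m: "C \<inter> C' \<noteq> {}" using supp_ne[OF pos_roots_root_set[OF a(1)]] by blast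
    have "C \<subseteq> C'" "C' \<subseteq> C"
      using component_meets[OF C'(1), of C] component_meets[OF C(1), of C'] C(1) C'(1) m
      by (auto simp: dynkin_component_def)
    then have "C = C'" by blast
    moreover have ps: "C \<subset> S" by (rule component_psubset[OF False C(1)])
    ultimately show ?thesis using less.hyps[OF psubset_card_mono[OF f ps]] C C' less.prems by blast
  qed
qed

definition cascade :: "('g \<Rightarrow> 'k) set \<Rightarrow> ('g \<Rightarrow> 'k) set" where "cascade S = hr ` Kset sc br h S"

lemma Kset_conn: "S \<subseteq> B \<Longrightarrow> K \<in> Kset sc br h S \<Longrightarrow> K \<subseteq> S \<and> K \<subseteq> B \<and> conn K"
  unfolding Kset_def using inK_conn[of S K] by blast

lemma finite_Kset: "S \<subseteq> B \<Longrightarrow> finite (Kset sc br h S)"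
proof -
  assume "S \<subseteq> B"
  then have "Kset sc br h S \<subseteq> Pow B" using Kset_conn by blast
  then show ?thesis using finB finite_subset by blast
qed

lemma cascade_pos_roots: "S \<subseteq> B \<Longrightarrow> cascade S \<subseteq> pos_roots S"
proof
  fix w assume S: "S \<subseteq> B" and "w \<in> cascade S"
  then obtain K where K: "K \<in> Kset sc br h S" "w = hr K" by (auto simp: cascade_def)
  have c: "K \<subseteq> S" "K \<subseteq> B" "conn K" using Kset_conn[OF S K(1)] by auto
  then show "w \<in> pos_roots S" using hr_pos_roots[OF c(2,3)] pos_roots_mono[OF c(1)] K(2) by blast
qed

lemma finite_cascade: "S \<subseteq> B \<Longrightarrow> finite (cascade S)"
  by (simp add: cascade_def finite_Kset)

text \<open>Each highest root lies in its own piece, and the pieces are disjoint, so different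
  members of K(S) have different highest roots.\<close>

lemma card_cascade: assumes "S \<subseteq> B" shows "card (cascade S) = card (Kset sc br h S)"
  unfolding cascade_def
proof (rule card_image, rule inj_onI)
  fix K K' assume K: "K \<in> Kset sc br h S" "K' \<in> Kset sc br h S" "hr K = hr K'"
  have "hr K \<in> cascade_part K" "hr K \<in> cascade_part K'"
    using hr_cascade_part Kset_conn[OF assms] K by metis+
  then show "K = K'" using inK_disjoint[OF assms] K by (auto simp: Kset_def)
qed

text \<open>The positive pairing is recorded because \<open>br_sum_ne\<close> needs it to make the
  bracket of the two root vectors nonzero.\<close>

lemma cascade_partner:
  assumes "S \<subseteq> B" "w \<in> pos_roots S - cascade S"
  obtains w' \<omega> where "w' \<in> pos_roots S - cascade S" "\<omega> \<in> cascade S" "w + w' = \<omega>" "cartan_int w \<omega> > 0"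
proof -
  obtain K where K: "inK sc br h S K" "w \<in> cascade_part K"
    using inK_cover[OF assms(1)] assms(2) by blast
  have KK: "K \<in> Kset sc br h S" using K by (simp add: Kset_def)
  have Kc: "K \<subseteq> S" "K \<subseteq> B" "conn K" using Kset_conn[OF assms(1) KK] by auto
  have ne: "w \<noteq> hr K" using assms(2) KK by (auto simp: cascade_def)
  note p = cascade_part_partner[OF Kc(2,3) K(2) ne]
  have "hr K - w \<in> pos_roots S" using p(2) pos_roots_mono[OF Kc(1)] by (auto simp: cascade_part_def)
  moreover have "hr K - w \<notin> cascade S"
  proof
    assume "hr K - w \<in> cascade S"
    then obtain K' where K': "K' \<in> Kset sc br h S" "hr K - w = hr K'" by (auto simp: cascade_def)
    then have "hr K - w \<in> cascade_part K'" using hr_cascade_part Kset_conn[OF assms(1)] by metis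
    then have "K = K'" using inK_disjoint[OF assms(1)] p(2) KK K' by (auto simp: Kset_def)
    then show False using p(3) K' by simp
  qed
  moreover have "hr K \<in> cascade S" using KK by (simp add: cascade_def)
  ultimately show ?thesis using that[of "hr K - w" "hr K"] p(1) by simp
qed

text \<open>Any such sum places \<open>w\<close> in the piece of the highest root reached.
  Disjointness of the pieces determines that highest root, hence the other summand, and excludes
  that \<open>w\<close> is itself a highest root.\<close>

lemma cascade_sum:
  assumes "S \<subseteq> B" "w \<in> pos_roots S" "w' \<in> pos_roots S" "w + w' \<in> cascade S"
  shows "w \<notin> cascade S" and "\<And>w''. w'' \<in> pos_roots S \<Longrightarrow> w + w'' \<in> cascade S \<Longrightarrow> w'' = w'"
proof -
  have main: "\<exists>K. K \<in> Kset sc br h S \<and> w + w' = hr K \<and> w \<in> cascade_part K \<and> w \<noteq> hr K"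
    if "w' \<in> pos_roots S" "w + w' \<in> cascade S" for w'
  proof -
    obtain K where K: "K \<in> Kset sc br h S" "w + w' = hr K"
      using \<open>w + w' \<in> cascade S\<close> by (auto simp: cascade_def)
    have "K \<subseteq> B" "conn K" using Kset_conn[OF assms(1) K(1)] by auto
    then show ?thesis using cascade_part_sum[of K w w'] K pos_roots_mono[OF assms(1)] assms(2) that(1)
      by blast
  qed
  obtain K where K: "K \<in> Kset sc br h S" "w + w' = hr K" "w \<in> cascade_part K" "w \<noteq> hr K"
    using main[OF assms(3,4)] by blast
  show "w \<notin> cascade S"
  proof
    assume "w \<in> cascade S"
    then obtain K' where K': "K' \<in> Kset sc br h S" "w = hr K'" by (auto simp: cascade_def)
    then have "w \<in> cascade_part K'" using hr_cascade_part Kset_conn[OF assms(1)] by metis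
    then have "K = K'" using inK_disjoint[OF assms(1)] K K' by (auto simp: Kset_def)
    then show False using K(4) K' by simp
  qed
  show "w'' = w'" if w'': "w'' \<in> pos_roots S" "w + w'' \<in> cascade S" for w''
  proof -
    obtain K' where K': "K' \<in> Kset sc br h S" "w + w'' = hr K'" "w \<in> cascade_part K'"
      using main[OF w''] by blast
    then have "K = K'" using inK_disjoint[OF assms(1)] K by (auto simp: Kset_def)
    then have "w + w'' = w + w'" using K(2) K'(2) by simp
    then show ?thesis by simp
  qed
qed

end

section \<open>The degenerate bilinear form\<close>

text \<open>The Schur complement of a pivot is again a polynomial matrix that is diagonal at \<open>0\<close>.\<close>

lemma poly_diagonal_nonsing:
  fixes p :: "'i \<Rightarrow> 'i \<Rightarrow> 'k::field poly"
  assumes "finite I" "\<And>i j. i \<in> I \<Longrightarrow> j \<in> I \<Longrightarrow> poly (p i j) 0 \<noteq> 0 \<longleftrightarrow> i = j"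
  shows "\<exists>q. poly q 0 \<noteq> 0 \<and> (\<forall>t. poly q t \<noteq> 0 \<longrightarrow>
    (\<forall>x. (\<forall>j\<in>I. (\<Sum>i\<in>I. x i * poly (p i j) t) = 0) \<longrightarrow> (\<forall>i\<in>I. x i = 0)))"
  using assms
proof (induction I arbitrary: p rule: finite_induct)
  case empty
  show ?case by (intro exI[of _ 1]) simp
next
  case (insert a I)
  define p' where "p' i j = p a a * p i j - p i a * p a j" for i j
  have "poly (p' i j) 0 \<noteq> 0 \<longleftrightarrow> i = j" if "i \<in> I" "j \<in> I" for i j
    using insert.prems[of i j] insert.prems[of a a] insert.prems[of i a] insert.hyps(2) that
    by (auto simp: p'_def)
  then obtain q where q: "poly q 0 \<noteq> 0" "\<And>t x. poly q t \<noteq> 0 \<Longrightarrow>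
     (\<forall>j\<in>I. (\<Sum>i\<in>I. x i * poly (p' i j) t) = 0) \<Longrightarrow> (\<forall>i\<in>I. x i = 0)"
    using insert.IH[of p'] by blast
  show ?case
  proof (intro exI conjI allI impI)
    show "poly (q * p a a) 0 \<noteq> 0" using q(1) insert.prems[of a a] by simp
    fix t x assume t: "poly (q * p a a) t \<noteq> 0" and x: "\<forall>j\<in>insert a I. (\<Sum>i\<in>insert a I. x i * poly (p i j) t) = 0"
    have s: "(\<Sum>i\<in>I. x i * poly (p i j) t) = - (x a * poly (p a j) t)"
      if "j \<in> insert a I" for j
    proof -
      have "(\<Sum>i\<in>insert a I. x i * poly (p i j) t) = 0" using x that by blast
      then have "x a * poly (p a j) t + (\<Sum>i\<in>I. x i * poly (p i j) t) = 0"
        by (simp add: insert.hyps)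
      then show ?thesis by (metis add_eq_0_iff)
    qed
    have "(\<Sum>i\<in>I. x i * poly (p' i j) t) = 0" if j: "j \<in> I" for j
    proof -
      have "(\<Sum>i\<in>I. x i * poly (p' i j) t) = poly (p a a) t * (\<Sum>i\<in>I. x i * poly (p i j) t)
         - poly (p a j) t * (\<Sum>i\<in>I. x i * poly (p i a) t)"
        by (simp add: p'_def sum_distrib_left sum_subtractf[symmetric] algebra_simps)
      then show ?thesis using s[of j] s[of a] j by simp
    qed
    then have z: "\<forall>i\<in>I. x i = 0" using q(2)[of t x] t by simp
    have "(\<Sum>i\<in>I. x i * poly (p i a) t) = 0" by (rule sum.neutral) (simp add: z)
    then have "x a * poly (p a a) t = 0" using s[of a] by simp
    then show "\<forall>i\<in>insert a I. x i = 0" using z t by simp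
  qed
qed

text \<open>At 0 each row has one nonzero entry. Reordering the columns along these entries makes
  the matrix diagonal at 0, to which the Schur complement lemma applies.\<close>

lemma poly_monomial_nonsing:
  fixes p :: "'i \<Rightarrow> 'i \<Rightarrow> 'k::field_char_0 poly"
  assumes "finite I" and anti: "\<And>i j. p j i = - p i j"
    and ex: "\<And>i. i \<in> I \<Longrightarrow> \<exists>j\<in>I. poly (p i j) 0 \<noteq> 0"
    and un: "\<And>i j j'. i \<in> I \<Longrightarrow> j \<in> I \<Longrightarrow> j' \<in> I \<Longrightarrow> poly (p i j) 0 \<noteq> 0 \<Longrightarrow> poly (p i j') 0 \<noteq> 0 \<Longrightarrow> j = j'"
  obtains t where "t \<noteq> 0" "\<forall>x. (\<forall>j\<in>I. (\<Sum>i\<in>I. x i * poly (p i j) t) = 0) \<longrightarrow> (\<forall>i\<in>I. x i = 0)"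
proof -
  have "\<forall>i\<in>I. \<exists>j. j \<in> I \<and> poly (p i j) 0 \<noteq> 0" using ex by blast
  from bchoice[OF this] obtain s where s: "\<And>i. i \<in> I \<Longrightarrow> s i \<in> I" "\<And>i. i \<in> I \<Longrightarrow> poly (p i (s i)) 0 \<noteq> 0"
    by blast
  \<comment> \<open>Skew symmetry turns uniqueness within a row into uniqueness within a
    column.\<close>
  have "poly (p i (s j)) 0 \<noteq> 0 \<longleftrightarrow> i = j" if ij: "i \<in> I" "j \<in> I" for i j
  proof
    assume a: "poly (p i (s j)) 0 \<noteq> 0"
    have "poly (p (s j) i) 0 \<noteq> 0" "poly (p (s j) j) 0 \<noteq> 0"
      using a s(2)[OF ij(2)] anti[of i "s j"] anti[of j "s j"] by simp_all
    then show "i = j" using un[OF s(1)[OF ij(2)] ij] by blast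
  qed (use s ij in auto)
  then obtain q where q: "poly q 0 \<noteq> 0" "\<And>t x. poly q t \<noteq> 0 \<Longrightarrow>
     (\<forall>j\<in>I. (\<Sum>i\<in>I. x i * poly (p i (s j)) t) = 0) \<Longrightarrow> (\<forall>i\<in>I. x i = 0)"
    using poly_diagonal_nonsing[OF assms(1), of "\<lambda>i j. p i (s j)"] by blast
  \<comment> \<open>The extra factor X excludes the root 0: the rescaling by powers of
    \<open>t\<close> must be invertible.\<close>
  have "q * [:0, 1:] \<noteq> 0" using q(1) by auto
  then have "finite {t. poly (q * [:0, 1:]) t = 0}" by (rule poly_roots_finite)
  then have "{t. poly (q * [:0, 1:]) t = 0} \<noteq> UNIV" using infinite_UNIV_char_0 by metis
  then obtain t where "poly (q * [:0, 1:]) t \<noteq> 0" by blast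
  then have "t \<noteq> 0" "poly q t \<noteq> 0" by auto
  have "\<forall>i\<in>I. x i = 0" if "\<forall>j\<in>I. (\<Sum>i\<in>I. x i * poly (p i j) t) = 0" for x
    using q(2)[OF \<open>poly q t \<noteq> 0\<close>, of x] s(1) that by blast
  then show ?thesis using that[OF \<open>t \<noteq> 0\<close>] by blast
qed

context finite_dimensional_vector_space
begin

text \<open>The condition \<open>ind\<close> is independence modulo \<open>A\<close>. In the
  application \<open>A\<close> is the kernel of the form, and independence comes from a nonsingular
  block of its matrix.\<close>

lemma dim_complement_le:
  assumes A: "subspace A" "A \<subseteq> a" and a: "subspace a" and v: "\<And>i. i \<in> I \<Longrightarrow> v i \<in> a" and I: "finite I"
    and ind: "\<And>c. (\<Sum>i\<in>I. scale (c i) (v i)) \<in> A \<Longrightarrow> \<forall>i\<in>I. c i = 0"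
  shows "dim A + card I \<le> dim a"
proof -
  have inj: "inj_on v I"
  proof (rule inj_onI, rule ccontr)
    fix i j assume ij: "i \<in> I" "j \<in> I" "v i = v j" "i \<noteq> j"
    let ?c = "\<lambda>k. if k = i then 1 else if k = j then -1 else (0::'a)"
    have "(\<Sum>k\<in>I. scale (?c k) (v k)) = (\<Sum>k\<in>{i,j}. scale (?c k) (v k))"
      by (rule sum.mono_neutral_right) (use ij I in auto)
    also have "\<dots> = 0" using ij by simp
    finally have "\<forall>k\<in>I. ?c k = 0" using ind[of ?c] subspace_0[OF A(1)] by simp
    then have "?c i = 0" using ij(1) by blast
    then show False by simp
  qed
  have sp: "x \<in> span (v ` I) \<Longrightarrow> \<exists>c. x = (\<Sum>i\<in>I. scale (c i) (v i))"
    for x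
  proof -
    assume "x \<in> span (v ` I)"
    then obtain u where "x = (\<Sum>y\<in>v ` I. scale (u y) y)" using span_finite[of "v ` I"] I by auto
    then show ?thesis using inj by (auto simp: sum.reindex)
  qed
  have "independent (v ` I)"
  proof (rule independent_if_scalars_zero)
    show "finite (v ` I)" using I by simp
    fix f x assume f: "(\<Sum>x\<in>v ` I. scale (f x) x) = 0" and x: "x \<in> v ` I"
    have "(\<Sum>i\<in>I. scale (f (v i)) (v i)) = 0" using f inj by (simp add: sum.reindex)
    then have "\<forall>i\<in>I. f (v i) = 0"
      using ind[of "\<lambda>i. f (v i)"] subspace_0[OF A(1)] by simp
    then show "f x = 0" using x by auto
  qed
  then have d: "dim (span (v ` I)) = card I" using inj by (simp add: dim_eq_card_independent card_image)
  have i: "A \<inter> span (v ` I) = {0}"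
  proof -
    have "x = 0" if x: "x \<in> A" "x \<in> span (v ` I)" for x
    proof -
      obtain c where c: "x = (\<Sum>i\<in>I. scale (c i) (v i))" using sp[OF x(2)] by blast
      then have "\<forall>i\<in>I. c i = 0" using ind x(1) by simp
      then show ?thesis using c by simp
    qed
    then show ?thesis using subspace_0[OF A(1)] span_zero by auto
  qed
  have sv: "span (v ` I) \<subseteq> a" using v a by (intro span_minimal) auto
  have "dim {x + y |x y. x \<in> A \<and> y \<in> span (v ` I)} + dim (A \<inter> span (v ` I)) = dim A + dim (span (v ` I))"
    by (rule dim_sums_Int[OF A(1) subspace_span])
  then have "dim A + card I = dim {x + y |x y. x \<in> A \<and> y \<in> span (v ` I)}" using i d by simp
  also have "\<dots> \<le> dim a"
    by (rule dim_subset) (use A(2) sv a in \<open>auto intro: subspace_add\<close>)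
  finally show ?thesis .
qed

end

section \<open>Dual families in the Cartan subalgebra\<close>

context lie_base
begin

text \<open>Induction with a Gram-Schmidt step: a point of \<open>h\<close> where \<open>f\<close>
  differs from its interpolation by \<open>D\<close> is projected off the old dual family, which
  leaves a vector killed by \<open>D\<close> and not by \<open>f\<close>.\<close>

lemma dual_vectors:
  assumes "finite D" "\<not> module.dependent fscale D"
    and "\<And>f. f \<in> D \<Longrightarrow> f \<in> hdual sc h"
  shows "\<exists>H. (\<forall>d\<in>D. H d \<in> h) \<and> (\<forall>d\<in>D. \<forall>d'\<in>D. d (H d') = (if d = d' then 1 else 0))"
  using assms
proof (induction D rule: finite_induct)
  case empty then show ?case by simp
next
  case (insert f D)
  have lf: "d (x + y) = d x + d y" "d (sc c x) = c * d x"
    if "d \<in> insert f D" "x \<in> h" "y \<in> h" for d x y c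
    using insert.prems(2)[OF that(1)] that(2,3) by (auto simp: hdual_def dual_on_def)
  have lsum: "d (\<Sum>i\<in>A. g i) = (\<Sum>i\<in>A. d (g i))"
    if d: "d \<in> insert f D" and g: "\<And>i. i \<in> A \<Longrightarrow> g i \<in> h" and A: "finite A"
      for d A and g :: "('g \<Rightarrow> 'k) \<Rightarrow> 'g"
    using A g
  proof (induction A rule: finite_induct)
    case empty
    show ?case using lf(2)[OF d subspace_0[OF subspace_h] subspace_0[OF subspace_h], of 0] by simp
  next
    case (insert i A)
    have "sum g A \<in> h" by (rule subspace_sum[OF subspace_h]) (use insert.prems in blast)
    then show ?case using lf(1)[OF d, of "g i" "sum g A"] insert by simp
  qed
  have ldiff: "d (x - y) = d x - d y" if d: "d \<in> insert f D" "x \<in> h" "y \<in> h" for d x y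
    using lf(1)[OF d(1,2), of "sc (-1) y"] lf(2)[OF d(1,3,3), of "-1"] subspace_neg[OF subspace_h d(3)]
    by simp
  have "\<not> module.dependent fscale D" using insert.prems(1) fs.independent_mono by blast
  then obtain H where H: "\<And>d. d \<in> D \<Longrightarrow> H d \<in> h" "\<And>d d'. d \<in> D \<Longrightarrow> d' \<in> D \<Longrightarrow> d (H d') = (if d = d' then 1 else 0)"
    using insert.IH insert.prems(2) by blast
  \<comment> \<open>Evaluation on the dual family shows that no other combination of
    \<open>D\<close> could equal \<open>f\<close>.\<close>
  have "f \<noteq> (\<Sum>d\<in>D. fscale (f (H d)) d)"
  proof
    assume e: "f = (\<Sum>d\<in>D. fscale (f (H d)) d)"
    have "(\<Sum>d\<in>D. fscale (f (H d)) d) \<in> module.span fscale D"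
      by (intro fs.span_sum fs.span_scale fs.span_base)
    then have "f \<in> module.span fscale D" using e by simp
    then show False using insert.prems(1) insert.hyps(2) by (simp add: fs.independent_insert)
  qed
  then obtain x where "f x \<noteq> (\<Sum>d\<in>D. fscale (f (H d)) d) x" by blast
  then have x: "f x \<noteq> (\<Sum>d\<in>D. f (H d) * d x)" by (simp add: sum_apply fscale_def)
  have xh: "x \<in> h"
  proof (rule ccontr)
    assume "x \<notin> h"
    then have "d x = 0" if "d \<in> insert f D" for d
      using insert.prems(2)[OF that] by (simp add: hdual_def)
    then have "f x = 0" "(\<Sum>d\<in>D. f (H d) * d x) = 0" by (simp_all add: sum.neutral)
    then show False using x by simp
  qed
  define r where "r = f x - (\<Sum>d\<in>D. f (H d) * d x)"
  have r: "r \<noteq> 0" using x by (simp add: r_def)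
  define y where "y = x - (\<Sum>d\<in>D. sc (d x) (H d))"
  have sh: "(\<Sum>d\<in>D. sc (d x) (H d)) \<in> h"
    using H(1) by (intro subspace_sum subspace_scale subspace_h)
  have yh: "y \<in> h" unfolding y_def using xh sh by (intro subspace_diff subspace_h)
  have ds: "d (\<Sum>d\<in>D. sc (d x) (H d)) = (\<Sum>d'\<in>D. d' x * d (H d'))"
    if "d \<in> insert f D" for d
  proof -
    have "d (\<Sum>d\<in>D. sc (d x) (H d)) = (\<Sum>d'\<in>D. d (sc (d' x) (H d')))"
      using insert.hyps(1) H(1) by (intro lsum[OF that]) (auto intro: subspace_scale subspace_h)
    also have "\<dots> = (\<Sum>d'\<in>D. d' x * d (H d'))"
      using H(1) lf(2)[OF that] by (intro sum.cong) auto
    finally show ?thesis .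
  qed
  have fy: "f y = r" unfolding y_def
    using ldiff[of f, OF _ xh sh] ds[of f] by (simp add: r_def mult.commute)
  have dy: "d y = 0" if d: "d \<in> D" for d
  proof -
    have "(\<Sum>d'\<in>D. d' x * d (H d')) = (\<Sum>d'\<in>D. if d' = d then d' x else 0)"
      by (rule sum.cong) (use H(2)[OF d] in auto)
    also have "\<dots> = d x" using d insert.hyps(1) by simp
    finally show ?thesis unfolding y_def using ldiff[of d, OF _ xh sh] ds[of d] d by simp
  qed
  define z where "z = sc (1 / r) y"
  have zh: "z \<in> h" using yh by (simp add: z_def subspace_scale subspace_h)
  have fz: "f z = 1" using lf(2)[of f y y "1 / r"] yh fy r by (simp add: z_def)
  have dz: "d z = 0" if "d \<in> D" for d
    using lf(2)[of d y y "1 / r"] yh dy[OF that] that by (simp add: z_def)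
  \<comment> \<open>The old vectors are shifted along \<open>z\<close> so that \<open>f\<close>
    vanishes on them; \<open>D\<close> does not see the shift.\<close>
  define H' where "H' d = (if d = f then z else H d - sc (f (H d)) z)" for d
  have nD: "d \<noteq> f" if "d \<in> D" for d using that insert.hyps(2) by blast
  have H'h: "H' d \<in> h" if "d \<in> insert f D" for d
    using that zh H(1) by (auto simp: H'_def intro!: subspace_diff subspace_scale subspace_h)
  have "d (H' d') = (if d = d' then 1 else 0)" if d: "d \<in> insert f D" "d' \<in> insert f D" for d d'
  proof (cases "d' = f")
    case True
    then show ?thesis using d fz dz nD by (auto simp: H'_def)
  next
    case False
    then have d': "d' \<in> D" using d by simp
    have e: "d (H' d') = d (H d') - f (H d') * d z"
      using False ldiff[OF d(1) H(1)[OF d'], of "sc (f (H d')) z"] lf(2)[OF d(1) zh zh] zh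
      by (simp add: H'_def subspace_scale subspace_h)
    show ?thesis
    proof (cases "d = f")
      case True
      then show ?thesis using e fz False by simp
    next
      case dD: False
      then have "d \<in> D" using d(1) by simp
      then show ?thesis using e dz[of d] H(2)[of d d'] d' by simp
    qed
  qed
  then show ?case using H'h by blast
qed

section \<open>Absolute height and signed roots\<close>

definition abs_ht :: "('g \<Rightarrow> 'k) \<Rightarrow> nat" where "abs_ht l = nat \<bar>ht l\<bar>"

lemma abs_ht_add_le: "l \<in> root_lattice \<Longrightarrow> m \<in> root_lattice \<Longrightarrow> abs_ht (l + m) \<le> abs_ht l + abs_ht m"
  by (simp add: abs_ht_def ht_add nat_add_distrib[symmetric] nat_mono abs_triangle_ineq)

lemma abs_ht_0: "abs_ht 0 = 0" by (simp add: abs_ht_def ht_def base_coeff_0)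

lemma abs_ht_neg: "l \<in> root_lattice \<Longrightarrow> abs_ht (- l) = abs_ht l" by (simp add: abs_ht_def ht_neg)

text \<open>This is why the positive part of \<open>S\<close> commutes with the negative part of \<open>T\<close> in the degeneration.\<close>

lemma abs_ht_add_sign:
  assumes "l \<in> root_lattice" "m \<in> root_lattice" "abs_ht l + abs_ht m = abs_ht (l + m)" "ht l > 0" shows "ht m \<ge> 0"
  using assms by (simp add: abs_ht_def ht_add)

text \<open>The nonzero weights of \<open>g_ST\<close>, and those among them on which the linear form is supported.\<close>

definition signed_roots :: "('g \<Rightarrow> 'k) set \<Rightarrow> ('g \<Rightarrow> 'k) set \<Rightarrow> ('g \<Rightarrow> 'k) set" where
  "signed_roots S T = pos_roots S \<union> uminus ` pos_roots T"
definition signed_cascade :: "('g \<Rightarrow> 'k) set \<Rightarrow> ('g \<Rightarrow> 'k) set \<Rightarrow> ('g \<Rightarrow> 'k) set" where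
  "signed_cascade S T = cascade S \<union> uminus ` cascade T"

lemma signed_roots_root_set: "w \<in> signed_roots S T \<Longrightarrow> w \<in> root_set"
  using pos_roots_root_set root_set_neg by (auto simp: signed_roots_def)

text \<open>Negation exchanges \<open>S\<close> and \<open>T\<close>. The facts below are proved for
  positive \<open>w\<close> and carried over to negative ones in this way.\<close>

lemma signed_roots_neg: "w \<in> signed_roots S T \<Longrightarrow> - w \<in> signed_roots T S"
  by (auto simp: signed_roots_def)

lemma signed_cascade_neg: "w \<in> signed_cascade S T \<longleftrightarrow> - w \<in> signed_cascade T S"
proof -
  have "w \<in> uminus ` A \<longleftrightarrow> - w \<in> A" for w :: "'g \<Rightarrow> 'k" and A
    by (auto intro: image_eqI[of w uminus "- w"])
  then show ?thesis by (auto simp: signed_cascade_def)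
qed

lemma signed_cascade_signed_roots: "S \<subseteq> B \<Longrightarrow> T \<subseteq> B \<Longrightarrow> signed_cascade S T \<subseteq> signed_roots S T"
  unfolding signed_cascade_def signed_roots_def
  using cascade_pos_roots[of S] cascade_pos_roots[of T] by blast

lemma signed_roots_pos: assumes "w \<in> signed_roots S T" "ht w \<ge> 0" shows "w \<in> pos_roots S"
proof (rule ccontr)
  assume "w \<notin> pos_roots S"
  then obtain u where u: "u \<in> pos_roots T" "w = - u" using assms(1) by (auto simp: signed_roots_def)
  then show False using pos_roots_pos[OF u(1)] assms(2) ht_neg[OF pos_roots_root_lattice[OF u(1)]]
    by simp
qed

lemma signed_cascade_pos: assumes "T \<subseteq> B" "w \<in> signed_cascade S T" "ht w \<ge> 0" shows "w \<in> cascade S"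
proof (rule ccontr)
  assume "w \<notin> cascade S"
  then obtain u where u: "u \<in> cascade T" "w = - u" using assms(2) by (auto simp: signed_cascade_def)
  then have "u \<in> pos_roots T" using cascade_pos_roots[OF assms(1)] by blast
  then show False using pos_roots_pos[of u T] assms(3) u ht_neg[OF pos_roots_root_lattice, of u T]
    by simp
qed

lemma signed_roots_cases: assumes "w \<in> signed_roots S T" obtains "ht w > 0" "w \<in> pos_roots S" | "ht (- w) > 0" "- w \<in> pos_roots T" "- w \<in> signed_roots T S"
  using assms pos_roots_pos by (auto simp: signed_roots_def)

text \<open>The partner is positive as well, so absolute heights add, and the corresponding matrix
  entry survives at \<open>t = 0\<close>.\<close>

lemma signed_roots_partner_pos:
  assumes ST: "S \<subseteq> B" "T \<subseteq> B" and w: "w \<in> pos_roots S" "w \<notin> signed_cascade S T"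
  shows "\<exists>w'\<in>signed_roots S T - signed_cascade S T. \<exists>\<omega>\<in>signed_cascade S T. w + w' = \<omega> \<and> abs_ht w + abs_ht w' = abs_ht \<omega> \<and> cartan_int w \<omega> > 0"
proof -
  have "w \<in> pos_roots S - cascade S" using w by (auto simp: signed_cascade_def)
  then obtain w' \<omega> where p: "w' \<in> pos_roots S - cascade S" "\<omega> \<in> cascade S" "w + w' = \<omega>" "cartan_int w \<omega> > 0"
    using cascade_partner[OF ST(1)] by blast
  have h: "ht w > 0" "ht w' > 0" using pos_roots_pos w p by blast+
  have "abs_ht w + abs_ht w' = abs_ht \<omega>"
    using h ht_add[OF pos_roots_root_lattice[OF w(1)] pos_roots_root_lattice, of w' S] p
    by (auto simp: abs_ht_def)
  moreover have "w' \<notin> signed_cascade S T"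
    using signed_cascade_pos[OF ST(2), of w' S] p(1) h by auto
  ultimately show ?thesis using p by (auto simp: signed_roots_def signed_cascade_def)
qed

lemma signed_roots_partner:
  assumes ST: "S \<subseteq> B" "T \<subseteq> B" and w: "w \<in> signed_roots S T" "w \<notin> signed_cascade S T"
  shows "\<exists>w'\<in>signed_roots S T - signed_cascade S T. \<exists>\<omega>\<in>signed_cascade S T. w + w' = \<omega> \<and> abs_ht w + abs_ht w' = abs_ht \<omega> \<and> cartan_int w \<omega> > 0"
  using w(1)
proof (cases rule: signed_roots_cases)
  case 1
  then show ?thesis using signed_roots_partner_pos[OF ST] w by blast
next
  case 2
  have "- w \<notin> signed_cascade T S" using signed_cascade_neg w(2) by blast
  then obtain u \<omega> where u: "u \<in> signed_roots T S - signed_cascade T S" "\<omega> \<in> signed_cascade T S" "- w + u = \<omega>" "abs_ht (- w) + abs_ht u = abs_ht \<omega>" "cartan_int (- w) \<omega> > 0"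
    using signed_roots_partner_pos[OF ST(2,1) 2(2)] by blast
  have R: "w \<in> root_set" "u \<in> root_set" "\<omega> \<in> root_set"
    using signed_roots_root_set w(1) u signed_cascade_signed_roots[OF ST(2,1)] by blast+
  have "- u \<in> signed_roots S T - signed_cascade S T"
    using u(1) signed_roots_neg signed_cascade_neg[of "- u" S T] by auto
  moreover have "- \<omega> \<in> signed_cascade S T"
    using u(2) signed_cascade_neg[of "- \<omega>" S T] by simp
  moreover have "w + - u = - \<omega>" using u(3) by (simp add: algebra_simps)
  moreover have "abs_ht w + abs_ht (- u) = abs_ht (- \<omega>)"
    using u(4) R root_set_root_lattice by (simp add: abs_ht_neg)
  moreover have "cartan_int w (- \<omega>) > 0"
  proof -
    have "cartan_int (- w) \<omega> + cartan_int w \<omega> = cartan_int (- w + w) \<omega>"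
      using cartan_int_add R root_set_root_lattice by (metis root_lattice_neg)
    also have "\<dots> = 0"
      using cartan_int_root_lattice[OF root_lattice_0 R(3)] by (simp add: base_coeff_0)
    finally show ?thesis using u(5) cartan_int_neg_r[OF R(3,1)] by simp
  qed
  ultimately show ?thesis by blast
qed

text \<open>Additivity of absolute heights forces \<open>w'\<close> to be positive too. The sum then
  takes place among the positive roots of \<open>S\<close>, where \<open>cascade_sum\<close>
  applies.\<close>

lemma signed_roots_sum_pos:
  assumes ST: "S \<subseteq> B" "T \<subseteq> B" and w: "w \<in> pos_roots S" "w' \<in> signed_roots S T" "w + w' \<in> signed_cascade S T" "abs_ht w + abs_ht w' = abs_ht (w + w')"
  shows "w \<notin> signed_cascade S T" and "w' \<in> pos_roots S" and "w + w' \<in> cascade S"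
proof -
  have l: "w \<in> root_lattice" "w' \<in> root_lattice"
    using w signed_roots_root_set root_set_root_lattice pos_roots_root_lattice by blast+
  have h: "ht w > 0" using pos_roots_pos[OF w(1)] .
  have h': "ht w' \<ge> 0" using abs_ht_add_sign[OF l w(4) h] .
  then show r: "w' \<in> pos_roots S" using signed_roots_pos[OF w(2)] by blast
  show p: "w + w' \<in> cascade S" using signed_cascade_pos[OF ST(2) w(3)] ht_add[OF l] h h' by simp
  show "w \<notin> signed_cascade S T"
    using cascade_sum(1)[OF ST(1) w(1) r p] signed_cascade_pos[OF ST(2), of w S] h by auto
qed

lemma signed_roots_sum:
  assumes ST: "S \<subseteq> B" "T \<subseteq> B" and w: "w \<in> signed_roots S T" "w' \<in> signed_roots S T" "w + w' \<in> signed_cascade S T" "abs_ht w + abs_ht w' = abs_ht (w + w')"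
  shows "w \<notin> signed_cascade S T" 
    and "\<And>w''. w'' \<in> signed_roots S T \<Longrightarrow> w + w'' \<in> signed_cascade S T \<Longrightarrow> abs_ht w + abs_ht w'' = abs_ht (w + w'') \<Longrightarrow> w'' = w'"
proof -
  have neg: "- w + - u \<in> signed_cascade T S" "abs_ht (- w) + abs_ht (- u) = abs_ht (- w + - u)" "- u \<in> signed_roots T S"
    if "u \<in> signed_roots S T" "w + u \<in> signed_cascade S T" "abs_ht w + abs_ht u = abs_ht (w + u)"
      for u
  proof -
    have e: "- w + - u = - (w + u)" by simp
    have l: "w \<in> root_lattice" "u \<in> root_lattice"
      using w(1) that(1) signed_roots_root_set root_set_root_lattice by blast+
    show "- w + - u \<in> signed_cascade T S" unfolding e using signed_cascade_neg that(2) by blast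
    show "abs_ht (- w) + abs_ht (- u) = abs_ht (- w + - u)" using that(3)
      unfolding e abs_ht_neg[OF l(1)] abs_ht_neg[OF l(2)] abs_ht_neg[OF root_lattice_add[OF l]] .
    show "- u \<in> signed_roots T S" using signed_roots_neg that(1) by blast
  qed
  show "w \<notin> signed_cascade S T"
    using w(1)
  proof (cases rule: signed_roots_cases)
    case 1 then show ?thesis using signed_roots_sum_pos(1)[OF ST _ w(2-4)] by blast
  next
    case 2 then show ?thesis
      using signed_roots_sum_pos(1)[OF ST(2,1) 2(2) neg(3,1,2)[OF w(2-4)]] signed_cascade_neg by blast
  qed
  show "w'' = w'" if w'': "w'' \<in> signed_roots S T" "w + w'' \<in> signed_cascade S T" "abs_ht w + abs_ht w'' = abs_ht (w + w'')"
    for w''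
    using w(1)
  proof (cases rule: signed_roots_cases)
    case 1
    show ?thesis
      using cascade_sum(2)[OF ST(1) 1(2) signed_roots_sum_pos(2,3)[OF ST 1(2) w(2-4)] signed_roots_sum_pos(2,3)[OF ST 1(2) w'']] .
  next
    case 2
    have "- w'' = - w'"
      using cascade_sum(2)[OF ST(2) 2(2) signed_roots_sum_pos(2,3)[OF ST(2,1) 2(2) neg(3,1,2)[OF w(2-4)]]
          signed_roots_sum_pos(2,3)[OF ST(2,1) 2(2) neg(3,1,2)[OF w'']]] .
    then show ?thesis by simp
  qed
qed

section \<open>The nonsingular block and the bound for the index\<close>

definition root_vector :: "('g \<Rightarrow> 'k) \<Rightarrow> 'g" where "root_vector \<alpha> = (SOME x. x \<in> weight_space \<alpha> \<and> x \<noteq> 0)"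

lemma root_vector: assumes "\<alpha> \<in> root_set" shows "root_vector \<alpha> \<in> weight_space \<alpha>" "root_vector \<alpha> \<noteq> 0"
proof -
  have "\<exists>x. x \<in> weight_space \<alpha> \<and> x \<noteq> 0"
    using weight_space_ne assms by (auto simp: root_set_def)
  from someI_ex[OF this] show "root_vector \<alpha> \<in> weight_space \<alpha>" "root_vector \<alpha> \<noteq> 0"
    by (auto simp: root_vector_def)
qed

lemma g_ST_eq:
  assumes "S \<subseteq> B" "T \<subseteq> B"
  shows "g_ST sc br h S T = span (h \<union> (\<Union>w\<in>signed_roots S T. weight_space w))"
proof -
  have r: "root_space sc br h w = weight_space w" if "w \<in> signed_roots S T" for w
    using root_set_out[OF signed_roots_root_set[OF that]] by (intro root_space_eq) blast
  have "h \<union> \<Union> (root_space sc br h ` rootsS_pos sc br h S) \<union> \<Union> (root_space sc br h ` rootsS_neg sc br h T)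
      = h \<union> (\<Union>w\<in>signed_roots S T. root_space sc br h w)"
    unfolding rootsS_pos_eq[OF assms(1)] rootsS_neg_eq[OF assms(2)] signed_roots_def by blast
  also have "\<dots> = h \<union> (\<Union>w\<in>signed_roots S T. weight_space w)" using r by simp
  finally show ?thesis by (simp add: g_ST_def)
qed

lemma finite_signed_roots: "finite (signed_roots S T)"
  by (simp add: signed_roots_def finite_pos_roots)

text \<open>An upper bound is the direction that is used: the kernel of the form has dimension at
  most that of the algebra minus the size of the block.\<close>

lemma dim_g_ST:
  assumes "S \<subseteq> B" "T \<subseteq> B"
  shows "dim (g_ST sc br h S T) \<le> dim h + card (signed_roots S T)"
proof -
  obtain b where b: "independent b" "span b = h" "finite b" "card b = dim h"
    using subspace_basis[OF subspace_h] .
  have "g_ST sc br h S T \<subseteq> span (b \<union> root_vector ` signed_roots S T)"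
    unfolding g_ST_eq[OF assms]
  proof (rule span_minimal)
    have "weight_space w \<subseteq> span (b \<union> root_vector ` signed_roots S T)"
      if "w \<in> signed_roots S T" for w
    proof -
      have "weight_space w = span {root_vector w}"
        using weight_space_span root_vector signed_roots_root_set[OF that] by blast
      also have "\<dots> \<subseteq> span (b \<union> root_vector ` signed_roots S T)"
        by (rule span_mono) (use that in auto)
      finally show ?thesis .
    qed
    moreover have "h \<subseteq> span (b \<union> root_vector ` signed_roots S T)"
      unfolding b(2)[symmetric] by (rule span_mono) auto
    ultimately show "h \<union> (\<Union>w\<in>signed_roots S T. weight_space w) \<subseteq> span (b \<union> root_vector ` signed_roots S T)"
      by blast
  qed simp
  then have "dim (g_ST sc br h S T) \<le> card (b \<union> root_vector ` signed_roots S T)"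
    using b(3) finite_signed_roots by (intro dim_le_card) auto
  also have "\<dots> \<le> card b + card (root_vector ` signed_roots S T)" by (rule card_Un_le)
  also have "\<dots> \<le> dim h + card (signed_roots S T)"
    using b(4) card_image_le[OF finite_signed_roots] by simp
  finally show ?thesis .
qed

text \<open>The number of signed roots stands on both sides because the count is done in natural
  numbers, where it must precede the subtraction of the cascade.\<close>

lemma index_bound:
  assumes ST: "S \<subseteq> B" "T \<subseteq> B"
  shows "lie_index sc br (g_ST sc br h S T) + card (signed_roots S T) - card (signed_cascade S T)
    + 2 * fs.dim (signed_cascade S T) \<le> dim h + card (signed_roots S T)"
proof -
  let ?a = "g_ST sc br h S T"
  let ?signed_roots = "signed_roots S T" and ?O = "signed_cascade S T"
  have OW: "?O \<subseteq> ?signed_roots" by (rule signed_cascade_signed_roots[OF ST])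
  have ORt: "\<omega> \<in> root_set" if "\<omega> \<in> ?O" for \<omega>
    using that OW signed_roots_root_set by blast
  have fO: "finite ?O" using OW finite_signed_roots finite_subset by blast
  \<comment> \<open>A basis of the span of the signed highest roots; its size is the dimension of
    \<open>E_ST\<close>.\<close>
  obtain D where D: "D \<subseteq> ?O" "\<not> module.dependent fscale D" "card D = fs.dim ?O"
    using fs.basis_exists[of ?O] by metis
  have fD: "finite D" using D(1) fO finite_subset by blast
  have "d \<in> hdual sc h" if "d \<in> D" for d
    using ORt D(1) that roots_eq by (auto simp: roots_def)
  then obtain H where H: "\<And>d. d \<in> D \<Longrightarrow> H d \<in> h" 
    "\<And>d d'. d \<in> D \<Longrightarrow> d' \<in> D \<Longrightarrow> d (H d') = (if d = d' then 1 else 0)"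
    using dual_vectors[OF fD D(2)] by blast
  \<comment> \<open>Each \<open>d\<close> in \<open>D\<close> enters twice: as a root vector
    (\<open>Inl\<close>) and as its dual vector in \<open>h\<close> (\<open>Inr\<close>). At
    \<open>t = 0\<close> the signed cascade pairs with \<open>h\<close> only, in rank
    \<open>card D\<close>, so the cascade roots outside \<open>D\<close> are left out.\<close>
  define I where "I = Inl ` ((?signed_roots - ?O) \<union> D) \<union> Inr ` D"
  define vec where "vec = case_sum root_vector H"
  define wt where "wt = case_sum (\<lambda>w. w) (\<lambda>_::('g \<Rightarrow> 'k). 0 :: 'g \<Rightarrow> 'k)"
  have fI: "finite I" using finite_signed_roots fD by (simp add: I_def)
  have I_cases: "(\<exists>w. i = Inl w \<and> w \<in> ?signed_roots - ?O) \<or> (\<exists>d. i = Inl d \<and> d \<in> D) \<or> (\<exists>d. i = Inr d \<and> d \<in> D)"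
    if "i \<in> I" for i
    using that by (auto simp: I_def)
  have InlW: "w \<in> ?signed_roots" if "Inl w \<in> I" for w using that D(1) OW by (auto simp: I_def)
  have InlR: "w \<in> root_set" if "Inl w \<in> I" for w
    using InlW[OF that] signed_roots_root_set by blast
  have InrD: "d \<in> D" if "Inr d \<in> I" for d using that by (auto simp: I_def)
  have wt_root_lattice: "wt i \<in> root_lattice" and wt_out: "\<forall>x. x \<notin> h \<longrightarrow> wt i x = 0" and vec_weight_space: "vec i \<in> weight_space (wt i)"
    if "i \<in> I" for i
  proof -
    show "wt i \<in> root_lattice"
      using that InlR root_set_root_lattice root_lattice_0 by (cases i) (auto simp: wt_def)
    show "\<forall>x. x \<notin> h \<longrightarrow> wt i x = 0"
      using that InlR root_set_out by (cases i) (auto simp: wt_def)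
    show "vec i \<in> weight_space (wt i)"
      using that InlR root_vector InrD H(1) weight_space_0 by (cases i) (auto simp: wt_def vec_def)
  qed
  \<comment> \<open>Up to a nonzero factor the coordinate along \<omega>, read off by the Killing
    form; as a function on the whole algebra it is visibly linear.\<close>
  define k where "k \<omega> i j = killing (root_vector (- \<omega>)) (br (vec i) (vec j))"
    for \<omega> i j
  have k_ne: "\<omega> = wt i + wt j"
    if "k \<omega> i j \<noteq> 0" "i \<in> I" "j \<in> I" "\<omega> \<in> ?O" for \<omega> i j
  proof (rule ccontr)
    assume "\<omega> \<noteq> wt i + wt j"
    then have n: "- \<omega> + (wt i + wt j) \<noteq> 0"
      by (metis add.left_neutral add_minus_cancel add.right_neutral)
    have "k \<omega> i j = 0" unfolding k_def
    proof (rule killing_orth[OF _ _ n])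
      show "root_vector (- \<omega>) \<in> weight_space (- \<omega>)"
        using root_vector root_set_neg ORt that by blast
      show "br (vec i) (vec j) \<in> weight_space (wt i + wt j)"
        using weight_space_br vec_weight_space that by blast
      show "\<forall>x. x \<notin> h \<longrightarrow> (- \<omega>) x = 0"
        using root_set_out ORt that by (simp add: fun_Compl_def)
      show "\<forall>x. x \<notin> h \<longrightarrow> (wt i + wt j) x = 0" using wt_out that by simp
    qed
    then show False using that by simp
  qed
  have hle: "abs_ht \<omega> \<le> abs_ht (wt i) + abs_ht (wt j)"
    if "k \<omega> i j \<noteq> 0" "i \<in> I" "j \<in> I" "\<omega> \<in> ?O" for \<omega> i j
    using k_ne[OF that] abs_ht_add_le wt_root_lattice that by simp
  have k_anti: "k \<omega> j i = - k \<omega> i j" for \<omega> i j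
    unfolding k_def by (subst br_anti) (simp add: killing_neg_r)
  \<comment> \<open>The truncated subtraction is harmless: by \<open>hle\<close> a monomial with
    nonzero coefficient has a true nonnegative exponent.\<close>
  define p where "p i j = (\<Sum>\<omega>\<in>?O. monom (k \<omega> i j) (abs_ht (wt i) + abs_ht (wt j) - abs_ht \<omega>))"
    for i j
  have p_anti: "p j i = - p i j" for i j
    unfolding p_def by (simp add: k_anti[of _ i j] sum_negf[symmetric] minus_monom add.commute)
  have p0: "poly (p i j) 0 = (\<Sum>\<omega>\<in>?O. if abs_ht (wt i) + abs_ht (wt j) - abs_ht \<omega> = 0 then k \<omega> i j else 0)"
    for i j
    unfolding p_def poly_sum by (rule sum.cong) (auto simp: poly_monom)
  have p0_ne: "\<exists>\<omega>\<in>?O. \<omega> = wt i + wt j \<and> abs_ht (wt i) + abs_ht (wt j) = abs_ht \<omega> \<and> k \<omega> i j \<noteq> 0"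
    if ne: "poly (p i j) 0 \<noteq> 0" and ij: "i \<in> I" "j \<in> I" for i j
  proof -
    obtain \<omega> where w: "\<omega> \<in> ?O" "(if abs_ht (wt i) + abs_ht (wt j) - abs_ht \<omega> = 0 then k \<omega> i j else 0) \<noteq> 0"
    proof -
      have "\<exists>\<omega>\<in>?O. (if abs_ht (wt i) + abs_ht (wt j) - abs_ht \<omega> = 0 then k \<omega> i j else 0) \<noteq> 0"
      proof (rule ccontr)
        assume "\<not> ?thesis"
        then have "poly (p i j) 0 = 0" unfolding p0 by (intro sum.neutral) blast
        then show False using ne by simp
      qed
      then show thesis using that by blast
    qed
    then have "k \<omega> i j \<noteq> 0" "abs_ht (wt i) + abs_ht (wt j) - abs_ht \<omega> = 0"
      by (auto split: if_splits)
    then show ?thesis using w(1) k_ne[OF _ ij w(1)] hle[OF _ ij w(1)] by auto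
  qed
  have p0_I: "poly (p i j) 0 \<noteq> 0"
    if ij: "i \<in> I" "j \<in> I" and w: "\<omega> \<in> ?O" "abs_ht (wt i) + abs_ht (wt j) = abs_ht \<omega>" "k \<omega> i j \<noteq> 0"
      for i j \<omega>
  proof -
    have "poly (p i j) 0 = (\<Sum>\<omega>'\<in>?O. if \<omega>' = \<omega> then k \<omega> i j else 0)"
      unfolding p0
    proof (rule sum.cong[OF refl])
      fix \<omega>' assume w': "\<omega>' \<in> ?O"
      show "(if abs_ht (wt i) + abs_ht (wt j) - abs_ht \<omega>' = 0 then k \<omega>' i j else 0) = (if \<omega>' = \<omega> then k \<omega> i j else 0)"
        using k_ne[OF _ ij w'] k_ne[OF w(3) ij w(1)] w(2) by (cases "k \<omega>' i j = 0") auto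
    qed
    then show ?thesis using fO w by simp
  qed
  have br_H: "br (root_vector w) (H d) = sc (- w (H d)) (root_vector w)"
    if "w \<in> root_set" "d \<in> D" for w d
  proof -
    have "br (H d) (root_vector w) = sc (w (H d)) (root_vector w)"
      using h_act[OF root_vector(1)[OF that(1)] _ H(1)[OF that(2)]] root_set_out[OF that(1)] by blast
    then show ?thesis by (subst br_anti) simp
  qed
  have killing_root_vector: "killing (root_vector (- w)) (root_vector w) \<noteq> 0"
    if "w \<in> root_set" for w
    using killing_ne[OF that root_vector[OF that] root_vector[OF root_set_neg[OF that]]] killing_comm
    by metis
  \<comment> \<open>The bracket of the root vector of \<open>d\<close> with \<open>H d\<close> is
    minus that root vector, and weight 0 has height 0, so the exponent is 0.\<close>
  have D_pair: "poly (p (Inl d) (Inr d)) 0 \<noteq> 0" if d: "d \<in> D" for d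
  proof -
    have dR: "d \<in> root_set" "d \<in> ?O" using d D(1) ORt by auto
    have "k d (Inl d) (Inr d) = - killing (root_vector (- d)) (root_vector d)"
      using br_H[OF dR(1) d] H(2)[OF d d] by (simp add: k_def vec_def killing_neg_r)
    then show ?thesis using killing_root_vector[OF dR(1)] dR(2) d
      by (intro p0_I[of _ _ d]) (auto simp: I_def wt_def abs_ht_0)
  qed
  \<comment> \<open>A root outside the cascade meets its partner in the Heisenberg piece; the two
    vectors belonging to the same \<open>d\<close> meet each other.\<close>
  have ex: "\<exists>j\<in>I. poly (p i j) 0 \<noteq> 0" if i: "i \<in> I" for i
    using I_cases[OF i]
  proof (elim disjE exE conjE)
    fix w assume w: "i = Inl w" "w \<in> ?signed_roots - ?O"
    then obtain w' \<omega> where w': "w' \<in> ?signed_roots - ?O" "\<omega> \<in> ?O" "w + w' = \<omega>" "abs_ht w + abs_ht w' = abs_ht \<omega>" "cartan_int w \<omega> > 0"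
      using signed_roots_partner[OF ST, of w] by blast
    have R: "w \<in> root_set" "w' \<in> root_set" "\<omega> \<in> root_set"
      using w w' signed_roots_root_set ORt by auto
    have n: "br (root_vector w) (root_vector w') \<noteq> 0"
      by (rule br_sum_ne[OF R(1,2) _ _ root_vector[OF R(1)] root_vector[OF R(2)]]) (use R w' in auto)
    have g: "br (root_vector w) (root_vector w') \<in> weight_space \<omega>"
      using weight_space_br[OF root_vector(1)[OF R(1)] root_vector(1)[OF R(2)]] w' by simp
    have "k \<omega> (Inl w) (Inl w') \<noteq> 0"
      using killing_ne[OF R(3) g n root_vector[OF root_set_neg[OF R(3)]]] killing_comm
      by (simp add: k_def vec_def)
    then have "poly (p (Inl w) (Inl w')) 0 \<noteq> 0"
      using w w' by (intro p0_I[of _ _ \<omega>]) (auto simp: I_def wt_def)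
    moreover have "Inl w' \<in> I" using w' by (simp add: I_def)
    ultimately show ?thesis using w by blast
  next
    fix d assume d: "i = Inl d" "d \<in> D"
    then show ?thesis using D_pair[OF d(2)] by (auto simp: I_def)
  next
    fix d assume d: "i = Inr d" "d \<in> D"
    then show ?thesis using D_pair[OF d(2)] p_anti[of "Inr d" "Inl d"]
      by (intro bexI[of _ "Inl d"]) (auto simp: I_def)
  qed
  \<comment> \<open>A root outside the cascade meets only its partner. A cascade root is no summand
    of a cascade root, so \<open>d\<close> meets only vectors of \<open>h\<close>, and duality
    leaves \<open>H d\<close>. Conversely \<open>H d\<close> detects among the chosen cascade roots
    only \<open>d\<close>, and two vectors of \<open>h\<close> give weight 0, which is not a
    root.\<close>
  have un: "j = j'" if i: "i \<in> I" and j: "j \<in> I" and j': "j' \<in> I" and ne: "poly (p i j) 0 \<noteq> 0" "poly (p i j') 0 \<noteq> 0"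
    for i j j'
  proof -
    note j = j ne(1) and j' = j' ne(2)
    have z: "0 \<notin> ?O" using ORt by (auto simp: root_set_def)
    show ?thesis
    proof (cases i)
      case (Inl w)
      have wW: "w \<in> ?signed_roots" using InlW i Inl by simp
      have a: "u \<in> ?signed_roots \<and> w + u \<in> ?O \<and> abs_ht w + abs_ht u = abs_ht (w + u)"
        if "Inl u \<in> I" "poly (p i (Inl u)) 0 \<noteq> 0" for u
        using p0_ne[OF that(2) i that(1)] InlW[OF that(1)] Inl by (auto simp: wt_def)
      have b: "w \<in> ?O \<and> w (H d) \<noteq> 0"
        if "Inr d \<in> I" "poly (p i (Inr d)) 0 \<noteq> 0" for d
        using p0_ne[OF that(2) i that(1)] Inl br_H[OF signed_roots_root_set[OF wW] InrD[OF that(1)]]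
        by (auto simp: wt_def k_def vec_def killing_neg_r killing_sc_r)
      have c: "w = d" if "Inr d \<in> I" "poly (p i (Inr d)) 0 \<noteq> 0" for d
      proof -
        have "w \<in> D" using b[OF that] i Inl by (auto simp: I_def)
        then have "w (H d) = (if w = d then 1 else 0)" using H(2) InrD[OF that(1)] by blast
        then show ?thesis using b[OF that] by metis
      qed
      show ?thesis
      proof (cases j)
        case ju: (Inl u)
        note au = a[of u, folded ju, OF j]
        have nO: "w \<notin> ?O" using signed_roots_sum(1)[OF ST wW] au by blast
        show ?thesis
        proof (cases j')
          case ju': (Inl u')
          show ?thesis using signed_roots_sum(2)[OF ST wW, of u u'] au a[of u', folded ju', OF j'] ju ju'
            by blast
        next
          case (Inr d) then show ?thesis using b j' nO by blast
        qed
      next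
        case jd: (Inr d)
        have wd: "w = d" "w \<in> ?O" using c[of d] b[of d] j jd by auto
        show ?thesis
        proof (cases j')
          case ju': (Inl u')
          then show ?thesis using signed_roots_sum(1)[OF ST wW, of u'] a[of u', folded ju', OF j'] wd
            by blast
        next
          case (Inr d') then show ?thesis using c[of d'] j' wd jd by simp
        qed
      qed
    next
      case (Inr d)
      have dD: "d \<in> D" using InrD i Inr by simp
      have "x = Inl d" if x: "x \<in> I" "poly (p i x) 0 \<noteq> 0" for x
      proof (cases x)
        case xu: (Inl u)
        obtain \<omega> where o: "\<omega> \<in> ?O" "\<omega> = wt i + wt x" "k \<omega> i x \<noteq> 0"
          using p0_ne[OF x(2) i x(1)] by blast
        have u: "u \<in> ?O" "\<omega> = u" using o Inr xu by (auto simp: wt_def)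
        then have uD: "u \<in> D" using x(1) xu by (auto simp: I_def)
        have "k u x i \<noteq> 0" using o(3) k_anti[of u x i] u by simp
        then have "u (H d) \<noteq> 0"
          using br_H[OF ORt[OF u(1)] dD] xu Inr by (auto simp: k_def vec_def killing_neg_r killing_sc_r)
        then show ?thesis using H(2)[OF uD dD] xu by (auto split: if_splits)
      next
        case (Inr e)
        then show ?thesis using p0_ne[OF x(2) i x(1)] z \<open>i = Inr d\<close> by (auto simp: wt_def)
      qed
      from this[OF j] this[OF j'] show ?thesis by simp
    qed
  qed
  obtain t where t: "t \<noteq> 0"
    "\<forall>x. (\<forall>j\<in>I. (\<Sum>i\<in>I. x i * poly (p i j) t) = 0) \<longrightarrow> (\<forall>i\<in>I. x i = 0)"
    by (rule poly_monomial_nonsing[OF fI p_anti ex un])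
  \<comment> \<open>Negative powers of \<open>t\<close> on the coordinates and positive ones on the
    vectors \<open>v\<close> combine to the exponents of \<open>p\<close>.\<close>
  define f where "f Y = (\<Sum>\<omega>\<in>?O. inverse t ^ abs_ht \<omega> * killing (root_vector (- \<omega>)) Y)"
    for Y
  define v where "v i = sc (t ^ abs_ht (wt i)) (vec i)" for i
  have f_add: "f (x + y) = f x + f y" and f_sc: "f (sc c x) = c * f x" for x y c
    by (simp_all add: f_def killing_add_r killing_sc_r distrib_left sum.distrib sum_distrib_left mult_ac)
  have fl: "f (br (\<Sum>i\<in>I. sc (c i) (v i)) y) = (\<Sum>i\<in>I. c i * f (br (v i) y))" for c y
  proof -
    have f0: "f 0 = 0" using f_sc[of 0 0] by simp
    have "f (br (\<Sum>i\<in>A. sc (c i) (v i)) y) = (\<Sum>i\<in>A. c i * f (br (v i) y))"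
      if "finite A" for A
      using that by (induction A rule: finite_induct) (simp_all add: f0 br_add_l br_sc_l f_add f_sc)
    then show ?thesis using fI by blast
  qed
  have fv: "f (br (v i) (v j)) = poly (p i j) t" if ij: "i \<in> I" "j \<in> I" for i j
  proof -
    have "f (br (v i) (v j)) = t ^ abs_ht (wt i) * (t ^ abs_ht (wt j) * f (br (vec i) (vec j)))"
      by (simp add: v_def br_sc_l br_sc_r f_sc)
    also have "\<dots> = (\<Sum>\<omega>\<in>?O. t ^ abs_ht (wt i) * t ^ abs_ht (wt j) * inverse t ^ abs_ht \<omega> * k \<omega> i j)"
      by (simp add: f_def k_def sum_distrib_left mult_ac)
    also have "\<dots> = poly (p i j) t"
      unfolding p_def poly_sum poly_monom
    proof (rule sum.cong[OF refl])
      fix \<omega> assume w: "\<omega> \<in> ?O"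
      show "t ^ abs_ht (wt i) * t ^ abs_ht (wt j) * inverse t ^ abs_ht \<omega> * k \<omega> i j = k \<omega> i j * t ^ (abs_ht (wt i) + abs_ht (wt j) - abs_ht \<omega>)"
      proof (cases "k \<omega> i j = 0")
        case False
        then have le: "abs_ht \<omega> \<le> abs_ht (wt i) + abs_ht (wt j)" using hle[OF _ ij w] by blast
        have "t ^ (abs_ht (wt i) + abs_ht (wt j)) = t ^ (abs_ht (wt i) + abs_ht (wt j) - abs_ht \<omega>) * t ^ abs_ht \<omega>"
          using le by (simp add: power_add[symmetric])
        then have "t ^ abs_ht (wt i) * t ^ abs_ht (wt j) * inverse t ^ abs_ht \<omega> = t ^ (abs_ht (wt i) + abs_ht (wt j) - abs_ht \<omega>)"
          using t(1) by (simp add: power_add field_simps)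
        then show ?thesis by simp
      qed simp
    qed
    finally show ?thesis .
  qed
  have sa: "subspace ?a" using g_ST_eq[OF ST] by simp
  have va: "v i \<in> ?a" if i: "i \<in> I" for i
  proof -
    have "vec i \<in> h \<union> (\<Union>w\<in>?signed_roots. weight_space w)"
      using vec_weight_space[OF i] InlW InrD i H(1) by (cases i) (auto simp: wt_def vec_def)
    then show ?thesis unfolding v_def g_ST_eq[OF ST] by (intro span_scale span_base)
  qed
  let ?A = "{X \<in> ?a. \<forall>Y\<in>?a. f (br X Y) = 0}"
  have f0: "f 0 = 0" using f_sc[of 0 0] by simp
  have sA: "subspace ?A"
    using sa
    by (intro subspaceI) (auto simp: br_add_l br_sc_l f_add f_sc f0 intro: subspace_0 subspace_add subspace_scale)
  \<comment> \<open>A combination of the \<open>v i\<close> in the kernel is in particular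
    orthogonal to every \<open>v j\<close>; its coefficients solve the nonsingular system.\<close>
  have "dim ?A + card I \<le> dim ?a"
  proof (rule dim_complement_le[OF sA _ sa va fI])
    fix c assume c: "(\<Sum>i\<in>I. sc (c i) (v i)) \<in> ?A"
    show "\<forall>i\<in>I. c i = 0"
    proof (rule t(2)[THEN spec, THEN mp], intro ballI)
      fix j assume j: "j \<in> I"
      have "f (br (\<Sum>i\<in>I. sc (c i) (v i)) (v j)) = 0" using c va[OF j] by blast
      then show "(\<Sum>i\<in>I. c i * poly (p i j) t) = 0" unfolding fl using fv j by simp
    qed
  qed auto
  moreover have "lie_index sc br ?a \<le> dim ?A"
    unfolding lie_index_def
  proof (rule Least_le, intro exI conjI)
    show "dual_on sc ?a f" by (simp add: dual_on_def f_add f_sc)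
  qed simp
  moreover have "card I = card ?signed_roots - card ?O + 2 * card D"
  proof -
    have "card I = card ((?signed_roots - ?O) \<union> D) + card D"
      unfolding I_def using finite_signed_roots fD by (subst card_Un_disjoint) (auto simp: card_image)
    also have "card ((?signed_roots - ?O) \<union> D) = card (?signed_roots - ?O) + card D"
      using finite_signed_roots fD D(1) by (intro card_Un_disjoint) auto
    also have "card (?signed_roots - ?O) = card ?signed_roots - card ?O"
      using OW fO by (intro card_Diff_subset)
    finally show ?thesis by simp
  qed
  moreover have "card ?O \<le> card ?signed_roots" using OW finite_signed_roots by (intro card_mono)
  ultimately show ?thesis using dim_g_ST[OF ST] D(3) by linarith
qed

text \<open>The sign keeps the two cascades apart: a set in both K(S) and K(T) contributes a
  positive and a negative root and is counted twice.\<close>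

lemma card_signed_cascade:
  assumes ST: "S \<subseteq> B" "T \<subseteq> B"
  shows "card (signed_cascade S T) = card (Kset sc br h S) + card (Kset sc br h T)"
proof -
  have "cascade S \<inter> uminus ` cascade T = {}"
  proof -
    have False if w: "w \<in> cascade S" "w = - u" "u \<in> cascade T" for w u
    proof -
      have "w \<in> pos_roots S" "u \<in> pos_roots T" using w cascade_pos_roots ST by blast+
      then show False using pos_roots_pos[of w S] pos_roots_pos[of u T] ht_neg[OF pos_roots_root_lattice, of u T] w(2)
        by simp
    qed
    then show ?thesis by blast
  qed
  then have "card (signed_cascade S T) = card (cascade S) + card (uminus ` cascade T)"
    unfolding signed_cascade_def using finite_cascade ST by (intro card_Un_disjoint) auto
  also have "card (uminus ` cascade T) = card (cascade T)" by (rule card_image) (simp add: inj_on_def)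
  finally show ?thesis using card_cascade ST by simp
qed

text \<open>A span does not change when generators are negated.\<close>

lemma dim_E_ST: "vector_space.dim fscale (E_ST sc br h S T) = fs.dim (signed_cascade S T)"
proof -
  have e: "highest_root sc br h ` (Kset sc br h S \<union> Kset sc br h T) = cascade S \<union> cascade T"
    by (simp add: cascade_def image_Un)
  have "fs.span (cascade S \<union> cascade T) = fs.span (signed_cascade S T)"
    unfolding fs.span_eq
  proof
    show "cascade S \<union> cascade T \<subseteq> fs.span (signed_cascade S T)"
    proof
      fix u assume "u \<in> cascade S \<union> cascade T"
      then consider "u \<in> signed_cascade S T" | "- u \<in> signed_cascade S T"
        by (auto simp: signed_cascade_def)
      then show "u \<in> fs.span (signed_cascade S T)"
      proof cases
        case 2
        then have "- (- u) \<in> fs.span (signed_cascade S T)" by (intro fs.span_neg fs.span_base)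
        then show ?thesis by simp
      qed (rule fs.span_base)
    qed
    show "signed_cascade S T \<subseteq> fs.span (cascade S \<union> cascade T)"
      unfolding signed_cascade_def
      by (auto intro: fs.span_base fs.span_neg)
  qed
  then show ?thesis unfolding E_ST_def e by simp
qed

end

theorem theorem3p9:
  fixes sc :: "'k::field_char_0 \<Rightarrow> 'g::ab_group_add \<Rightarrow> 'g"
    and br :: "'g \<Rightarrow> 'g \<Rightarrow> 'g"
    and h :: "'g set"
    and B S T :: "('g \<Rightarrow> 'k) set"
  assumes alg_closed: "\<forall>p :: 'k poly. 0 < degree p \<longrightarrow> (\<exists>x. poly p x = 0)"
    and "semisimple sc br"
    and "finite_dim sc"
    and "cartan sc br h"
    and "is_base sc br h B"
    and "S \<subseteq> B" and "T \<subseteq> B"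
  shows "int (lie_index sc br (g_ST sc br h S T))
           \<le> int (vector_space.dim sc h) + int (card (Kset sc br h S)) + int (card (Kset sc br h T))
             - 2 * int (vector_space.dim fscale (E_ST sc br h S T))"
proof -
  have la: "lie_algebra sc br" using assms(2) by (simp add: semisimple_def)
  then interpret vector_space sc by (simp add: lie_algebra_def)
  obtain C where C: "finite C" "span C = UNIV" using assms(3) by (auto simp: finite_dim_def)
  obtain Basis where Basis: "Basis \<subseteq> C" "independent Basis" "C \<subseteq> span Basis"
    using maximal_independent_subset[of C] by blast
  have "finite Basis" using Basis(1) C(1) finite_subset by blast
  moreover have "span Basis = UNIV"
    using span_mono[OF Basis(3)] C(2) by (metis span_span top.extremum_unique)
  ultimately interpret lie_base sc Basis br h B
    by unfold_locales (use assms la Basis(2) in auto)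
  \<comment> \<open>Makes the truncated subtraction in \<open>index_bound\<close> a true
    one.\<close>
  have "card (signed_cascade S T) \<le> card (signed_roots S T)"
    using signed_cascade_signed_roots[OF assms(6,7)] finite_signed_roots by (intro card_mono)
  then show ?thesis using index_bound[OF assms(6,7)] card_signed_cascade[OF assms(6,7)] dim_E_ST[of S T]
    by linarith
qed

end
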